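(* Let $Z=\{Z_t,t\ge 0\}$ be a continuous centered stationary Gaussian process with $f_Z:=\mathbb{E}[Z_0^2]>0$ and covariance $\rho(t)=\rho(-t):=\mathbb{E}[Z_0Z_t]$, $t\ge0$. Assume $\int_{\mathbb{R}}\rho^2(r)\,dr<\infty$ and that $\mathbb{E}[|Z_t-Z_s|^2]\le c|t-s|^{2\alpha}$ for some $c>0$ and $\alpha\in(0,1)$ whenever $|t-s|$ is small enough. Let $\mathcal{N}\sim\mathcal{N}(0,1)$. If $\Delta_n\to0$ and $T_n:=n\Delta_n\to\infty$ as $n\to\infty$, then there is $C>0$ such that, for every $n\ge1$, $$d_{TV}\left(\frac{\widetilde f_n(Z)-f_Z}{\sqrt{\mathrm{Var}(\widetilde f_n(Z)-f_Z)}},\mathcal{N}\right)\le\varphi_{T_n}(Z)+2\left|1-\frac{\mathrm{Var}(\widehat f_{T_n}(Z)-f_Z)}{\mathrm{Var}(\widetilde f_n(Z)-f_Z)}\right|+C\left[n\Delta_n^{2\alpha+1}\right]^{1/4},$$ where, for $T>0$, $$\varphi_T(Z)=C\max\left\{\frac{8}{\sqrt T}\left(\int_{-T}^T|\rho(t)|^{3/2}dt\right)^2,\ \frac{48}{T}\left(\int_{-T}^T|\rho(t)|^{4/3}dt\right)^3\right\}.$$ The same result holds with $d_{TV}$ replaced by the Wasserstein distance $d_W$.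
   Context: For a sequence of step sizes $\Delta_n>0$, set $t_i=i\Delta_n$, $i=0,\dots,n$. The estimators are $\widehat f_T(Z):=\frac1T\int_0^TZ_t^2\,dt$ for $T>0$, and $\widetilde f_n(Z):=\frac1n\sum_{i=1}^nZ_{t_i}^2$ for $n\ge1$. For real random variables $X,Y$: $d_{TV}(X,Y)=\sup_{A}|\mathbb{P}[X\in A]-\mathbb{P}[Y\in A]|$ (supremum over Borel sets $A\subset\mathbb{R}$) and $d_W(X,Y)=\sup_f|\mathbb{E}[f(X)]-\mathbb{E}[f(Y)]|$ (supremum over functions $f:\mathbb{R}\to\mathbb{R}$ with Lipschitz constant at most $1$). *)

theory Defs
  imports "HOL-Probability.Probability"
begin

(* A process indexed by [0, infinity) is a function Z :: real => 'a => real; only its values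
   at times t >= 0 are ever constrained or used. *)

(* The second disjunct is the degenerate law N(m,0): normal_density needs a positive
   standard deviation. *)
definition gaussian_rv :: "'a measure \<Rightarrow> ('a \<Rightarrow> real) \<Rightarrow> bool" where
  "gaussian_rv M X \<longleftrightarrow> X \<in> borel_measurable M \<and>
     ((\<exists>m \<sigma>. \<sigma> > 0 \<and> distributed M lborel X (normal_density m \<sigma>)) \<or>
      (\<exists>m. AE \<omega> in M. X \<omega> = m))"

definition gaussian_process :: "'a measure \<Rightarrow> (real \<Rightarrow> 'a \<Rightarrow> real) \<Rightarrow> bool" where
  "gaussian_process M Z \<longleftrightarrow>
     (\<forall>I a. finite I \<longrightarrow> I \<subseteq> {0..} \<longrightarrow> gaussian_rv M (\<lambda>\<omega>. \<Sum>t\<in>I. a t * Z t \<omega>))"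

definition centered_process :: "'a measure \<Rightarrow> (real \<Rightarrow> 'a \<Rightarrow> real) \<Rightarrow> bool" where
  "centered_process M Z \<longleftrightarrow> (\<forall>t\<ge>0. integral\<^sup>L M (Z t) = 0)"

(* strict stationarity: shift invariance of all finite-dimensional distributions *)
definition stationary_process :: "'a measure \<Rightarrow> (real \<Rightarrow> 'a \<Rightarrow> real) \<Rightarrow> bool" where
  "stationary_process M Z \<longleftrightarrow>
     (\<forall>I h. finite I \<longrightarrow> I \<subseteq> {0..} \<longrightarrow> h \<ge> 0 \<longrightarrow>
        distr M (PiM I (\<lambda>_. borel)) (\<lambda>\<omega>. \<lambda>t\<in>I. Z (t + h) \<omega>) =
        distr M (PiM I (\<lambda>_. borel)) (\<lambda>\<omega>. \<lambda>t\<in>I. Z t \<omega>))"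

definition continuous_process :: "'a measure \<Rightarrow> (real \<Rightarrow> 'a \<Rightarrow> real) \<Rightarrow> bool" where
  "continuous_process M Z \<longleftrightarrow> (\<forall>\<omega>\<in>space M. continuous_on {0..} (\<lambda>t. Z t \<omega>))"

definition autocov :: "'a measure \<Rightarrow> (real \<Rightarrow> 'a \<Rightarrow> real) \<Rightarrow> real \<Rightarrow> real" where
  "autocov M Z t = (\<integral>\<omega>. Z 0 \<omega> * Z \<bar>t\<bar> \<omega> \<partial>M)"

definition f_Z :: "'a measure \<Rightarrow> (real \<Rightarrow> 'a \<Rightarrow> real) \<Rightarrow> real" where
  "f_Z M Z = (\<integral>\<omega>. (Z 0 \<omega>)\<^sup>2 \<partial>M)"

definition f_hat :: "(real \<Rightarrow> 'a \<Rightarrow> real) \<Rightarrow> real \<Rightarrow> 'a \<Rightarrow> real" where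
  "f_hat Z T \<omega> = 1 / T * (LBINT t:{0..T}. (Z t \<omega>)\<^sup>2)"

definition f_tilde :: "(real \<Rightarrow> 'a \<Rightarrow> real) \<Rightarrow> (nat \<Rightarrow> real) \<Rightarrow> nat \<Rightarrow> 'a \<Rightarrow> real" where
  "f_tilde Z \<Delta> n \<omega> = 1 / real n * (\<Sum>i=1..n. (Z (real i * \<Delta> n) \<omega>)\<^sup>2)"

definition d_TV :: "'a measure \<Rightarrow> ('a \<Rightarrow> real) \<Rightarrow> 'b measure \<Rightarrow> ('b \<Rightarrow> real) \<Rightarrow> real" where
  "d_TV M X N Y =
     (SUP A\<in>sets borel. \<bar>measure M {\<omega>\<in>space M. X \<omega> \<in> A} - measure N {\<omega>\<in>space N. Y \<omega> \<in> A}\<bar>)"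

(* Extended-real valued, so that the supremum is meaningful without knowing it to be finite;
   only meant for integrable X and Y, for which all the expectations exist. *)
definition d_W :: "'a measure \<Rightarrow> ('a \<Rightarrow> real) \<Rightarrow> 'b measure \<Rightarrow> ('b \<Rightarrow> real) \<Rightarrow> ereal" where
  "d_W M X N Y =
     (SUP f\<in>{f :: real \<Rightarrow> real. 1-lipschitz_on UNIV f}.
        ereal \<bar>(\<integral>\<omega>. f (X \<omega>) \<partial>M) - (\<integral>\<omega>. f (Y \<omega>) \<partial>N)\<bar>)"

definition normalized_error ::
  "'a measure \<Rightarrow> (real \<Rightarrow> 'a \<Rightarrow> real) \<Rightarrow> (nat \<Rightarrow> real) \<Rightarrow> nat \<Rightarrow> 'a \<Rightarrow> real" where
  "normalized_error M Z \<Delta> n \<omega> =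
     (f_tilde Z \<Delta> n \<omega> - f_Z M Z) /
     sqrt (prob_space.variance M (\<lambda>\<omega>. f_tilde Z \<Delta> n \<omega> - f_Z M Z))"

definition \<phi> :: "real \<Rightarrow> 'a measure \<Rightarrow> (real \<Rightarrow> 'a \<Rightarrow> real) \<Rightarrow> real \<Rightarrow> real" where
  "\<phi> C M Z T = C * max
     (8 / sqrt T * (LBINT t:{-T..T}. \<bar>autocov M Z t\<bar> powr (3/2))\<^sup>2)
     (48 / T * (LBINT t:{-T..T}. \<bar>autocov M Z t\<bar> powr (4/3)) ^ 3)"

end

theory Submission
  imports Defs
begin

text \<open>
The normalized error at stage \<open>n\<close> is a quadratic form in the finitely many jointly Gaussian variables
\<open>Z\<^sub>k = Z (k \<Delta>\<^sub>n)\<close>, \<open>1 \<le> k \<le> n\<close>: if \<open>R\<close> is their covariance matrix and \<open>a = (2 tr R\<^sup>2)\<^sup>-\<^sup>1\<^sup>/\<^sup>2\<close>, it equals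
\<open>F = a (\<Sum>k. Z\<^sub>k\<^sup>2 - R\<^sub>k\<^sub>k)\<close>, which has mean \<open>0\<close> and variance \<open>1\<close>. Hence the approximation by a Gaussian can be carried
out for this finite quadratic form itself, and the only analytic input about the process is its covariance function
\<open>\<rho>\<close>.

Stein's method turns both distances into bounds on \<open>E[f'(F) - F f(F)]\<close>, where \<open>f\<close> solves Stein's equation for a test
function. For test functions with values in \<open>[0,1]\<close> and for \<open>1\<close>-Lipschitz test functions alike, \<open>\<bar>f'\<bar> \<le> 2\<close>
(\<open>half_line_bound_bounded\<close>, \<open>half_line_bound_lipschitz\<close>, \<open>stein_equation_solution\<close>), while for indicator functions no
bound on \<open>f''\<close> is available. (Total variation is reduced to continuous test functions by inner regularity, in
\<open>abs_measure_diff_le_of_continuous\<close>.) The usual argument gives \<open>E[f'(F) - F f(F)] = - 2 E[Y f'(F)]\<close>, where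
\<open>Y = a\<^sup>2 \<langle>Z, R Z\<rangle> - 1/2\<close> is a centred quadratic form; the Cauchy-Schwarz inequality would then lose the optimal rate.
Instead, Gaussian integration by parts is applied twice more, to \<open>E[F f(F) Y]\<close> through its factor \<open>F\<close> and through its
factor \<open>Y\<close> (\<open>stein_identity_F\<close>, \<open>stein_identity_Y\<close>). Comparing the two results gives the exact identity
\<open>E[f'(F) - F f(F)] = 4 E[Y\<^sup>2 f'(F)] - 4 a\<^sup>3 E[\<bar>R Z\<bar>\<^sup>2 F f'(F)]\<close>,
which involves \<open>f'\<close> only. Since \<open>R\<close> is a covariance matrix, both \<open>E[Y\<^sup>2]\<close> and \<open>a\<^sup>3 E[\<bar>R Z\<bar>\<^sup>2 \<bar>F\<bar>]\<close> are at most a constant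
times \<open>\<tau> = a\<^sup>3 tr R\<^sup>3\<close>, one eighth of the third cumulant of \<open>F\<close> (\<open>stein_discrepancy_bound\<close>). Thus both distances are
at most \<open>28 \<tau>\<close>, and \<open>\<tau> \<le> 1\<close>.

It remains to estimate \<open>\<tau>\<close> (\<open>sampled_tau_le\<close>). With \<open>T = n \<Delta>\<^sub>n\<close>: as \<open>\<rho>\<close> is bounded away from \<open>0\<close> near the origin,
\<open>tr R\<^sup>2\<close> is at least of order \<open>n\<^sup>2 / T\<close>; by the inequality of arithmetic and geometric means, \<open>tr R\<^sup>3\<close> is at most \<open>n\<close> times
the squared maximal row sum of \<open>\<bar>R\<^sub>i\<^sub>j\<bar>\<^sup>3\<^sup>/\<^sup>2\<close>; and the Hoelder continuity of \<open>\<rho>\<close>, inherited from the increments of \<open>Z\<close>,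
compares these row sums with integrals. The outcome is a bound by a multiple of
\<open>(\<integral>\<bar>\<rho>\<bar>\<^sup>3\<^sup>/\<^sup>2)\<^sup>2 / \<surd>T + (T \<Delta>\<^sub>n\<^sup>2\<^sup>\<alpha>)\<^sup>3\<^sup>/\<^sup>2\<close> for all large \<open>n\<close>. The first term is controlled by the first entry of the maximum in
\<open>\<phi>\<close>, the second by \<open>(n \<Delta>\<^sub>n\<^sup>2\<^sup>\<alpha>\<^sup>+\<^sup>1)\<^sup>1\<^sup>/\<^sup>4\<close> when \<open>T \<Delta>\<^sub>n\<^sup>2\<^sup>\<alpha> \<le> 1\<close>, and otherwise \<open>\<tau> \<le> 1\<close> suffices. The finitely many remaining \<open>n\<close> are
absorbed in the constant.

The process is given through the laws of its linear combinations only. Integration by parts for a vector of this kind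
needs its joint law, which is recovered from cosine transforms (\<open>joint_cosine_uniqueness\<close>) and used to exchange one
coordinate for an independent standard normal variable (\<open>regression_law\<close>).
\<close>

section \<open>Joint laws are determined by cosine transforms\<close>

text \<open>Normalizing the weights to probability densities reduces the claim to the uniqueness theorem for characteristic functions
of real random variables. The phase \<open>\<theta>\<close> stands for both parts of a characteristic function, so that all integrals stay real.
Weights make it possible to treat several coordinates one after the other.\<close>

lemma weighted_cosine_uniqueness:
  fixes X w :: "'a \<Rightarrow> real" and X' w' :: "'b \<Rightarrow> real"
  assumes "prob_space M" "prob_space M'"
    and [measurable]: "X \<in> borel_measurable M" "X' \<in> borel_measurable M'"
      "w \<in> borel_measurable M" "w' \<in> borel_measurable M'"
    and w: "\<And>\<omega>. 0 \<le> w \<omega>" "\<And>\<omega>. w \<omega> \<le> B" and w': "\<And>\<omega>. 0 \<le> w' \<omega>" "\<And>\<omega>. w' \<omega> \<le> B"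
    and cos_eq: "\<And>s \<theta>. (\<integral>\<omega>. w \<omega> * cos (s * X \<omega> + \<theta>) \<partial>M) = (\<integral>\<omega>. w' \<omega> * cos (s * X' \<omega> + \<theta>) \<partial>M')"
    and A[measurable]: "A \<in> sets borel"
  shows "(\<integral>\<omega>. w \<omega> * indicator A (X \<omega>) \<partial>M) = (\<integral>\<omega>. w' \<omega> * indicator A (X' \<omega>) \<partial>M')"
proof -
  interpret M: prob_space M by fact
  interpret M': prob_space M' by fact
  have B: "0 \<le> B" using w order_trans by blast
  have intw: "integrable M w" by (rule M.integrable_const_bound[where B=B]) (use w in auto)
  have intw': "integrable M' w'" by (rule M'.integrable_const_bound[where B=B]) (use w' in auto)
  define c where "c = (\<integral>\<omega>. w \<omega> \<partial>M)"
  have c': "c = (\<integral>\<omega>. w' \<omega> \<partial>M')" using cos_eq[of 0 0] by (simp add: c_def)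
  have "c \<ge> 0" unfolding c_def by (intro integral_nonneg_AE) (simp add: w)
  show ?thesis
  proof (cases "c = 0")
    case True
    have a: "AE \<omega> in M. w \<omega> = 0"
      using integral_nonneg_eq_0_iff_AE[OF intw] w True by (simp add: c_def)
    have a': "AE \<omega> in M'. w' \<omega> = 0"
      using integral_nonneg_eq_0_iff_AE[OF intw'] w' True by (simp add: c')
    have "(\<integral>\<omega>. w \<omega> * indicator A (X \<omega>) \<partial>M) = 0"
      by (subst integral_cong_AE[where g="\<lambda>_. 0"]) (use a in auto)
    moreover have "(\<integral>\<omega>. w' \<omega> * indicator A (X' \<omega>) \<partial>M') = 0"
      by (subst integral_cong_AE[where g="\<lambda>_. 0"]) (use a' in auto)
    ultimately show ?thesis by simp
  next
    case False
    with \<open>c \<ge> 0\<close> have c: "c > 0" by simp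
    \<comment> \<open>The phases 0 and - pi/2 give the real and the imaginary part of the characteristic function.\<close>
    have main: "real_distribution (distr (density L (\<lambda>\<omega>. ennreal (v \<omega> / c))) borel Y) \<and>
        char (distr (density L (\<lambda>\<omega>. ennreal (v \<omega> / c))) borel Y) t =
          Complex ((\<integral>\<omega>. v \<omega> * cos (t * Y \<omega> + 0) \<partial>L) / c) ((\<integral>\<omega>. v \<omega> * cos (t * Y \<omega> + (- pi/2)) \<partial>L) / c) \<and>
        measure (distr (density L (\<lambda>\<omega>. ennreal (v \<omega> / c))) borel Y) A = (\<integral>\<omega>. v \<omega> * indicator A (Y \<omega>) \<partial>L) / c"
      if "prob_space L" and [measurable]: "Y \<in> borel_measurable L" "v \<in> borel_measurable L"
        and v: "\<And>\<omega>. 0 \<le> v \<omega>" "\<And>\<omega>. v \<omega> \<le> B" and cv: "c = (\<integral>\<omega>. v \<omega> \<partial>L)" for L :: "'c measure" and Y v t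
    proof -
      interpret L: prob_space L by fact
      have iv: "integrable L v" by (rule L.integrable_const_bound[where B=B]) (use v in auto)
      let ?D = "density L (\<lambda>\<omega>. ennreal (v \<omega> / c))"
      have "emeasure ?D (space ?D) = (\<integral>\<^sup>+\<omega>. ennreal (v \<omega> / c) \<partial>L)"
        by (simp add: emeasure_density cong: nn_integral_cong)
      also have "\<dots> = ennreal (\<integral>\<omega>. v \<omega> / c \<partial>L)"
        by (rule nn_integral_eq_integral) (use iv v c in auto)
      also have "\<dots> = 1" using cv c by simp
      finally have D: "prob_space ?D" by (intro prob_spaceI) auto
      have 1: "real_distribution (distr ?D borel Y)"
        by (intro real_distribution.intro prob_space.prob_space_distr[OF D] real_distribution_axioms.intro) auto
      have bnd: "integrable L (\<lambda>\<omega>. (v \<omega> / c) *\<^sub>R iexp (t * Y \<omega>))"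
        by (rule L.integrable_const_bound[where B="B/c"]) (use v c in \<open>auto simp: divide_right_mono\<close>)
      have "char (distr ?D borel Y) t = (\<integral>\<omega>. (v \<omega> / c) *\<^sub>R iexp (t * Y \<omega>) \<partial>L)"
        unfolding char_def using v c by (simp add: integral_distr integral_density)
      also have "\<dots> = Complex ((\<integral>\<omega>. v \<omega> * cos (t * Y \<omega> + 0) \<partial>L) / c) ((\<integral>\<omega>. v \<omega> * cos (t * Y \<omega> + (- pi/2)) \<partial>L) / c)"
      proof (rule complex_eqI)
        show "Re (\<integral>\<omega>. (v \<omega> / c) *\<^sub>R iexp (t * Y \<omega>) \<partial>L) = Re (Complex ((\<integral>\<omega>. v \<omega> * cos (t * Y \<omega> + 0) \<partial>L) / c) ((\<integral>\<omega>. v \<omega> * cos (t * Y \<omega> + (- pi/2)) \<partial>L) / c))"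
          by (subst integral_Re[symmetric, OF bnd]) (simp add: Re_exp)
        have "cos (t * Y \<omega> + (- pi/2)) = sin (t * Y \<omega>)" for \<omega> 
          by (simp add: cos_sin_eq cos_add)
        then show "Im (\<integral>\<omega>. (v \<omega> / c) *\<^sub>R iexp (t * Y \<omega>) \<partial>L) = Im (Complex ((\<integral>\<omega>. v \<omega> * cos (t * Y \<omega> + 0) \<partial>L) / c) ((\<integral>\<omega>. v \<omega> * cos (t * Y \<omega> + (- pi/2)) \<partial>L) / c))"
          by (subst integral_Im[symmetric, OF bnd]) (simp add: Im_exp)
      qed
      finally have 2: "char (distr ?D borel Y) t = \<dots>" .
      have "measure (distr ?D borel Y) A = (\<integral>x. indicator A x \<partial>distr ?D borel Y)" by simp
      also have "\<dots> = (\<integral>\<omega>. (v \<omega> / c) *\<^sub>R indicator A (Y \<omega>) \<partial>L)"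
        using v c by (subst integral_distr) (auto simp: integral_density)
      finally have 3: "measure (distr ?D borel Y) A = (\<integral>\<omega>. v \<omega> * indicator A (Y \<omega>) \<partial>L) / c" by simp
      show ?thesis using 1 2 3 by blast
    qed
    note m = main[OF \<open>prob_space M\<close> assms(3,5) w c_def]
    note m' = main[OF \<open>prob_space M'\<close> assms(4,6) w' c']
    have "distr (density M (\<lambda>\<omega>. ennreal (w \<omega> / c))) borel X = distr (density M' (\<lambda>\<omega>. ennreal (w' \<omega> / c))) borel X'"
    proof (rule Levy_uniqueness)
      show "char (distr (density M (\<lambda>\<omega>. ennreal (w \<omega> / c))) borel X) = char (distr (density M' (\<lambda>\<omega>. ennreal (w' \<omega> / c))) borel X')"
        by (rule ext) (simp only: m m' cos_eq)
    qed (use m m' in auto)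
    then show ?thesis using m m' c by simp
  qed
qed

text \<open>The Cramer-Wold theorem for finite families. Coordinates are moved one at a time from the cosine into indicator functions.
In each step the variables already moved, together with the remaining cosine, act as a weight on the law of the next
coordinate.\<close>

lemma joint_cosine_uniqueness:
  fixes X :: "'k \<Rightarrow> 'a \<Rightarrow> real" and X' :: "'k \<Rightarrow> 'b \<Rightarrow> real"
  assumes "prob_space M" "prob_space M'" and K: "finite K"
    and X: "\<And>k. k \<in> K \<Longrightarrow> X k \<in> borel_measurable M"
    and X': "\<And>k. k \<in> K \<Longrightarrow> X' k \<in> borel_measurable M'"
    and cos_eq: "\<And>u \<theta>. (\<integral>\<omega>. cos ((\<Sum>k\<in>K. u k * X k \<omega>) + \<theta>) \<partial>M) = (\<integral>\<omega>. cos ((\<Sum>k\<in>K. u k * X' k \<omega>) + \<theta>) \<partial>M')"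
  shows "distr M (PiM K (\<lambda>_. borel)) (\<lambda>\<omega>. \<lambda>k\<in>K. X k \<omega>) = distr M' (PiM K (\<lambda>_. borel)) (\<lambda>\<omega>. \<lambda>k\<in>K. X' k \<omega>)"
proof -
  interpret M: prob_space M by fact
  interpret M': prob_space M' by fact
  have mX[measurable]: "(\<lambda>\<omega>. \<lambda>k\<in>K. X k \<omega>) \<in> measurable M (PiM K (\<lambda>_. borel))"
    "(\<lambda>\<omega>. \<lambda>k\<in>K. X' k \<omega>) \<in> measurable M' (PiM K (\<lambda>_. borel))"
    using X X' by auto
  \<comment> \<open>Coordinates in J are tested against indicators, the remaining ones against cosines.\<close>
  have mixed: "(\<integral>\<omega>. (\<Prod>k\<in>J. indicator (A k) (X k \<omega>)) * cos ((\<Sum>k\<in>K-J. u k * X k \<omega>) + \<theta>) \<partial>M)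
        = (\<integral>\<omega>. (\<Prod>k\<in>J. indicator (A k) (X' k \<omega>)) * cos ((\<Sum>k\<in>K-J. u k * X' k \<omega>) + \<theta>) \<partial>M')"
    if "J \<subseteq> K" and A: "\<And>k. k \<in> K \<Longrightarrow> A k \<in> sets borel" for J A u \<theta>
    using finite_subset[OF \<open>J \<subseteq> K\<close> K] \<open>J \<subseteq> K\<close>
  proof (induction J arbitrary: u \<theta> rule: finite_induct)
    case empty
    then show ?case using cos_eq by simp
  next
    case (insert j J)
    then have j: "j \<in> K" "j \<notin> J" "j \<in> K - J" and JK: "J \<subseteq> K" "finite (K - J)" using K by auto
    note [measurable] = X[OF j(1)] X'[OF j(1)]
    note IH = insert.IH[OF JK(1)]
    have KJ: "K - insert j J = K - J - {j}" by auto
    define S where "S \<omega> = (\<Sum>k\<in>K - J - {j}. u k * X k \<omega>) + \<theta>" for \<omega>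
    define S' where "S' \<omega> = (\<Sum>k\<in>K - J - {j}. u k * X' k \<omega>) + \<theta>" for \<omega>
    define p where "p \<omega> = (\<Prod>k\<in>J. indicator (A k) (X k \<omega>) :: real)" for \<omega>
    define p' where "p' \<omega> = (\<Prod>k\<in>J. indicator (A k) (X' k \<omega>) :: real)" for \<omega>
    have [measurable]: "S \<in> borel_measurable M" "S' \<in> borel_measurable M'"
      unfolding S_def S'_def using X X' by (auto intro!: borel_measurable_sum borel_measurable_times borel_measurable_add)
    have [measurable]: "p \<in> borel_measurable M" "p' \<in> borel_measurable M'"
      unfolding p_def p'_def using X X' A JK(1)
      by (auto intro!: borel_measurable_prod measurable_compose[OF _ borel_measurable_indicator])
    have p: "0 \<le> p \<omega>" "p \<omega> \<le> 1" and p': "0 \<le> p' \<omega>'" "p' \<omega>' \<le> 1" for \<omega> \<omega>'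
      unfolding p_def p'_def by (auto intro!: prod_nonneg prod_le_1 simp: indicator_def)
    have ip: "integrable M (\<lambda>\<omega>. p \<omega> * cos (f \<omega>))" if [measurable]: "f \<in> borel_measurable M" for f
      by (rule M.integrable_const_bound[where B=1])
        (use p in \<open>auto simp: abs_mult intro!: mult_le_one\<close>)
    have ip': "integrable M' (\<lambda>\<omega>. p' \<omega> * cos (f \<omega>))" if [measurable]: "f \<in> borel_measurable M'" for f
      by (rule M'.integrable_const_bound[where B=1])
        (use p' in \<open>auto simp: abs_mult intro!: mult_le_one\<close>)
    have base: "(\<integral>\<omega>. p \<omega> * cos (s * X j \<omega> + (r * S \<omega> + \<eta>)) \<partial>M) = (\<integral>\<omega>. p' \<omega> * cos (s * X' j \<omega> + (r * S' \<omega> + \<eta>)) \<partial>M')" for s r \<eta>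
    proof -
      have e: "(\<Sum>k\<in>K - J. (if k = j then s else r * u k) * f k) + (r * \<theta> + \<eta>)
          = s * f j + (r * ((\<Sum>k\<in>K - J - {j}. u k * f k) + \<theta>) + \<eta>)" for f
      proof -
        have "(\<Sum>k\<in>K - J - {j}. (if k = j then s else r * u k) * f k) = (\<Sum>k\<in>K - J - {j}. r * (u k * f k))"
          by (intro sum.cong) (auto simp: algebra_simps)
        then show ?thesis using j(3) JK(2)
          by (simp add: sum.remove[OF JK(2) j(3)] sum_distrib_left algebra_simps)
      qed
      show ?thesis
        using IH[of "\<lambda>k. if k = j then s else r * u k" "r * \<theta> + \<eta>"] unfolding p_def p'_def S_def S'_def e .
    qed
    \<comment> \<open>A cosine is not a nonnegative weight, but 1 + cos is; the case r = 0 is subtracted at the end.\<close>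
    have w: "(\<integral>\<omega>. (p \<omega> * (1 + r * cos (S \<omega>))) * indicator (A j) (X j \<omega>) \<partial>M)
          = (\<integral>\<omega>. (p' \<omega> * (1 + r * cos (S' \<omega>))) * indicator (A j) (X' j \<omega>) \<partial>M')" if r: "r = 0 \<or> r = 1" for r :: real
    proof (rule weighted_cosine_uniqueness[where B=2])
      fix s \<eta>
      have pw: "q * (1 + r * cos t) * cos (a + \<eta>) = q * cos (a + (0 * t + \<eta>)) +
          r/2 * (q * cos (a + (1 * t + \<eta>))) + r/2 * (q * cos (a + ((-1) * t + \<eta>)))" for q t a
      proof -
        have "a + (1 * t + \<eta>) = (a + \<eta>) + t" "a + ((-1) * t + \<eta>) = (a + \<eta>) - t" by auto
        then show ?thesis by (simp only: cos_add[of "a + \<eta>" t] cos_diff[of "a + \<eta>" t]) (simp add: algebra_simps)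
      qed
      show "(\<integral>\<omega>. p \<omega> * (1 + r * cos (S \<omega>)) * cos (s * X j \<omega> + \<eta>) \<partial>M) =
        (\<integral>\<omega>. p' \<omega> * (1 + r * cos (S' \<omega>)) * cos (s * X' j \<omega> + \<eta>) \<partial>M')"
        unfolding pw
        by (simp only: Bochner_Integration.integral_add Bochner_Integration.integrable_add ip ip' base
            integral_mult_right_zero integrable_mult_right borel_measurable_add borel_measurable_times
            borel_measurable_const \<open>S \<in> borel_measurable M\<close> \<open>S' \<in> borel_measurable M'\<close> X[OF j(1)] X'[OF j(1)])
    next
      fix \<omega> \<omega>'
      have "1 + r * cos (S \<omega>) \<ge> 0" "1 + r * cos (S \<omega>) \<le> 2" "1 + r * cos (S' \<omega>') \<ge> 0" "1 + r * cos (S' \<omega>') \<le> 2"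
        using r cos_ge_minus_one[of "S \<omega>"] cos_le_one[of "S \<omega>"] cos_ge_minus_one[of "S' \<omega>'"] cos_le_one[of "S' \<omega>'"]
        by (auto simp del: cos_ge_minus_one cos_le_one)
      then show "0 \<le> p \<omega> * (1 + r * cos (S \<omega>))" "p \<omega> * (1 + r * cos (S \<omega>)) \<le> 2"
         "0 \<le> p' \<omega>' * (1 + r * cos (S' \<omega>'))" "p' \<omega>' * (1 + r * cos (S' \<omega>')) \<le> 2"
        using p[of \<omega>] p'[of \<omega>'] mult_mono[of "p \<omega>" 1 "1 + r * cos (S \<omega>)" 2] mult_mono[of "p' \<omega>'" 1 "1 + r * cos (S' \<omega>')" 2]
        by auto
    qed (use A j assms in \<open>auto\<close>)
    have iA: "integrable M (\<lambda>\<omega>. p \<omega> * (1 + r * cos (S \<omega>)) * indicator (A j) (X j \<omega>))"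
         "integrable M' (\<lambda>\<omega>. p' \<omega> * (1 + r * cos (S' \<omega>)) * indicator (A j) (X' j \<omega>))" if r: "r = 0 \<or> r = 1" for r :: real
    proof -
      have bd: "\<bar>q * (1 + r * cos t) * indicator B (x::real)\<bar> \<le> 2" if "0 \<le> q" "q \<le> 1" for q t B x :: "_"
      proof -
        have "\<bar>1 + r * cos t\<bar> \<le> 2" using r cos_ge_minus_one[of t] cos_le_one[of t] by (auto simp del: cos_ge_minus_one cos_le_one)
        then show ?thesis using that mult_mono[of q 1 "\<bar>1 + r * cos t\<bar>" 2] by (auto simp: abs_mult indicator_def)
      qed
      have [measurable]: "(\<lambda>x. indicator (A j) x :: real) \<in> borel_measurable borel" using A j(1) by auto
      show "integrable M (\<lambda>\<omega>. p \<omega> * (1 + r * cos (S \<omega>)) * indicator (A j) (X j \<omega>))"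
        by (rule M.integrable_const_bound[where B=2]) (use bd[OF p(1,2)] in auto)
      show "integrable M' (\<lambda>\<omega>. p' \<omega> * (1 + r * cos (S' \<omega>)) * indicator (A j) (X' j \<omega>))"
        by (rule M'.integrable_const_bound[where B=2]) (use bd[OF p'(1,2)] in auto)
    qed
    have pe: "(\<Prod>k\<in>insert j J. indicator (A k) (X k \<omega>)) * cos ((\<Sum>k\<in>K - insert j J. u k * X k \<omega>) + \<theta>)
       = p \<omega> * (1 + 1 * cos (S \<omega>)) * indicator (A j) (X j \<omega>) - p \<omega> * (1 + 0 * cos (S \<omega>)) * indicator (A j) (X j \<omega>)" for \<omega>
      using insert.hyps j unfolding p_def S_def KJ by (simp add: algebra_simps)
    have pe': "(\<Prod>k\<in>insert j J. indicator (A k) (X' k \<omega>)) * cos ((\<Sum>k\<in>K - insert j J. u k * X' k \<omega>) + \<theta>)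
       = p' \<omega> * (1 + 1 * cos (S' \<omega>)) * indicator (A j) (X' j \<omega>) - p' \<omega> * (1 + 0 * cos (S' \<omega>)) * indicator (A j) (X' j \<omega>)" for \<omega>
      using insert.hyps j unfolding p'_def S'_def KJ by (simp add: algebra_simps)
    show ?case unfolding pe pe'
      by (subst (1 2) Bochner_Integration.integral_diff) (use iA[of 1] iA[of 0] w[of 1] w[of 0] in auto)
  qed
  show ?thesis
  proof (rule measure_eqI_PiM_finite[OF K, where A="\<lambda>_. Pi\<^sub>E K (\<lambda>_. UNIV)"])
    fix A :: "'k \<Rightarrow> real set" assume A: "\<And>i. i \<in> K \<Longrightarrow> A i \<in> sets borel"
    have AP[measurable]: "Pi\<^sub>E K A \<in> sets (PiM K (\<lambda>_. borel))" using K A by (intro sets_PiM_I_finite) auto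
    have ind: "(\<Prod>k\<in>K. indicator (A k) (x k)) = (indicator (Pi\<^sub>E K A) (\<lambda>k\<in>K. x k) :: real)" for x
      using K by (auto simp: indicator_def PiE_iff)
    have "(\<integral>\<omega>. indicator (Pi\<^sub>E K A) (\<lambda>k\<in>K. X k \<omega>) \<partial>M) = (\<integral>\<omega>. (indicator (Pi\<^sub>E K A) (\<lambda>k\<in>K. X' k \<omega>) :: real) \<partial>M')"
      using mixed[of K A "\<lambda>_. 0" 0] A by (simp add: ind)
    moreover have law: "measure (distr L (PiM K (\<lambda>_. borel)) f) (Pi\<^sub>E K A) = (\<integral>\<omega>. (indicator (Pi\<^sub>E K A) (f \<omega>) :: real) \<partial>L)"
      if [measurable]: "f \<in> measurable L (PiM K (\<lambda>_. borel))" for L :: "'c measure" and f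
    proof -
      have "(\<integral>\<omega>. (indicator (Pi\<^sub>E K A) (f \<omega>) :: real) \<partial>L) = (\<integral>x. (indicator (Pi\<^sub>E K A) x :: real) \<partial>distr L (PiM K (\<lambda>_. borel)) f)"
        by (rule integral_distr[symmetric]) measurable
      also have "\<dots> = measure (distr L (PiM K (\<lambda>_. borel)) f) (Pi\<^sub>E K A \<inter> space (distr L (PiM K (\<lambda>_. borel)) f))"
        by (rule Bochner_Integration.integral_indicator)
      finally show ?thesis using sets.sets_into_space[OF AP] by (simp add: Int_absorb2)
    qed
    ultimately have "measure (distr M (PiM K (\<lambda>_. borel)) (\<lambda>\<omega>. \<lambda>k\<in>K. X k \<omega>)) (Pi\<^sub>E K A) = measure (distr M' (PiM K (\<lambda>_. borel)) (\<lambda>\<omega>. \<lambda>k\<in>K. X' k \<omega>)) (Pi\<^sub>E K A)"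
      by (simp only: law[OF mX(1)] law[OF mX(2)])
    moreover have "finite_measure (distr M (PiM K (\<lambda>_. borel)) (\<lambda>\<omega>. \<lambda>k\<in>K. X k \<omega>))" "finite_measure (distr M' (PiM K (\<lambda>_. borel)) (\<lambda>\<omega>. \<lambda>k\<in>K. X' k \<omega>))"
      by (intro M.finite_measure_distr M'.finite_measure_distr; measurable)+
    ultimately show "emeasure (distr M (PiM K (\<lambda>_. borel)) (\<lambda>\<omega>. \<lambda>k\<in>K. X k \<omega>)) (Pi\<^sub>E K A) = emeasure (distr M' (PiM K (\<lambda>_. borel)) (\<lambda>\<omega>. \<lambda>k\<in>K. X' k \<omega>)) (Pi\<^sub>E K A)"
      by (simp add: finite_measure.emeasure_eq_measure)
  next
    show "range (\<lambda>_. Pi\<^sub>E K (\<lambda>_. UNIV)) \<subseteq> prod_algebra K (\<lambda>_. borel :: real measure)"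
      using K by (auto intro!: prod_algebraI_finite)
    have "prob_space (distr M (PiM K (\<lambda>_. borel)) (\<lambda>\<omega>. \<lambda>k\<in>K. X k \<omega>))" by (rule M.prob_space_distr) measurable
    then show "emeasure (distr M (PiM K (\<lambda>_. borel)) (\<lambda>\<omega>. \<lambda>k\<in>K. X k \<omega>)) (Pi\<^sub>E K (\<lambda>_. UNIV)) \<noteq> \<infinity>"
      by (metis finite_measure.emeasure_finite infinity_ennreal_def prob_space_def)
  qed (simp_all add: space_PiM)
qed


section \<open>Variables with moments of all orders and Gaussian variables\<close>

text \<open>A class that is closed under sums and products and contains the Gaussian variables: it settles every integrability question
about polynomials in the coordinates.\<close>

definition all_moments :: "'a measure \<Rightarrow> ('a \<Rightarrow> real) \<Rightarrow> bool" where
  "all_moments M X \<longleftrightarrow> X \<in> borel_measurable M \<and> (\<forall>p. integrable M (\<lambda>\<omega>. \<bar>X \<omega>\<bar> ^ p))"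

lemma all_moments_measurable: "all_moments M X \<Longrightarrow> X \<in> borel_measurable M"
  by (simp add: all_moments_def)

lemma all_moments_integrable: "all_moments M X \<Longrightarrow> integrable M X"
  using integrable_norm_cancel[of M X] by (auto simp: all_moments_def dest: spec[of _ 1])

lemma all_moments_bound:
  assumes "all_moments M Y" "X \<in> borel_measurable M" "\<And>\<omega>. \<omega> \<in> space M \<Longrightarrow> \<bar>X \<omega>\<bar> \<le> \<bar>Y \<omega>\<bar>"
  shows "all_moments M X"
  unfolding all_moments_def
proof (intro conjI allI)
  fix p show "integrable M (\<lambda>\<omega>. \<bar>X \<omega>\<bar> ^ p)"
  proof (rule Bochner_Integration.integrable_bound)
    show "integrable M (\<lambda>\<omega>. \<bar>Y \<omega>\<bar> ^ p)" using assms(1) by (simp add: all_moments_def)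
    show "AE \<omega> in M. norm (\<bar>X \<omega>\<bar> ^ p) \<le> norm (\<bar>Y \<omega>\<bar> ^ p)"
      using assms(3) by (intro AE_I2) (simp add: power_mono)
  qed (use assms in measurable)
qed (use assms in auto)

text \<open>The cosine transform of the standard normal law is the real form of its characteristic function.\<close>

lemma std_normal_cos:
  "(\<integral>x. cos (\<sigma> * x + \<theta>) \<partial>std_normal_distribution) = exp (- \<sigma>\<^sup>2 / 2) * cos \<theta>"
proof -
  have "(\<integral>x. cos (\<sigma> * x + \<theta>) \<partial>std_normal_distribution) = (\<integral>x. Re (exp (\<i> * \<theta>) * iexp (\<sigma> * x)) \<partial>std_normal_distribution)"
    by (simp add: exp_add[symmetric] Re_exp add.commute)
  also have "\<dots> = Re (exp (\<i> * \<theta>) * char std_normal_distribution \<sigma>)"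
    unfolding char_def
    by (subst integral_Re) (auto intro!: integrable_mult_right prob_space.integrable_iexp prob_space_normal_density)
  also have "\<dots> = exp (- \<sigma>\<^sup>2 / 2) * cos \<theta>" by (simp add: char_std_normal_distribution Re_exp)
  finally show ?thesis .
qed

context prob_space
begin

lemma all_moments_const[simp, intro]: "all_moments M (\<lambda>_. c)"
  by (simp add: all_moments_def)

lemma all_moments_mult[intro]:
  assumes "all_moments M X" "all_moments M Y"
  shows "all_moments M (\<lambda>\<omega>. X \<omega> * Y \<omega>)"
  unfolding all_moments_def
proof (intro conjI allI)
  have [measurable]: "X \<in> borel_measurable M" "Y \<in> borel_measurable M" using assms by (auto simp: all_moments_def)
  show "(\<lambda>\<omega>. X \<omega> * Y \<omega>) \<in> borel_measurable M" by measurable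
  fix p show "integrable M (\<lambda>\<omega>. \<bar>X \<omega> * Y \<omega>\<bar> ^ p)"
  proof (rule Bochner_Integration.integrable_bound)
    show "integrable M (\<lambda>\<omega>. \<bar>X \<omega>\<bar> ^ (2*p) + \<bar>Y \<omega>\<bar> ^ (2*p))" using assms by (simp add: all_moments_def)
    have "\<bar>x * y\<bar> ^ p \<le> \<bar>x\<bar> ^ (2*p) + \<bar>y\<bar> ^ (2*p)" for x y :: real
    proof -
      have "2 * (\<bar>x\<bar> ^ p * \<bar>y\<bar> ^ p) \<le> (\<bar>x\<bar> ^ p)\<^sup>2 + (\<bar>y\<bar> ^ p)\<^sup>2"
        using sum_squares_bound[of "\<bar>x\<bar> ^ p" "\<bar>y\<bar> ^ p"] by (simp add: mult.assoc)
      moreover have "0 \<le> \<bar>x\<bar> ^ p * \<bar>y\<bar> ^ p" by simp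
      moreover have "(\<bar>x\<bar> ^ p)\<^sup>2 = \<bar>x\<bar> ^ (2*p)" "(\<bar>y\<bar> ^ p)\<^sup>2 = \<bar>y\<bar> ^ (2*p)" by (simp_all only: power_mult[symmetric] mult.commute[of p])
      ultimately show ?thesis unfolding abs_mult power_mult_distrib by linarith
    qed
    then show "AE \<omega> in M. norm (\<bar>X \<omega> * Y \<omega>\<bar> ^ p) \<le> norm (\<bar>X \<omega>\<bar> ^ (2*p) + \<bar>Y \<omega>\<bar> ^ (2*p))"
      by (intro AE_I2) (auto simp: power_abs abs_mult)
  qed measurable
qed

lemma all_moments_add[intro]:
  assumes "all_moments M X" "all_moments M Y"
  shows "all_moments M (\<lambda>\<omega>. X \<omega> + Y \<omega>)"
  unfolding all_moments_def
proof (intro conjI allI)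
  have [measurable]: "X \<in> borel_measurable M" "Y \<in> borel_measurable M" using assms by (auto simp: all_moments_def)
  show "(\<lambda>\<omega>. X \<omega> + Y \<omega>) \<in> borel_measurable M" by measurable
  fix p show "integrable M (\<lambda>\<omega>. \<bar>X \<omega> + Y \<omega>\<bar> ^ p)"
  proof (rule Bochner_Integration.integrable_bound)
    show "integrable M (\<lambda>\<omega>. 2 ^ p * (\<bar>X \<omega>\<bar> ^ p + \<bar>Y \<omega>\<bar> ^ p))" using assms by (simp add: all_moments_def)
    have "\<bar>x + y\<bar> ^ p \<le> 2 ^ p * (\<bar>x\<bar> ^ p + \<bar>y\<bar> ^ p)" for x y :: real
    proof -
      have "\<bar>x + y\<bar> ^ p \<le> (2 * max \<bar>x\<bar> \<bar>y\<bar>) ^ p" by (intro power_mono) auto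
      also have "\<dots> \<le> 2 ^ p * (\<bar>x\<bar> ^ p + \<bar>y\<bar> ^ p)" by (auto simp: power_mult_distrib max_def)
      finally show ?thesis .
    qed
    then show "AE \<omega> in M. norm (\<bar>X \<omega> + Y \<omega>\<bar> ^ p) \<le> norm (2 ^ p * (\<bar>X \<omega>\<bar> ^ p + \<bar>Y \<omega>\<bar> ^ p))"
      by (intro AE_I2) (auto simp: power_abs abs_mult)
  qed measurable
qed

lemma all_moments_minus[intro]: "all_moments M X \<Longrightarrow> all_moments M (\<lambda>\<omega>. - X \<omega>)"
  using all_moments_mult[OF all_moments_const[of "-1"]] by simp

lemma all_moments_diff[intro]:
  "all_moments M X \<Longrightarrow> all_moments M Y \<Longrightarrow> all_moments M (\<lambda>\<omega>. X \<omega> - Y \<omega>)"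
  using all_moments_add[of X "\<lambda>\<omega>. - Y \<omega>"] by auto

lemma all_moments_power[intro]: "all_moments M X \<Longrightarrow> all_moments M (\<lambda>\<omega>. X \<omega> ^ n)"
  by (induction n) auto

lemma all_moments_abs[intro]: "all_moments M X \<Longrightarrow> all_moments M (\<lambda>\<omega>. \<bar>X \<omega>\<bar>)"
  using borel_measurable_abs[of X M] by (simp add: all_moments_def)

lemma all_moments_sum[intro]:
  "(\<And>i. i \<in> I \<Longrightarrow> all_moments M (X i)) \<Longrightarrow> all_moments M (\<lambda>\<omega>. \<Sum>i\<in>I. X i \<omega>)"
  by (induction I rule: infinite_finite_induct) auto

text \<open>What is needed about a single centred Gaussian variable, the degenerate one included: it is determined by its variance, and
its fourth moment controls products in the remainder terms below.\<close>

lemma centered_gaussian_rv: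
  assumes g: "gaussian_rv M X" and mean: "expectation X = 0"
  shows "all_moments M X"
    and "expectation (\<lambda>\<omega>. cos (X \<omega> + \<theta>)) = exp (- expectation (\<lambda>\<omega>. (X \<omega>)\<^sup>2) / 2) * cos \<theta>"
    and "expectation (\<lambda>\<omega>. X \<omega> ^ 4) = 3 * (expectation (\<lambda>\<omega>. (X \<omega>)\<^sup>2))\<^sup>2"
proof -
  have [measurable]: "X \<in> borel_measurable M" using g by (simp add: gaussian_rv_def)
  consider (normal) m \<sigma> where "\<sigma> > 0" "distributed M lborel X (normal_density m \<sigma>)"
    | (const) m where "AE \<omega> in M. X \<omega> = m"
    using g by (auto simp: gaussian_rv_def)
  then have "all_moments M X \<and> expectation (\<lambda>\<omega>. cos (X \<omega> + \<theta>)) = exp (- expectation (\<lambda>\<omega>. (X \<omega>)\<^sup>2) / 2) * cos \<theta> \<and>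
     expectation (\<lambda>\<omega>. X \<omega> ^ 4) = 3 * (expectation (\<lambda>\<omega>. (X \<omega>)\<^sup>2))\<^sup>2"
  proof cases
    case normal
    have m: "m = 0" using normal_distributed_expectation[OF normal] mean by simp
    define Y where "Y \<omega> = X \<omega> / \<sigma>" for \<omega>
    have [measurable]: "Y \<in> borel_measurable M" unfolding Y_def by simp
    have X: "X = (\<lambda>\<omega>. \<sigma> * Y \<omega>)" using normal(1) by (auto simp: Y_def)
    have Y: "distributed M lborel Y std_normal_density"
      using normal m normal_standard_normal_convert[OF normal(1), of X m] by (simp add: Y_def[abs_def])
    have dY: "distr M borel Y = std_normal_distribution"
      using distributed_distr_eq_density[OF Y] by (simp cong: distr_cong)
    have iY: "integrable M (\<lambda>\<omega>. f (Y \<omega>)) \<longleftrightarrow> integrable std_normal_distribution f" if "f \<in> borel_measurable borel" for f :: "real \<Rightarrow> real"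
      using that unfolding dY[symmetric] by (subst integrable_distr_eq) auto
    have eY: "expectation (\<lambda>\<omega>. f (Y \<omega>)) = integral\<^sup>L std_normal_distribution f" if "f \<in> borel_measurable borel" for f :: "real \<Rightarrow> real"
      using that unfolding dY[symmetric] by (subst integral_distr) auto
    have aY: "all_moments M Y" unfolding all_moments_def
      using iY[of "\<lambda>x. \<bar>x\<bar> ^ _"] integrable_norm[OF integrable_std_normal_distribution_moment] by (auto simp: power_abs)
    have 2: "expectation (\<lambda>\<omega>. (Y \<omega>)\<^sup>2) = 1" using eY[of "\<lambda>x. x\<^sup>2"] std_normal_distribution_even_moments(1)[of 1] by simp
    have 4: "expectation (\<lambda>\<omega>. Y \<omega> ^ 4) = 3" using eY[of "\<lambda>x. x ^ 4"] std_normal_distribution_even_moments(1)[of 2] by (simp add: fact_numeral)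
    have "expectation (\<lambda>\<omega>. cos (X \<omega> + \<theta>)) = exp (- \<sigma>\<^sup>2 / 2) * cos \<theta>"
      using eY[of "\<lambda>x. cos (\<sigma> * x + \<theta>)"] by (simp add: X std_normal_cos)
    moreover have "all_moments M X" unfolding X by (intro all_moments_mult all_moments_const aY)
    moreover have "expectation (\<lambda>\<omega>. (X \<omega>)\<^sup>2) = \<sigma>\<^sup>2" "expectation (\<lambda>\<omega>. X \<omega> ^ 4) = 3 * \<sigma> ^ 4"
      unfolding X power_mult_distrib using 2 4 by simp_all
    ultimately show ?thesis by simp
  next
    case const
    have m: "m = 0" using mean integral_cong_AE[of X M "\<lambda>_. m"] const by (auto simp: prob_space)
    have c: "expectation (\<lambda>\<omega>. f (X \<omega>)) = f 0" if "f \<in> borel_measurable borel" for f :: "real \<Rightarrow> real"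
    proof -
      have "AE \<omega> in M. f (X \<omega>) = f 0" using const m by auto
      with that have "expectation (\<lambda>\<omega>. f (X \<omega>)) = expectation (\<lambda>_. f 0)" by (intro integral_cong_AE) auto
      then show ?thesis by (simp add: prob_space)
    qed
    have "integrable M (\<lambda>\<omega>. \<bar>X \<omega>\<bar> ^ p)" for p
      by (subst integrable_cong_AE[where g="\<lambda>_. 0 ^ p"]) (use const m in auto)
    then show ?thesis using c[of "\<lambda>x. cos (x + \<theta>)"] c[of "\<lambda>x. x^2"] c[of "\<lambda>x. x^4"] by (simp add: all_moments_def)
  qed
  then show "all_moments M X"
    and "expectation (\<lambda>\<omega>. cos (X \<omega> + \<theta>)) = exp (- expectation (\<lambda>\<omega>. (X \<omega>)\<^sup>2) / 2) * cos \<theta>"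
    and "expectation (\<lambda>\<omega>. X \<omega> ^ 4) = 3 * (expectation (\<lambda>\<omega>. (X \<omega>)\<^sup>2))\<^sup>2" by auto
qed

end

text \<open>By the fundamental theorem of calculus \<open>h\<close> has limits at both infinities because \<open>h'\<close> is integrable, and these limits vanish because \<open>h\<close> is
integrable. This replaces growth conditions in the integration by parts below, where integrability comes from Fubini's theorem.\<close>

lemma integral_derivative_eq_0:
  fixes h h' :: "real \<Rightarrow> real"
  assumes D: "\<And>x. (h has_real_derivative h' x) (at x)" and c: "continuous_on UNIV h'"
    and h: "integrable lborel h" and h': "integrable lborel h'"
  shows "(\<integral>x. h' x \<partial>lborel) = 0"
proof -
  have top: "(k \<longlongrightarrow> 0) at_top"
    if D: "\<And>x. (k has_real_derivative k' x) (at x)" and c: "continuous_on UNIV k'"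
    and k: "integrable lborel k" and k': "integrable lborel k'" for k k' :: "real \<Rightarrow> real"
  proof -
    have "((\<lambda>y. \<integral>x. indicator {..y} x *\<^sub>R (indicator {0..} x * k' x) \<partial>lborel) \<longlongrightarrow> (\<integral>x. indicator {0..} x * k' x \<partial>lborel)) at_top"
      by (rule tendsto_integral_at_top) (use k' in \<open>auto intro: integrable_real_mult_indicator simp: mult.commute\<close>)
    moreover have "\<forall>\<^sub>F y in at_top. (\<integral>x. indicator {..y} x *\<^sub>R (indicator {0..} x * k' x) \<partial>lborel) = k y - k 0"
      using eventually_ge_at_top[of 0]
    proof eventually_elim
      case (elim y)
      have "(\<integral>x. indicator {..y} x *\<^sub>R (indicator {0..} x * k' x) \<partial>lborel) = (\<integral>x. indicator {0..y} x *\<^sub>R k' x \<partial>lborel)"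
        by (intro Bochner_Integration.integral_cong) (auto simp: indicator_def)
      also have "\<dots> = k y - k 0"
        by (rule integral_FTC_atLeastAtMost) (use elim D c in \<open>auto intro: DERIV_subset continuous_on_subset
            simp: has_real_derivative_iff_has_vector_derivative[symmetric]\<close>)
      finally show ?case .
    qed
    ultimately have "((\<lambda>y. k y - k 0) \<longlongrightarrow> (\<integral>x. indicator {0..} x * k' x \<partial>lborel)) at_top"
      by (simp cong: tendsto_cong)
    from tendsto_add[OF this tendsto_const[of "k 0"]] obtain L where L: "(k \<longlongrightarrow> L) at_top" by auto
    have "L = 0"
    proof (rule ccontr)
      assume "L \<noteq> 0"
      then have "\<forall>\<^sub>F y in at_top. dist (k y) L < \<bar>L\<bar>/2" using L by (intro tendstoD) auto
      then obtain a where a: "\<And>y. y \<ge> a \<Longrightarrow> dist (k y) L < \<bar>L\<bar>/2" by (auto simp: eventually_at_top_linorder)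
      have "\<And>y. y \<ge> a \<Longrightarrow> \<bar>L\<bar>/2 \<le> \<bar>k y\<bar>" using a by (force simp: dist_real_def abs_if split: if_splits)
      then have "integrable lborel (\<lambda>x. indicator {a..} x * (\<bar>L\<bar>/2))"
        by (intro Bochner_Integration.integrable_bound[OF k]) (auto simp: indicator_def)
      from integrable_mult_right[OF this, of "2/\<bar>L\<bar>"]
      have "integrable lborel (\<lambda>x. indicator {a..} x :: real)" using \<open>L \<noteq> 0\<close> by (simp add: field_simps)
      then have fin: "emeasure lborel {a..} < \<infinity>" by (subst (asm) integrable_indicator_iff) auto
      define r where "r = enn2real (emeasure lborel {a..})"
      have r: "r \<ge> 0" "emeasure lborel {a..} = ennreal r" using fin by (auto simp: r_def)
      have "emeasure lborel {a..a + (r + 1)} \<le> emeasure lborel {a..}" by (rule emeasure_mono) auto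
      then have "ennreal (r + 1) \<le> ennreal r" using r by simp
      then show False using r(1) by (simp add: ennreal_le_iff)
    qed
    with L show ?thesis by simp
  qed
  have t1: "(h \<longlongrightarrow> 0) at_top" by (rule top[OF D c h h'])
  have "((\<lambda>x. h (- x)) \<longlongrightarrow> 0) at_top"
  proof (rule top)
    show "((\<lambda>x. h (- x)) has_real_derivative - h' (- x)) (at x)" for x
      using DERIV_chain2[OF D DERIV_minus[OF DERIV_ident]] by simp
    show "continuous_on UNIV (\<lambda>x. - h' (- x))" by (intro continuous_intros continuous_on_compose2[OF c]) auto
    show "integrable lborel (\<lambda>x. h (- x))" "integrable lborel (\<lambda>x. - h' (- x))"
      using lborel_integrable_real_affine[OF h, of "-1" 0] lborel_integrable_real_affine[OF h', of "-1" 0] by auto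
  qed
  then have t2: "(h \<longlongrightarrow> 0) at_bot" by (simp add: filterlim_at_bot_mirror)
  have "(LBINT x=-\<infinity>..\<infinity>. h' x) = 0 - 0"
    by (rule interval_integral_FTC_integrable[where F=h])
      (use D c h' t1 t2 in \<open>auto simp: has_real_derivative_iff_has_vector_derivative[symmetric] continuous_on_eq_continuous_at
        set_integrable_def at_left_PInf at_right_MInf filterlim_filtermap comp_def einterval_eq\<close>)
  then show ?thesis by (simp add: interval_integral_to_infinity_eq interval_lebesgue_integral_def set_lebesgue_integral_def einterval_eq)
qed

lemma std_normal_integration_by_parts:
  fixes g g' :: "real \<Rightarrow> real"
  assumes D: "\<And>x. (g has_real_derivative g' x) (at x)" and c: "continuous_on UNIV g'"
    and g: "integrable std_normal_distribution g" and g': "integrable std_normal_distribution g'"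
    and xg: "integrable std_normal_distribution (\<lambda>x. x * g x)"
  shows "(\<integral>x. x * g x \<partial>std_normal_distribution) = (\<integral>x. g' x \<partial>std_normal_distribution)"
proof -
  let ?n = std_normal_density
  have cg: "continuous_on UNIV g" using D by (meson DERIV_isCont continuous_at_imp_continuous_on)
  have [measurable]: "g \<in> borel_measurable borel" "g' \<in> borel_measurable borel"
    using cg c by (auto intro: borel_measurable_continuous_onI)
  have Dn: "(?n has_real_derivative - x * ?n x) (at x)" for x
  proof -
    define c where "c = 1 / sqrt (2 * pi)"
    have n: "?n = (\<lambda>x. c * exp (- (x\<^sup>2 / 2)))" by (simp add: normal_density_def c_def fun_eq_iff)
    show ?thesis unfolding n by (auto intro!: derivative_eq_intros)
  qed
  have I: "integrable lborel (\<lambda>x. ?n x * g x)" "integrable lborel (\<lambda>x. ?n x * g' x)" "integrable lborel (\<lambda>x. ?n x * (x * g x))"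
    using g g' xg by (auto simp: integrable_density)
  have "(\<integral>x. ?n x * g' x - ?n x * (x * g x) \<partial>lborel) = 0"
  proof (rule integral_derivative_eq_0)
    show "((\<lambda>x. ?n x * g x) has_real_derivative ?n x * g' x - ?n x * (x * g x)) (at x)" for x
      using DERIV_mult[OF Dn D[of x]] by (simp add: algebra_simps)
    show "continuous_on UNIV (\<lambda>x. ?n x * g' x - ?n x * (x * g x))"
      using c cg unfolding normal_density_def by (intro continuous_intros) auto
  qed (use I in auto)
  then show ?thesis using I by (simp add: integral_density)
qed


section \<open>Integration by parts for Gaussian vectors\<close>

locale gaussian_vector = prob_space M for M :: "'a measure" +
  fixes K :: "'k set" and Z :: "'k \<Rightarrow> 'a \<Rightarrow> real"
  assumes finite_K: "finite K"
    and gaussian_lincomb: "\<And>u. gaussian_rv M (\<lambda>\<omega>. \<Sum>k\<in>K. u k * Z k \<omega>)"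
    and centered: "\<And>k. k \<in> K \<Longrightarrow> expectation (Z k) = 0"
begin

definition R :: "'k \<Rightarrow> 'k \<Rightarrow> real" where
  "R i j = expectation (\<lambda>\<omega>. Z i \<omega> * Z j \<omega>)"

definition vec :: "'a \<Rightarrow> 'k \<Rightarrow> real" where
  "vec \<omega> = (\<lambda>k\<in>K. Z k \<omega>)"

lemma gaussian_component: "k \<in> K \<Longrightarrow> gaussian_rv M (Z k)"
  using gaussian_lincomb[of "\<lambda>j. if j = k then 1 else 0"] finite_K
  by (simp add: if_distrib[of "\<lambda>x. x * _"] cong: if_cong)

lemma all_moments_component: "k \<in> K \<Longrightarrow> all_moments M (Z k)"
  using centered_gaussian_rv(1) gaussian_component centered by blast

lemma component_measurable[measurable (raw)]: "k \<in> K \<Longrightarrow> Z k \<in> borel_measurable M"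
  using all_moments_component all_moments_measurable by blast

lemma all_moments_lincomb: "all_moments M (\<lambda>\<omega>. \<Sum>k\<in>K. u k * Z k \<omega>)"
  by (intro all_moments_sum all_moments_mult all_moments_const all_moments_component)

lemma vec_measurable[measurable]: "vec \<in> measurable M (PiM K (\<lambda>_. borel))"
  unfolding vec_def[abs_def] by measurable

lemma integrable_component_mult: "i \<in> K \<Longrightarrow> j \<in> K \<Longrightarrow> integrable M (\<lambda>\<omega>. Z i \<omega> * Z j \<omega>)"
  by (intro all_moments_integrable all_moments_mult all_moments_component)

lemma R_sym: "R i j = R j i"
  by (simp add: R_def mult.commute)

lemma expectation_lincomb: "expectation (\<lambda>\<omega>. \<Sum>k\<in>K. u k * Z k \<omega>) = 0"
  by (subst Bochner_Integration.integral_sum) (auto simp: centered all_moments_integrable[OF all_moments_component])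

lemma expectation_component_lincomb:
  "i \<in> K \<Longrightarrow> expectation (\<lambda>\<omega>. Z i \<omega> * (\<Sum>k\<in>K. u k * Z k \<omega>)) = (\<Sum>k\<in>K. u k * R i k)"
  unfolding sum_distrib_left mult.left_commute[of _ "u _"]
  by (subst Bochner_Integration.integral_sum) (auto simp: R_def integrable_component_mult)

lemma expectation_lincomb_square:
  "expectation (\<lambda>\<omega>. (\<Sum>k\<in>K. u k * Z k \<omega>)\<^sup>2) = (\<Sum>i\<in>K. \<Sum>j\<in>K. u i * u j * R i j)"
proof -
  have "expectation (\<lambda>\<omega>. (\<Sum>k\<in>K. u k * Z k \<omega>)\<^sup>2)
      = expectation (\<lambda>\<omega>. \<Sum>i\<in>K. u i * (Z i \<omega> * (\<Sum>k\<in>K. u k * Z k \<omega>)))"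
    by (simp add: power2_eq_square sum_distrib_right mult.assoc)
  also have "\<dots> = (\<Sum>i\<in>K. u i * (\<Sum>j\<in>K. u j * R i j))"
    by (subst Bochner_Integration.integral_sum)
      (auto simp: expectation_component_lincomb intro!: integrable_mult_right all_moments_integrable all_moments_mult
        all_moments_component all_moments_lincomb)
  finally show ?thesis by (simp add: sum_distrib_left mult.assoc)
qed

text \<open>Subtracting the regression on \<open>\<xi> = Z\<^sub>i / s\<close> from every coordinate leaves a vector independent of \<open>\<xi>\<close>; so \<open>\<xi>\<close> may be replaced by an
independent standard normal variable \<open>x\<close> without changing the joint law. Both sides have the same cosine transforms, since
linear combinations of Gaussian coordinates are determined by their variance.\<close>

lemma regression_law:
  fixes i :: 'k
  assumes i: "i \<in> K" and pos: "R i i > 0"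
  defines "s \<equiv> sqrt (R i i)"
  shows "distr (std_normal_distribution \<Otimes>\<^sub>M M) (PiM K (\<lambda>_. borel)) (\<lambda>(x, \<omega>). \<lambda>k\<in>K. Z k \<omega> + R i k / s * (x - Z i \<omega> / s))
    = distr M (PiM K (\<lambda>_. borel)) vec"
proof -
  interpret \<gamma>: prob_space std_normal_distribution by (rule prob_space_normal_density) simp
  interpret P: pair_prob_space std_normal_distribution M ..
  note [measurable] = i
  define Z' where "Z' = (\<lambda>k (x, \<omega>). Z k \<omega> + R i k / s * (x - Z i \<omega> / s))"
  have mZ'[measurable]: "Z' k \<in> borel_measurable (std_normal_distribution \<Otimes>\<^sub>M M)" if "k \<in> K" for k
  proof -
    have [measurable]: "Z k \<in> borel_measurable M" "Z i \<in> borel_measurable M" using i that by auto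
    show ?thesis unfolding Z'_def by measurable
  qed
  have s: "s > 0" "s * s = R i i" using pos by (auto simp: s_def)
  have "distr (std_normal_distribution \<Otimes>\<^sub>M M) (PiM K (\<lambda>_. borel)) (\<lambda>p. \<lambda>k\<in>K. Z' k p)
    = distr M (PiM K (\<lambda>_. borel)) (\<lambda>\<omega>. \<lambda>k\<in>K. Z k \<omega>)"
  proof (rule joint_cosine_uniqueness)
    fix u \<theta>
    \<comment> \<open>The covariance of \<xi> with the linear combination with coefficients u.\<close>
    define \<beta> where "\<beta> = (\<Sum>k\<in>K. u k * R i k) / s"
    define u' where "u' = (\<lambda>k. u k - (if k = i then \<beta> / s else 0))"
    have lin: "(\<Sum>k\<in>K. u' k * Z k \<omega>) = (\<Sum>k\<in>K. u k * Z k \<omega>) - \<beta> * (Z i \<omega> / s)" for \<omega>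
      using finite_K i by (simp add: u'_def left_diff_distrib sum_subtractf if_distrib[of "\<lambda>x. x * _"] cong: if_cong)
    have split: "(\<Sum>k\<in>K. u k * Z' k (x, \<omega>)) + \<theta> = \<beta> * x + ((\<Sum>k\<in>K. u' k * Z k \<omega>) + \<theta>)" for x \<omega>
    proof -
      have "(\<Sum>k\<in>K. u k * (Z k \<omega> + R i k / s * t)) = (\<Sum>k\<in>K. u k * Z k \<omega>) + \<beta> * t" for t
        unfolding \<beta>_def by (simp add: distrib_left sum.distrib sum_divide_distrib sum_distrib_right mult.assoc)
      from this[of "x - Z i \<omega> / s"] show ?thesis unfolding lin Z'_def prod.case by (simp only:) (simp add: right_diff_distrib)
    qed
    have int: "integrable (std_normal_distribution \<Otimes>\<^sub>M M) (\<lambda>(x, \<omega>). cos (\<beta> * x + ((\<Sum>k\<in>K. u' k * Z k \<omega>) + \<theta>)))"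
    proof (rule P.integrable_const_bound[where B=1])
      have [measurable]: "(\<lambda>\<omega>. \<Sum>k\<in>K. u' k * Z k \<omega>) \<in> borel_measurable M"
        by (rule all_moments_measurable[OF all_moments_lincomb])
      show "(\<lambda>(x, \<omega>). cos (\<beta> * x + ((\<Sum>k\<in>K. u' k * Z k \<omega>) + \<theta>))) \<in> borel_measurable (std_normal_distribution \<Otimes>\<^sub>M M)"
        by measurable
    qed auto
    have var: "expectation (\<lambda>\<omega>. (\<Sum>k\<in>K. u' k * Z k \<omega>)\<^sup>2) = expectation (\<lambda>\<omega>. (\<Sum>k\<in>K. u k * Z k \<omega>)\<^sup>2) - \<beta>\<^sup>2"
    proof -
      have "(A - \<beta> * (c / s))\<^sup>2 = A\<^sup>2 - 2 * \<beta> / s * (c * A) + \<beta>\<^sup>2 / s\<^sup>2 * (c * c)" for A c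
        using s(1) by (simp add: field_simps power2_eq_square)
      then have "(\<Sum>k\<in>K. u' k * Z k \<omega>)\<^sup>2 = (\<Sum>k\<in>K. u k * Z k \<omega>)\<^sup>2 - 2 * \<beta> / s * (Z i \<omega> * (\<Sum>k\<in>K. u k * Z k \<omega>)) + \<beta>\<^sup>2 / s\<^sup>2 * (Z i \<omega> * Z i \<omega>)" for \<omega>
        unfolding lin .
      then have "expectation (\<lambda>\<omega>. (\<Sum>k\<in>K. u' k * Z k \<omega>)\<^sup>2) =
         expectation (\<lambda>\<omega>. (\<Sum>k\<in>K. u k * Z k \<omega>)\<^sup>2) - 2 * \<beta> / s * expectation (\<lambda>\<omega>. Z i \<omega> * (\<Sum>k\<in>K. u k * Z k \<omega>)) + \<beta>\<^sup>2 / s\<^sup>2 * R i i"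
        unfolding R_def
        by (simp add: Bochner_Integration.integral_add Bochner_Integration.integral_diff all_moments_integrable
            all_moments_power all_moments_lincomb all_moments_mult all_moments_component i)
      also have "2 * \<beta> / s * expectation (\<lambda>\<omega>. Z i \<omega> * (\<Sum>k\<in>K. u k * Z k \<omega>)) = 2 * \<beta>\<^sup>2"
        using s pos by (simp add: expectation_component_lincomb[OF i] \<beta>_def power2_eq_square)
      also have "\<beta>\<^sup>2 / s\<^sup>2 * R i i = \<beta>\<^sup>2" using s pos by (simp add: power2_eq_square)
      finally show ?thesis by simp
    qed
    have "(\<integral>p. cos ((\<Sum>k\<in>K. u k * Z' k p) + \<theta>) \<partial>(std_normal_distribution \<Otimes>\<^sub>M M))
       = (\<integral>(x, \<omega>). cos (\<beta> * x + ((\<Sum>k\<in>K. u' k * Z k \<omega>) + \<theta>)) \<partial>(std_normal_distribution \<Otimes>\<^sub>M M))"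
      by (intro Bochner_Integration.integral_cong) (auto simp: split)
    also have "\<dots> = (\<integral>\<omega>. (\<integral>x. cos (\<beta> * x + ((\<Sum>k\<in>K. u' k * Z k \<omega>) + \<theta>)) \<partial>std_normal_distribution) \<partial>M)"
      by (rule P.integral_snd[OF int, symmetric])
    also have "\<dots> = exp (- \<beta>\<^sup>2 / 2) * expectation (\<lambda>\<omega>. cos ((\<Sum>k\<in>K. u' k * Z k \<omega>) + \<theta>))"
      by (simp add: std_normal_cos)
    also have "\<dots> = exp (- expectation (\<lambda>\<omega>. (\<Sum>k\<in>K. u k * Z k \<omega>)\<^sup>2) / 2) * cos \<theta>"
      by (subst centered_gaussian_rv(2)[OF gaussian_lincomb expectation_lincomb])
        (simp add: var mult.assoc[symmetric] exp_add[symmetric] field_simps)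
    also have "\<dots> = expectation (\<lambda>\<omega>. cos ((\<Sum>k\<in>K. u k * Z k \<omega>) + \<theta>))"
      by (rule centered_gaussian_rv(2)[OF gaussian_lincomb expectation_lincomb, symmetric])
    finally show "(\<integral>p. cos ((\<Sum>k\<in>K. u k * Z' k p) + \<theta>) \<partial>(std_normal_distribution \<Otimes>\<^sub>M M)) = expectation (\<lambda>\<omega>. cos ((\<Sum>k\<in>K. u k * Z k \<omega>) + \<theta>))" .
  qed (use finite_K P.prob_space_axioms prob_space_axioms in auto)
  then show ?thesis by (simp add: vec_def[abs_def] Z'_def case_prod_beta')
qed

text \<open>The one-dimensional formula applied in the variable \<open>x\<close> of \<open>regression_law\<close>: moving \<open>x\<close> moves the vector along the \<open>i\<close>-th row of
the covariance matrix. Accordingly \<open>g'\<close> is the derivative of \<open>g\<close> in that direction, \<open>\<Sum>k. R\<^sub>i\<^sub>k \<partial>\<^sub>k g\<close>.\<close>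

theorem gaussian_integration_by_parts:
  assumes i: "i \<in> K" and pos: "R i i > 0"
    and [measurable]: "g \<in> borel_measurable (PiM K (\<lambda>_. borel))" "g' \<in> borel_measurable (PiM K (\<lambda>_. borel))"
    and D: "\<And>z x. ((\<lambda>x. g (\<lambda>k\<in>K. z k + x * R i k)) has_real_derivative g' (\<lambda>k\<in>K. z k + x * R i k)) (at x)"
    and cont: "\<And>z. continuous_on UNIV (\<lambda>x. g' (\<lambda>k\<in>K. z k + x * R i k))"
    and int: "integrable M (\<lambda>\<omega>. g (vec \<omega>))" "integrable M (\<lambda>\<omega>. Z i \<omega> * g (vec \<omega>))" "integrable M (\<lambda>\<omega>. g' (vec \<omega>))"
  shows "expectation (\<lambda>\<omega>. Z i \<omega> * g (vec \<omega>)) = expectation (\<lambda>\<omega>. g' (vec \<omega>))"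
proof -
  interpret \<gamma>: prob_space std_normal_distribution by (rule prob_space_normal_density) simp
  interpret P: pair_prob_space std_normal_distribution M ..
  note [measurable] = i
  define s where "s = sqrt (R i i)"
  have s: "s > 0" "s * s = R i i" using pos by (auto simp: s_def)
  define V where "V = (\<lambda>(x, \<omega>). \<lambda>k\<in>K. Z k \<omega> + R i k / s * (x - Z i \<omega> / s))"
  have mV[measurable]: "V \<in> measurable (std_normal_distribution \<Otimes>\<^sub>M M) (PiM K (\<lambda>_. borel))"
    unfolding V_def case_prod_beta'
  proof (rule measurable_restrict)
    fix k assume "k \<in> K"
    have [measurable]: "Z k \<in> borel_measurable M" "Z i \<in> borel_measurable M" using i \<open>k \<in> K\<close> by auto
    show "(\<lambda>p. Z k (snd p) + R i k / s * (fst p - Z i (snd p) / s)) \<in> borel_measurable (std_normal_distribution \<Otimes>\<^sub>M M)"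
      by measurable
  qed
  have law: "distr (std_normal_distribution \<Otimes>\<^sub>M M) (PiM K (\<lambda>_. borel)) V = distr M (PiM K (\<lambda>_. borel)) vec"
    using regression_law[OF i pos] by (simp add: V_def s_def)
  have tI: "integrable (std_normal_distribution \<Otimes>\<^sub>M M) (\<lambda>p. f (V p)) \<longleftrightarrow> integrable M (\<lambda>\<omega>. f (vec \<omega>))"
    if [measurable]: "f \<in> borel_measurable (PiM K (\<lambda>_. borel))" for f :: "_ \<Rightarrow> real"
    using integrable_distr_eq[OF mV, of f] integrable_distr_eq[OF vec_measurable, of f] law by simp
  have tE: "(\<integral>p. f (V p) \<partial>(std_normal_distribution \<Otimes>\<^sub>M M)) = expectation (\<lambda>\<omega>. f (vec \<omega>))"
    if [measurable]: "f \<in> borel_measurable (PiM K (\<lambda>_. borel))" for f :: "_ \<Rightarrow> real"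
    using integral_distr[OF mV, of f] integral_distr[OF vec_measurable, of f] law by simp
  have Vi: "V p i = s * fst p" for p
  proof -
    have "R i i / s = s" using s by (simp add: field_simps)
    then have "Z i \<omega> + R i i / s * (x - Z i \<omega> / s) = s * x" for x \<omega>
      using s by (simp only: right_diff_distrib) simp
    then show ?thesis using i by (auto simp: V_def split: prod.splits)
  qed
  have veci: "vec \<omega> i = Z i \<omega>" for \<omega> using i by (simp add: vec_def)
  have mg: "(\<lambda>z. z i * g z) \<in> borel_measurable (PiM K (\<lambda>_. borel))" by measurable
  have I1: "integrable (std_normal_distribution \<Otimes>\<^sub>M M) (\<lambda>p. g (V p))" using tI[of g] int by simp
  have I2: "integrable (std_normal_distribution \<Otimes>\<^sub>M M) (\<lambda>p. s * (fst p * g (V p)))"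
    using tI[OF mg] int by (simp add: Vi veci mult.assoc)
  have I2': "integrable (std_normal_distribution \<Otimes>\<^sub>M M) (\<lambda>p. fst p * g (V p))"
    using integrable_mult_right[OF I2, of "1/s"] s by simp
  have I3: "integrable (std_normal_distribution \<Otimes>\<^sub>M M) (\<lambda>p. g' (V p))" using tI[of g'] int by simp
  have I3': "integrable (std_normal_distribution \<Otimes>\<^sub>M M) (\<lambda>p. g' (V p) / s)" using I3 by simp
  have "expectation (\<lambda>\<omega>. Z i \<omega> * g (vec \<omega>)) = (\<integral>p. s * (fst p * g (V p)) \<partial>(std_normal_distribution \<Otimes>\<^sub>M M))"
    using tE[OF mg] by (simp add: Vi veci mult.assoc)
  also have "\<dots> = s * (\<integral>\<omega>. (\<integral>x. x * g (V (x, \<omega>)) \<partial>std_normal_distribution) \<partial>M)"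
    using P.integral_snd[of "\<lambda>x \<omega>. x * g (V (x, \<omega>))"] I2' by (simp add: case_prod_beta')
  also have "(\<integral>\<omega>. (\<integral>x. x * g (V (x, \<omega>)) \<partial>std_normal_distribution) \<partial>M) = (\<integral>\<omega>. (\<integral>x. g' (V (x, \<omega>)) / s \<partial>std_normal_distribution) \<partial>M)"
  proof (rule integral_cong_AE)
    have "AE \<omega> in M. integrable std_normal_distribution (\<lambda>x. g (V (x, \<omega>)))"
      using P.AE_integrable_snd[of "\<lambda>x \<omega>. g (V (x, \<omega>))"] I1 by (simp add: case_prod_beta')
    moreover have "AE \<omega> in M. integrable std_normal_distribution (\<lambda>x. x * g (V (x, \<omega>)))"
      using P.AE_integrable_snd[of "\<lambda>x \<omega>. x * g (V (x, \<omega>))"] I2' by (simp add: case_prod_beta')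
    moreover have "AE \<omega> in M. integrable std_normal_distribution (\<lambda>x. g' (V (x, \<omega>)) / s)"
      using P.AE_integrable_snd[of "\<lambda>x \<omega>. g' (V (x, \<omega>)) / s"] I3' by (simp only: case_prod_beta' prod.collapse)
    ultimately show "AE \<omega> in M. (\<integral>x. x * g (V (x, \<omega>)) \<partial>std_normal_distribution) = (\<integral>x. g' (V (x, \<omega>)) / s \<partial>std_normal_distribution)"
    proof eventually_elim
      case (elim \<omega>)
      define z where "z = (\<lambda>k. Z k \<omega> - R i k / s * (Z i \<omega> / s))"
      have V: "V (x, \<omega>) = (\<lambda>k\<in>K. z k + (x / s) * R i k)" for x
        by (auto simp: V_def z_def fun_eq_iff algebra_simps diff_divide_distrib)
      show ?case
      proof (rule std_normal_integration_by_parts[OF _ _ elim(1) elim(3) elim(2)])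
        show "((\<lambda>x. g (V (x, \<omega>))) has_real_derivative g' (V (x, \<omega>)) / s) (at x)" for x
          using DERIV_chain2[OF D[of z "x / s"] DERIV_cdivide[OF DERIV_ident, of s]] by (simp add: V)
        show "continuous_on UNIV (\<lambda>x. g' (V (x, \<omega>)) / s)"
          unfolding V using s by (intro continuous_intros continuous_on_compose2[OF cont]) auto
      qed
    qed
  qed measurable
  also have "\<dots> = (\<integral>p. g' (V p) / s \<partial>(std_normal_distribution \<Otimes>\<^sub>M M))"
    using P.integral_snd[of "\<lambda>x \<omega>. g' (V (x, \<omega>)) / s"] I3' by (simp only: case_prod_beta' prod.collapse)
  also have "s * \<dots> = expectation (\<lambda>\<omega>. g' (vec \<omega>))" using tE[of g'] s by simp
  finally show ?thesis .
qed

end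


section \<open>Stein's identity for a Gaussian quadratic form\<close>

locale gaussian_quadratic = gaussian_vector M K Z
  for M :: "'a measure" and K :: "'k set" and Z :: "'k \<Rightarrow> 'a \<Rightarrow> real" +
  assumes nonempty_K: "K \<noteq> {}"
    and variance_pos: "\<And>i. i \<in> K \<Longrightarrow> R i i > 0"
begin

text \<open>The Hilbert-Schmidt norm of the covariance matrix.\<close>

definition frob :: real where
  "frob = sqrt (\<Sum>i\<in>K. \<Sum>j\<in>K. (R i j)\<^sup>2)"

text \<open>The factor that gives the quadratic form \<open>F\<close> variance \<open>1\<close>.\<close>

definition a :: real where
  "a = 1 / (sqrt 2 * frob)"

definition F :: "('k \<Rightarrow> real) \<Rightarrow> real" where
  "F z = a * (\<Sum>k\<in>K. (z k)\<^sup>2 - R k k)"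

text \<open>The vector \<open>R z\<close>; up to the factor \<open>2 a\<close>, its coordinates are the derivatives of \<open>F\<close> along the rows of \<open>R\<close>.\<close>

definition U :: "'k \<Rightarrow> ('k \<Rightarrow> real) \<Rightarrow> real" where
  "U i z = (\<Sum>k\<in>K. R i k * z k)"

text \<open>The fluctuation of \<open>\<langle>DF, DF\<rangle> / 4\<close>, where \<open>DF\<close> is the Malliavin derivative of \<open>F\<close>.\<close>

definition Y :: "('k \<Rightarrow> real) \<Rightarrow> real" where
  "Y z = a\<^sup>2 * (\<Sum>k\<in>K. z k * U k z) - 1 / 2"

definition S :: "('k \<Rightarrow> real) \<Rightarrow> real" where
  "S z = (\<Sum>k\<in>K. (U k z)\<^sup>2)"

text \<open>The vector \<open>R\<^sup>2 z\<close>, which arises from differentiating \<open>Y\<close> along the rows of \<open>R\<close>.\<close>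

definition V :: "'k \<Rightarrow> ('k \<Rightarrow> real) \<Rightarrow> real" where
  "V i z = (\<Sum>k\<in>K. R i k * U k z)"

abbreviation EE :: "(('k \<Rightarrow> real) \<Rightarrow> real) \<Rightarrow> real" where
  "EE h \<equiv> expectation (\<lambda>\<omega>. h (vec \<omega>))"

abbreviation mom :: "(('k \<Rightarrow> real) \<Rightarrow> real) \<Rightarrow> bool" where
  "mom h \<equiv> all_moments M (\<lambda>\<omega>. h (vec \<omega>))"

lemma frob_pos: "frob > 0"
proof -
  obtain i where i: "i \<in> K" using nonempty_K by auto
  have "0 < (R i i)\<^sup>2" using variance_pos[OF i] by simp
  also have "\<dots> \<le> (\<Sum>j\<in>K. (R i j)\<^sup>2)" using i finite_K by (intro member_le_sum) auto
  also have "\<dots> \<le> (\<Sum>i\<in>K. \<Sum>j\<in>K. (R i j)\<^sup>2)"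
    using i finite_K by (intro member_le_sum[of i K "\<lambda>i. \<Sum>j\<in>K. (R i j)\<^sup>2"]) (auto intro: sum_nonneg)
  finally show ?thesis by (simp add: frob_def)
qed

lemma frob_square: "frob\<^sup>2 = (\<Sum>i\<in>K. \<Sum>j\<in>K. (R i j)\<^sup>2)"
  by (simp add: frob_def sum_nonneg)

lemma a_pos: "a > 0" and a_frob: "a * frob = 1 / sqrt 2"
  using frob_pos by (auto simp: a_def)

lemma a_square: "a\<^sup>2 * (\<Sum>i\<in>K. \<Sum>j\<in>K. (R i j)\<^sup>2) = 1 / 2"
  unfolding frob_square[symmetric] power_mult_distrib[symmetric] a_frob by (simp add: power_divide)

lemma mom_component: "k \<in> K \<Longrightarrow> mom (\<lambda>z. z k)"
  by (simp add: vec_def all_moments_component)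

lemma mom_U: "mom (U i)"
  unfolding U_def by (intro all_moments_sum all_moments_mult all_moments_const mom_component)

lemma mom_V: "mom (V i)"
  unfolding V_def by (intro all_moments_sum all_moments_mult all_moments_const mom_U)

lemma mom_F: "mom F"
  unfolding F_def by (intro all_moments_sum all_moments_mult all_moments_const mom_component all_moments_power all_moments_diff)

lemma mom_Y: "mom Y"
  unfolding Y_def by (intro all_moments_sum all_moments_mult all_moments_const mom_component all_moments_power all_moments_diff mom_U)

lemma mom_S: "mom S"
  unfolding S_def by (intro all_moments_sum all_moments_power mom_U)

lemmas mom_intros = all_moments_sum all_moments_mult all_moments_const all_moments_power all_moments_diff all_moments_add
  all_moments_abs mom_component mom_U mom_V mom_F mom_Y mom_S

lemma meas_component[measurable]: "k \<in> K \<Longrightarrow> (\<lambda>z. z k) \<in> borel_measurable (PiM K (\<lambda>_. borel :: real measure))"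
  by measurable

lemma meas_U[measurable]: "U i \<in> borel_measurable (PiM K (\<lambda>_. borel))"
  unfolding U_def[abs_def] by (intro borel_measurable_sum borel_measurable_times borel_measurable_const meas_component)

lemma meas_V[measurable]: "V i \<in> borel_measurable (PiM K (\<lambda>_. borel))"
  unfolding V_def[abs_def] by measurable

lemma meas_F[measurable]: "F \<in> borel_measurable (PiM K (\<lambda>_. borel))"
  unfolding F_def[abs_def]
  by (intro borel_measurable_sum borel_measurable_times borel_measurable_const borel_measurable_diff borel_measurable_power meas_component)

lemma meas_Y[measurable]: "Y \<in> borel_measurable (PiM K (\<lambda>_. borel))"
  unfolding Y_def[abs_def]
  by (intro borel_measurable_sum borel_measurable_times borel_measurable_const borel_measurable_diff borel_measurable_power meas_component meas_U)

lemma F_line_derivative: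
  "((\<lambda>x. F (\<lambda>k\<in>K. z k + x * R i k)) has_real_derivative 2 * a * U i (\<lambda>k\<in>K. z k + x * R i k)) (at x)"
  unfolding F_def U_def
  by (auto intro!: derivative_eq_intros simp: sum_distrib_left mult_ac intro: sum.cong)

lemma U_line_derivative:
  "((\<lambda>x. U l (\<lambda>k\<in>K. z k + x * R i k)) has_real_derivative (\<Sum>k\<in>K. R l k * R i k)) (at x)"
  unfolding U_def by (auto intro!: derivative_eq_intros intro: sum.cong)

lemma Y_line_derivative:
  "((\<lambda>x. Y (\<lambda>k\<in>K. z k + x * R i k)) has_real_derivative 2 * a\<^sup>2 * V i (\<lambda>k\<in>K. z k + x * R i k)) (at x)"
proof -
  let ?w = "\<lambda>k\<in>K. z k + x * R i k"
  have "(\<Sum>k\<in>K. ?w k * (\<Sum>l\<in>K. R k l * R i l)) = (\<Sum>k\<in>K. \<Sum>l\<in>K. R i k * (R k l * ?w l))"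
    unfolding sum_distrib_left by (subst sum.swap) (simp add: R_sym mult_ac)
  also have "\<dots> = V i ?w" unfolding V_def U_def by (simp add: sum_distrib_left)
  finally have e: "(\<Sum>k\<in>K. ?w k * (\<Sum>l\<in>K. R k l * R i l)) = V i ?w" .
  have "((\<lambda>x. Y (\<lambda>k\<in>K. z k + x * R i k)) has_real_derivative
      a\<^sup>2 * (\<Sum>k\<in>K. R i k * U k ?w + ?w k * (\<Sum>l\<in>K. R k l * R i l))) (at x)"
    unfolding Y_def
    by (auto intro!: derivative_eq_intros U_line_derivative intro: sum.cong simp: algebra_simps)
  then show ?thesis unfolding sum.distrib e by (simp add: V_def[of i] algebra_simps)
qed

lemma U_line_continuous: "continuous_on UNIV (\<lambda>x. U l (\<lambda>k\<in>K. z k + x * R i k))"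
  and F_line_continuous: "continuous_on UNIV (\<lambda>x. F (\<lambda>k\<in>K. z k + x * R i k))"
  and Y_line_continuous: "continuous_on UNIV (\<lambda>x. Y (\<lambda>k\<in>K. z k + x * R i k))"
  by (intro continuous_at_imp_continuous_on ballI; rule DERIV_isCont[OF U_line_derivative] DERIV_isCont[OF F_line_derivative]
      DERIV_isCont[OF Y_line_derivative])+

lemma V_line_continuous: "continuous_on UNIV (\<lambda>x. V l (\<lambda>k\<in>K. z k + x * R i k))"
  unfolding V_def by (intro continuous_intros U_line_continuous)

text \<open>One formula for all integrations by parts below: \<open>\<alpha> = 1, \<beta> = 0\<close> serves for functions of \<open>F\<close>, and \<open>\<alpha> = 0, \<beta> = 1\<close> for functions of \<open>F\<close>
multiplied by \<open>Y\<close>.\<close>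

lemma quadratic_form_ibp:
  assumes i: "i \<in> K" and j: "j \<in> K"
    and D: "\<And>x. (f has_real_derivative f' x) (at x)" and cont: "continuous_on UNIV f'"
    and mf: "mom (\<lambda>z. f (F z))" and mf': "mom (\<lambda>z. f' (F z))"
  shows "EE (\<lambda>z. z i * (z j * f (F z) * (\<alpha> + \<beta> * Y z))) = R i j * EE (\<lambda>z. f (F z) * (\<alpha> + \<beta> * Y z))
      + 2 * a * EE (\<lambda>z. z j * U i z * f' (F z) * (\<alpha> + \<beta> * Y z)) + 2 * \<beta> * a\<^sup>2 * EE (\<lambda>z. z j * V i z * f (F z))"
proof -
  have cf: "continuous_on UNIV f" using D by (meson DERIV_isCont continuous_at_imp_continuous_on)
  have [measurable]: "f \<in> borel_measurable borel" "f' \<in> borel_measurable borel"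
    using cf cont by (auto intro: borel_measurable_continuous_onI)
  define g where "g z = z j * f (F z) * (\<alpha> + \<beta> * Y z)" for z
  define g1 where "g1 z = f (F z) * (\<alpha> + \<beta> * Y z)" for z
  define g2 where "g2 z = z j * U i z * f' (F z) * (\<alpha> + \<beta> * Y z)" for z
  define g3 where "g3 z = z j * V i z * f (F z)" for z
  define g' where "g' z = R i j * g1 z + 2 * a * g2 z + 2 * \<beta> * a\<^sup>2 * g3 z" for z
  have mom: "mom g" "mom g1" "mom g2" "mom g3"
    unfolding g_def g1_def g2_def g3_def using j by (intro mom_intros mf mf'; simp)+
  have int: "integrable M (\<lambda>\<omega>. g1 (vec \<omega>))" "integrable M (\<lambda>\<omega>. g2 (vec \<omega>))" "integrable M (\<lambda>\<omega>. g3 (vec \<omega>))"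
    using mom by (auto intro: all_moments_integrable)
  have [measurable]: "g \<in> borel_measurable (PiM K (\<lambda>_. borel))" "g' \<in> borel_measurable (PiM K (\<lambda>_. borel))"
    unfolding g_def[abs_def] g'_def[abs_def] g1_def g2_def g3_def using j by measurable
  have "expectation (\<lambda>\<omega>. Z i \<omega> * g (vec \<omega>)) = EE g'"
  proof (rule gaussian_integration_by_parts[OF i variance_pos[OF i]])
    show "((\<lambda>x. g (\<lambda>k\<in>K. z k + x * R i k)) has_real_derivative g' (\<lambda>k\<in>K. z k + x * R i k)) (at x)" for z x
    proof -
      let ?w = "\<lambda>x. \<lambda>k\<in>K. z k + x * R i k"
      have dj: "((\<lambda>x. ?w x j) has_real_derivative R i j) (at x)" using j by (auto intro!: derivative_eq_intros)
      have df: "((\<lambda>x. f (F (?w x))) has_real_derivative f' (F (?w x)) * (2 * a * U i (?w x))) (at x)"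
        by (rule DERIV_chain2[OF D F_line_derivative])
      have dY: "((\<lambda>x. \<alpha> + \<beta> * Y (?w x)) has_real_derivative \<beta> * (2 * a\<^sup>2 * V i (?w x))) (at x)"
        by (auto intro!: derivative_eq_intros Y_line_derivative)
      show ?thesis unfolding g_def g'_def g1_def g2_def g3_def
        by (rule DERIV_cong[OF DERIV_mult[OF DERIV_mult[OF dj df] dY]]) (simp add: algebra_simps)
    qed
    show "continuous_on UNIV (\<lambda>x. g' (\<lambda>k\<in>K. z k + x * R i k))" for z
    proof -
      let ?w = "\<lambda>x. \<lambda>k\<in>K. z k + x * R i k"
      have c: "continuous_on UNIV (\<lambda>x. f (F (?w x)))" "continuous_on UNIV (\<lambda>x. f' (F (?w x)))"
        using continuous_on_compose2[OF cf F_line_continuous] continuous_on_compose2[OF cont F_line_continuous] by auto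
      have cj: "continuous_on UNIV (\<lambda>x. ?w x j)" using j by (simp add: continuous_intros)
      show ?thesis unfolding g'_def g1_def g2_def g3_def
        by (intro continuous_on_add continuous_on_mult continuous_on_const c cj
            U_line_continuous V_line_continuous Y_line_continuous)
    qed
    show "integrable M (\<lambda>\<omega>. g (vec \<omega>))" "integrable M (\<lambda>\<omega>. Z i \<omega> * g (vec \<omega>))" "integrable M (\<lambda>\<omega>. g' (vec \<omega>))"
      unfolding g'_def using i by (intro all_moments_integrable mom_intros mom all_moments_component; simp)+
  qed measurable
  also have "\<dots> = R i j * EE g1 + 2 * a * EE g2 + 2 * \<beta> * a\<^sup>2 * EE g3"
    unfolding g'_def using int by simp
  finally show ?thesis
    using i unfolding g_def g1_def g2_def g3_def by (simp add: vec_def)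
qed

lemma EE_sum: "(\<And>i. i \<in> K \<Longrightarrow> mom (h i)) \<Longrightarrow> EE (\<lambda>z. \<Sum>i\<in>K. h i z) = (\<Sum>i\<in>K. EE (h i))"
  by (subst Bochner_Integration.integral_sum) (auto intro: all_moments_integrable)

lemma sum_component_V: "(\<Sum>i\<in>K. z i * V i z) = S z"
proof -
  have "(\<Sum>i\<in>K. z i * V i z) = (\<Sum>i\<in>K. \<Sum>k\<in>K. R k i * z i * U k z)"
    unfolding V_def sum_distrib_left by (simp add: R_sym mult_ac)
  also have "\<dots> = S z" by (subst sum.swap) (simp add: S_def U_def power2_eq_square sum_distrib_right)
  finally show ?thesis .
qed

lemma a_sum_component_U: "a\<^sup>2 * (\<Sum>i\<in>K. z i * U i z) = Y z + 1 / 2"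
  by (simp add: Y_def)

context
  fixes f f' :: "real \<Rightarrow> real" and \<alpha> \<beta> :: real
  assumes D: "\<And>x. (f has_real_derivative f' x) (at x)" and cont: "continuous_on UNIV f'"
    and mf: "mom (\<lambda>z. f (F z))" and mf': "mom (\<lambda>z. f' (F z))"
begin

text \<open>Integration by parts in each summand \<open>Z\<^sub>i \<cdot> Z\<^sub>i\<close> of \<open>F\<close>; the term in which the second factor \<open>Z\<^sub>i\<close> is differentiated cancels the centring.\<close>

lemma stein_identity_F:
  "EE (\<lambda>z. F z * (f (F z) * (\<alpha> + \<beta> * Y z)))
    = EE (\<lambda>z. (2 * Y z + 1) * f' (F z) * (\<alpha> + \<beta> * Y z)) + 2 * \<beta> * a ^ 3 * EE (\<lambda>z. S z * f (F z))"
proof -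
  define g where "g z = f (F z) * (\<alpha> + \<beta> * Y z)" for z
  define h where "h z = f' (F z) * (\<alpha> + \<beta> * Y z)" for z
  have mg: "mom g" and mh: "mom h" unfolding g_def h_def by (intro mom_intros mf mf')+
  have "EE (\<lambda>z. F z * g z) = EE (\<lambda>z. \<Sum>i\<in>K. a * (z i * (z i * g z)) - a * R i i * g z)"
    by (simp add: F_def sum_distrib_left sum_distrib_right algebra_simps power2_eq_square)
  also have "\<dots> = (\<Sum>i\<in>K. EE (\<lambda>z. a * (z i * (z i * g z)) - a * R i i * g z))"
    by (intro EE_sum mom_intros mg) auto
  also have "\<dots> = (\<Sum>i\<in>K. a * EE (\<lambda>z. z i * (z i * g z)) - a * R i i * EE g)"
    by (intro sum.cong refl, subst Bochner_Integration.integral_diff)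
      (auto intro!: all_moments_integrable mom_intros mg)
  also have "\<dots> = (\<Sum>i\<in>K. a * (2 * a * EE (\<lambda>z. z i * U i z * h z) + 2 * \<beta> * a\<^sup>2 * EE (\<lambda>z. z i * V i z * f (F z))))"
    by (intro sum.cong refl) (use quadratic_form_ibp[OF _ _ D cont mf mf', of _ _ \<alpha> \<beta>] in \<open>simp add: g_def h_def mult.assoc algebra_simps\<close>)
  also have "\<dots> = EE (\<lambda>z. \<Sum>i\<in>K. 2 * a\<^sup>2 * (z i * U i z * h z) + 2 * \<beta> * a ^ 3 * (z i * V i z * f (F z)))"
    by (subst EE_sum) (auto intro!: mom_intros mh mf sum.cong simp: Bochner_Integration.integral_add all_moments_integrable
        mom_intros mh mf power2_eq_square power3_eq_cube algebra_simps)
  also have "\<dots> = EE (\<lambda>z. (2 * Y z + 1) * h z + 2 * \<beta> * a ^ 3 * (S z * f (F z)))"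
  proof (intro Bochner_Integration.integral_cong refl)
    fix \<omega> let ?z = "vec \<omega>"
    have "(\<Sum>i\<in>K. 2 * a\<^sup>2 * (?z i * U i ?z * h ?z) + 2 * \<beta> * a ^ 3 * (?z i * V i ?z * f (F ?z)))
       = 2 * (a\<^sup>2 * (\<Sum>i\<in>K. ?z i * U i ?z)) * h ?z + 2 * \<beta> * a ^ 3 * ((\<Sum>i\<in>K. ?z i * V i ?z) * f (F ?z))"
      by (simp add: sum.distrib sum_distrib_left sum_distrib_right mult_ac)
    then show "(\<Sum>i\<in>K. 2 * a\<^sup>2 * (?z i * U i ?z * h ?z) + 2 * \<beta> * a ^ 3 * (?z i * V i ?z * f (F ?z)))
       = (2 * Y ?z + 1) * h ?z + 2 * \<beta> * a ^ 3 * (S ?z * f (F ?z))"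
      unfolding a_sum_component_U sum_component_V by (simp add: algebra_simps)
  qed
  also have "\<dots> = EE (\<lambda>z. (2 * Y z + 1) * h z) + 2 * \<beta> * a ^ 3 * EE (\<lambda>z. S z * f (F z))"
    by (subst Bochner_Integration.integral_add) (auto intro!: all_moments_integrable mom_intros mh mf)
  finally show ?thesis by (simp add: g_def h_def mult.assoc)
qed

text \<open>Integration by parts in each summand \<open>R\<^sub>i\<^sub>j Z\<^sub>i \<cdot> Z\<^sub>j\<close> of \<open>Y\<close>; the differentiated factor \<open>Z\<^sub>j\<close> produces \<open>a\<^sup>2 tr R\<^sup>2 = 1/2\<close>, which cancels the centring.\<close>

lemma stein_identity_Y:
  "EE (\<lambda>z. Y z * (f (F z) * (\<alpha> + \<beta> * Y z)))
    = 2 * a ^ 3 * EE (\<lambda>z. S z * f' (F z) * (\<alpha> + \<beta> * Y z)) + 2 * \<beta> * a ^ 4 * EE (\<lambda>z. (\<Sum>i\<in>K. U i z * V i z) * f (F z))"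
proof -
  define g where "g z = f (F z) * (\<alpha> + \<beta> * Y z)" for z
  define h where "h z = f' (F z) * (\<alpha> + \<beta> * Y z)" for z
  have mg: "mom g" and mh: "mom h" unfolding g_def h_def by (intro mom_intros mf mf')+
  have inner: "EE (\<lambda>z. z i * (U i z * g z)) = (\<Sum>j\<in>K. (R i j)\<^sup>2) * EE g + 2 * a * EE (\<lambda>z. (U i z)\<^sup>2 * h z)
      + 2 * \<beta> * a\<^sup>2 * EE (\<lambda>z. U i z * V i z * f (F z))" if i: "i \<in> K" for i
  proof -
    have "EE (\<lambda>z. z i * (U i z * g z)) = EE (\<lambda>z. \<Sum>j\<in>K. R i j * (z i * (z j * g z)))"
      by (simp add: U_def sum_distrib_left sum_distrib_right mult_ac)
    also have "\<dots> = (\<Sum>j\<in>K. R i j * EE (\<lambda>z. z i * (z j * g z)))"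
      using i by (subst EE_sum) (auto intro!: mom_intros mg)
    also have "\<dots> = (\<Sum>j\<in>K. R i j * (R i j * EE g + 2 * a * EE (\<lambda>z. z j * U i z * h z) + 2 * \<beta> * a\<^sup>2 * EE (\<lambda>z. z j * V i z * f (F z))))"
      by (intro sum.cong refl) (use quadratic_form_ibp[OF i _ D cont mf mf', of _ \<alpha> \<beta>] in \<open>simp add: g_def h_def mult.assoc\<close>)
    also have "\<dots> = (\<Sum>j\<in>K. (R i j)\<^sup>2) * EE g + (\<Sum>j\<in>K. EE (\<lambda>z. 2 * a * (R i j * z j * U i z * h z) + 2 * \<beta> * a\<^sup>2 * (R i j * z j * V i z * f (F z))))"
      unfolding sum_distrib_right sum.distrib[symmetric]
      by (intro sum.cong refl, subst Bochner_Integration.integral_add)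
        (auto intro!: all_moments_integrable mom_intros mh mf simp: algebra_simps power2_eq_square)
    also have "(\<Sum>j\<in>K. EE (\<lambda>z. 2 * a * (R i j * z j * U i z * h z) + 2 * \<beta> * a\<^sup>2 * (R i j * z j * V i z * f (F z))))
        = EE (\<lambda>z. \<Sum>j\<in>K. 2 * a * (R i j * z j * U i z * h z) + 2 * \<beta> * a\<^sup>2 * (R i j * z j * V i z * f (F z)))"
      by (rule EE_sum[symmetric]) (auto intro!: mom_intros mh mf)
    also have "\<dots> = EE (\<lambda>z. 2 * a * ((U i z)\<^sup>2 * h z) + 2 * \<beta> * a\<^sup>2 * (U i z * V i z * f (F z)))"
    proof (intro Bochner_Integration.integral_cong refl)
      fix \<omega> let ?z = "vec \<omega>"
      have "(\<Sum>j\<in>K. 2 * a * (R i j * ?z j * U i ?z * h ?z) + 2 * \<beta> * a\<^sup>2 * (R i j * ?z j * V i ?z * f (F ?z)))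
         = 2 * a * ((\<Sum>j\<in>K. R i j * ?z j) * U i ?z * h ?z) + 2 * \<beta> * a\<^sup>2 * ((\<Sum>j\<in>K. R i j * ?z j) * V i ?z * f (F ?z))"
        by (simp add: sum.distrib sum_distrib_left sum_distrib_right mult_ac)
      then show "(\<Sum>j\<in>K. 2 * a * (R i j * ?z j * U i ?z * h ?z) + 2 * \<beta> * a\<^sup>2 * (R i j * ?z j * V i ?z * f (F ?z)))
         = 2 * a * ((U i ?z)\<^sup>2 * h ?z) + 2 * \<beta> * a\<^sup>2 * (U i ?z * V i ?z * f (F ?z))"
        by (simp add: U_def[of i, symmetric] power2_eq_square)
    qed
    also have "\<dots> = 2 * a * EE (\<lambda>z. (U i z)\<^sup>2 * h z) + 2 * \<beta> * a\<^sup>2 * EE (\<lambda>z. U i z * V i z * f (F z))"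
      by (subst Bochner_Integration.integral_add) (auto intro!: all_moments_integrable mom_intros mh mf)
    finally show ?thesis by simp
  qed
  have mom_sum: "integrable M (\<lambda>\<omega>. \<Sum>i\<in>K. vec \<omega> i * (U i (vec \<omega>) * g (vec \<omega>)))"
    by (intro all_moments_integrable all_moments_sum all_moments_mult mg mom_component mom_U) auto
  have SS: "EE (\<lambda>z. S z * h z) = (\<Sum>i\<in>K. EE (\<lambda>z. (U i z)\<^sup>2 * h z))"
    unfolding S_def sum_distrib_right by (rule EE_sum) (intro all_moments_mult all_moments_power mom_U mh)
  have SV: "EE (\<lambda>z. (\<Sum>i\<in>K. U i z * V i z) * f (F z)) = (\<Sum>i\<in>K. EE (\<lambda>z. U i z * V i z * f (F z)))"
    unfolding sum_distrib_right by (rule EE_sum) (intro all_moments_mult mom_V mom_U mf)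
  have "EE (\<lambda>z. Y z * g z) = EE (\<lambda>z. a\<^sup>2 * (\<Sum>i\<in>K. z i * (U i z * g z)) - 1 / 2 * g z)"
    by (simp add: Y_def left_diff_distrib sum_distrib_right mult.assoc)
  also have "\<dots> = a\<^sup>2 * EE (\<lambda>z. \<Sum>i\<in>K. z i * (U i z * g z)) - 1 / 2 * EE g"
    using mom_sum all_moments_integrable[OF mg] by (subst Bochner_Integration.integral_diff) auto
  also have "EE (\<lambda>z. \<Sum>i\<in>K. z i * (U i z * g z)) = (\<Sum>i\<in>K. EE (\<lambda>z. z i * (U i z * g z)))"
    by (rule EE_sum) (intro all_moments_mult mg mom_component mom_U)
  also have "\<dots> = (\<Sum>i\<in>K. (\<Sum>j\<in>K. (R i j)\<^sup>2) * EE g + 2 * a * EE (\<lambda>z. (U i z)\<^sup>2 * h z)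
      + 2 * \<beta> * a\<^sup>2 * EE (\<lambda>z. U i z * V i z * f (F z)))"
    by (intro sum.cong refl inner)
  also have "\<dots> = (\<Sum>i\<in>K. \<Sum>j\<in>K. (R i j)\<^sup>2) * EE g + 2 * a * EE (\<lambda>z. S z * h z) + 2 * \<beta> * a\<^sup>2 * EE (\<lambda>z. (\<Sum>i\<in>K. U i z * V i z) * f (F z))"
    unfolding SS SV by (simp add: sum.distrib sum_distrib_right sum_distrib_left)
  finally have "EE (\<lambda>z. Y z * g z) = (a\<^sup>2 * (\<Sum>i\<in>K. \<Sum>j\<in>K. (R i j)\<^sup>2)) * EE g + 2 * a ^ 3 * EE (\<lambda>z. S z * h z)
      + 2 * \<beta> * a ^ 4 * EE (\<lambda>z. (\<Sum>i\<in>K. U i z * V i z) * f (F z)) - 1 / 2 * EE g"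
    by (simp add: algebra_simps power2_eq_square power3_eq_cube power4_eq_xxxx)
  then show ?thesis unfolding a_square by (simp add: g_def h_def mult.assoc)
qed

end

text \<open>The triple sum is \<open>tr R\<^sup>3\<close>, so that \<open>8 \<tau>\<close> is the third cumulant of \<open>F\<close>.\<close>

definition \<tau> :: real where
  "\<tau> = a ^ 3 * (\<Sum>i\<in>K. \<Sum>j\<in>K. \<Sum>k\<in>K. R i j * R i k * R j k)"

text \<open>The operator norm is at most the Hilbert-Schmidt norm.\<close>

lemma quadratic_form_bound: "(\<Sum>i\<in>K. \<Sum>j\<in>K. u i * u j * R i j) \<le> frob * (\<Sum>i\<in>K. (u i)\<^sup>2)"
proof -
  have e: "(\<Sum>i\<in>K. \<Sum>j\<in>K. u i * u j * R i j) = (\<Sum>p\<in>K\<times>K. (u (fst p) * u (snd p)) * R (fst p) (snd p))"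
    by (simp add: sum.cartesian_product case_prod_beta')
  have e1: "(\<Sum>p\<in>K\<times>K. (u (fst p) * u (snd p))\<^sup>2) = (\<Sum>i\<in>K. (u i)\<^sup>2)\<^sup>2"
    unfolding power2_eq_square[of "sum _ _"] sum_product sum.cartesian_product by (simp add: power_mult_distrib case_prod_beta')
  have e2: "(\<Sum>p\<in>K\<times>K. (R (fst p) (snd p))\<^sup>2) = frob\<^sup>2"
    unfolding frob_square sum.cartesian_product by (simp add: case_prod_beta')
  have "(\<Sum>i\<in>K. \<Sum>j\<in>K. u i * u j * R i j)\<^sup>2 \<le> (\<Sum>i\<in>K. (u i)\<^sup>2)\<^sup>2 * frob\<^sup>2"
    unfolding e e1[symmetric] e2[symmetric] by (rule Cauchy_Schwarz_ineq_sum)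
  then have "(\<Sum>i\<in>K. \<Sum>j\<in>K. u i * u j * R i j)\<^sup>2 \<le> (frob * (\<Sum>i\<in>K. (u i)\<^sup>2))\<^sup>2" by (simp add: power_mult_distrib mult.commute)
  then show ?thesis by (rule power2_le_imp_le) (use frob_pos in \<open>auto intro!: sum_nonneg mult_nonneg_nonneg\<close>)
qed

lemma EE_U_square: "EE (\<lambda>z. (U i z)\<^sup>2) = (\<Sum>j\<in>K. \<Sum>k\<in>K. R i j * R i k * R j k)"
  using expectation_lincomb_square[of "R i"] by (simp add: U_def vec_def)

lemma EE_U_fourth: "EE (\<lambda>z. U i z ^ 4) = 3 * (EE (\<lambda>z. (U i z)\<^sup>2))\<^sup>2"
  using centered_gaussian_rv(3)[OF gaussian_lincomb expectation_lincomb, of "R i"] by (simp add: U_def vec_def)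

text \<open>This representation of \<open>tr R\<^sup>3\<close> as an expected square is where positivity of the covariance matrix enters.\<close>

lemma tau_eq: "\<tau> = a ^ 3 * EE S"
  unfolding \<tau>_def S_def using EE_sum[of "\<lambda>i z. (U i z)\<^sup>2"] by (simp add: mom_intros EE_U_square)

lemma tau_nonneg: "\<tau> \<ge> 0"
  unfolding tau_eq using a_pos by (intro mult_nonneg_nonneg Bochner_Integration.integral_nonneg) (auto simp: S_def sum_nonneg)

text \<open>\<open>tr R\<^sup>3\<close> is a sum of values of the quadratic form \<open>R\<close> at the rows of \<open>R\<close>.\<close>

lemma tau_le_1: "\<tau> \<le> 1"
proof -
  have "(\<Sum>i\<in>K. \<Sum>j\<in>K. \<Sum>k\<in>K. R i j * R i k * R j k) \<le> (\<Sum>i\<in>K. frob * (\<Sum>j\<in>K. (R i j)\<^sup>2))"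
    by (intro sum_mono quadratic_form_bound)
  also have "\<dots> = frob ^ 3"
    unfolding sum_distrib_left[symmetric] frob_square[symmetric] by (simp add: power3_eq_cube power2_eq_square)
  finally have "\<tau> \<le> (a * frob) ^ 3" unfolding \<tau>_def power_mult_distrib using a_pos by (intro mult_left_mono) auto
  also have "\<dots> \<le> 1" unfolding a_frob by (intro power_le_one) auto
  finally show ?thesis .
qed

lemma EE_Y: "EE Y = 0"
  using stein_identity_Y[of "\<lambda>_. 1" "\<lambda>_. 0" 1 0] by simp

lemma EE_F_square: "EE (\<lambda>z. (F z)\<^sup>2) = 1"
  using stein_identity_F[of "\<lambda>x. x" "\<lambda>_. 1" 1 0] all_moments_integrable[OF mom_Y] EE_Y
  by (simp add: mom_F power2_eq_square prob_space)

text \<open>\<open>E[Y\<^sup>2] = 2 a\<^sup>4 E[\<langle>U, R U\<rangle>]\<close>, and the quadratic form is at most \<open>frob\<close> times \<open>\<bar>U\<bar>\<^sup>2\<close>.\<close>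

lemma EE_Y_square: "EE (\<lambda>z. (Y z)\<^sup>2) \<le> 3 / 2 * \<tau>"
proof -
  have "EE (\<lambda>z. (Y z)\<^sup>2) = 2 * a ^ 4 * EE (\<lambda>z. \<Sum>i\<in>K. U i z * V i z)"
    using stein_identity_Y[of "\<lambda>_. 1" "\<lambda>_. 0" 0 1] by (simp add: power2_eq_square)
  also have "EE (\<lambda>z. \<Sum>i\<in>K. U i z * V i z) \<le> EE (\<lambda>z. frob * S z)"
  proof (rule integral_mono)
    fix \<omega>
    show "(\<Sum>i\<in>K. U i (vec \<omega>) * V i (vec \<omega>)) \<le> frob * S (vec \<omega>)"
      using quadratic_form_bound[of "\<lambda>i. U i (vec \<omega>)"] by (simp add: S_def V_def sum_distrib_left mult_ac)
  qed (auto intro!: all_moments_integrable mom_intros)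
  also have "2 * a ^ 4 * EE (\<lambda>z. frob * S z) = 2 * (a * frob) * \<tau>"
    by (simp add: tau_eq power4_eq_xxxx power3_eq_cube)
  also have "\<dots> \<le> 3 / 2 * \<tau>"
  proof (rule mult_right_mono[OF _ tau_nonneg])
    have "sqrt 2 \<ge> 4 / 3" by (rule real_le_rsqrt) (simp add: power2_eq_square)
    then have "1 / sqrt 2 \<le> 3 / 4" by (simp add: field_simps)
    then show "2 * (a * frob) \<le> 3 / 2" unfolding a_frob by simp
  qed
  finally show ?thesis using a_pos by simp
qed

text \<open>Each coordinate of \<open>U\<close> is Gaussian, so the fourth moment of \<open>U\<^sub>i\<close> is three times its squared variance; with \<open>E[F\<^sup>2] = 1\<close> this bounds
\<open>E[U\<^sub>i\<^sup>2 \<bar>F\<bar>]\<close> by a multiple of the variance.\<close>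

lemma EE_S_abs_F: "EE (\<lambda>z. S z * \<bar>F z\<bar>) \<le> 2 * EE S"
proof -
  have b: "EE (\<lambda>z. (U i z)\<^sup>2 * \<bar>F z\<bar>) \<le> 2 * EE (\<lambda>z. (U i z)\<^sup>2)" for i
  proof (cases "EE (\<lambda>z. (U i z)\<^sup>2) = 0")
    case True
    moreover have "integrable M (\<lambda>\<omega>. (U i (vec \<omega>))\<^sup>2)" by (intro all_moments_integrable mom_intros)
    ultimately have "AE \<omega> in M. (U i (vec \<omega>))\<^sup>2 = 0"
      using integral_nonneg_eq_0_iff_AE[of M "\<lambda>\<omega>. (U i (vec \<omega>))\<^sup>2"] by simp
    then have "EE (\<lambda>z. (U i z)\<^sup>2 * \<bar>F z\<bar>) = expectation (\<lambda>_. 0)"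
      by (intro integral_cong_AE) (auto intro!: all_moments_measurable mom_intros)
    then show ?thesis using True by simp
  next
    case False
    define v where "v = EE (\<lambda>z. (U i z)\<^sup>2)"
    have "v \<ge> 0" unfolding v_def by (intro Bochner_Integration.integral_nonneg) auto
    with False have v: "v > 0" unfolding v_def by linarith
    \<comment> \<open>Young's inequality, balanced so that both terms are of the order of v.\<close>
    have "EE (\<lambda>z. (U i z)\<^sup>2 * \<bar>F z\<bar>) \<le> EE (\<lambda>z. 1 / (2 * v) * U i z ^ 4 + v / 2 * (F z)\<^sup>2)"
    proof (rule integral_mono)
      fix \<omega> let ?u = "(U i (vec \<omega>))\<^sup>2" and ?f = "\<bar>F (vec \<omega>)\<bar>"
      have "2 * ?u * (v * ?f) \<le> ?u\<^sup>2 + (v * ?f)\<^sup>2" by (rule sum_squares_bound)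
      then have "?u * ?f \<le> 1 / (2 * v) * ?u\<^sup>2 + v / 2 * ?f\<^sup>2"
        using v by (simp add: field_simps power2_eq_square)
      then show "?u * ?f \<le> 1 / (2 * v) * U i (vec \<omega>) ^ 4 + v / 2 * (F (vec \<omega>))\<^sup>2" by simp
    qed (intro all_moments_integrable mom_intros)+
    also have "\<dots> = 1 / (2 * v) * EE (\<lambda>z. U i z ^ 4) + v / 2 * EE (\<lambda>z. (F z)\<^sup>2)"
    proof -
      have "integrable M (\<lambda>\<omega>. U i (vec \<omega>) ^ 4)" "integrable M (\<lambda>\<omega>. (F (vec \<omega>))\<^sup>2)"
        by (intro all_moments_integrable mom_intros)+
      then show ?thesis by (subst Bochner_Integration.integral_add) auto
    qed
    also have "\<dots> = 2 * v" unfolding EE_U_fourth EE_F_square v_def[symmetric] using v by (simp add: field_simps power2_eq_square)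
    finally show ?thesis by (simp add: v_def)
  qed
  have "EE (\<lambda>z. S z * \<bar>F z\<bar>) = (\<Sum>i\<in>K. EE (\<lambda>z. (U i z)\<^sup>2 * \<bar>F z\<bar>))"
    unfolding S_def sum_distrib_right by (rule EE_sum) (intro mom_intros)
  also have "\<dots> \<le> (\<Sum>i\<in>K. 2 * EE (\<lambda>z. (U i z)\<^sup>2))" by (intro sum_mono b)
  also have "\<dots> = 2 * EE S" unfolding S_def by (subst EE_sum) (auto intro: mom_intros simp: sum_distrib_left)
  finally show ?thesis .
qed

text \<open>\<open>E[F f(F) Y]\<close> is computed twice, by \<open>stein_identity_F\<close> (fact \<open>2\<close> below) and by \<open>stein_identity_Y\<close> applied to \<open>x f(x)\<close> (fact \<open>3\<close>). The
terms that contain \<open>f\<close> undifferentiated cancel in the comparison, and what is left is the identity \<open>key\<close>.\<close>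

theorem stein_discrepancy_bound:
  assumes D: "\<And>x. (f has_real_derivative f' x) (at x)" and cont: "continuous_on UNIV f'"
    and B: "\<And>x. \<bar>f' x\<bar> \<le> B"
  shows "\<bar>EE (\<lambda>z. f' (F z) - F z * f (F z))\<bar> \<le> 14 * B * \<tau>"
proof -
  have cf: "continuous_on UNIV f" using D by (meson DERIV_isCont continuous_at_imp_continuous_on)
  have [measurable]: "f \<in> borel_measurable borel" "f' \<in> borel_measurable borel"
    using cf cont by (auto intro: borel_measurable_continuous_onI)
  have B0: "B \<ge> 0" using B[of 0] by linarith
  have growth: "\<bar>f x\<bar> \<le> \<bar>f 0\<bar> + B * \<bar>x\<bar>" for x
  proof -
    have "norm (f x - f 0) \<le> B * norm (x - 0)"
      by (rule field_differentiable_bound[where S=UNIV and f'=f']) (use D B in auto)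
    then show ?thesis by simp
  qed
  have mF: "(\<lambda>\<omega>. F (vec \<omega>)) \<in> borel_measurable M" by (rule all_moments_measurable[OF mom_F])
  have mf: "mom (\<lambda>z. f (F z))"
  proof (rule all_moments_bound)
    show "mom (\<lambda>z. \<bar>f 0\<bar> + B * \<bar>F z\<bar>)" by (intro mom_intros)
    show "(\<lambda>\<omega>. f (F (vec \<omega>))) \<in> borel_measurable M" using mF by measurable
    show "\<bar>f (F (vec \<omega>))\<bar> \<le> \<bar>\<bar>f 0\<bar> + B * \<bar>F (vec \<omega>)\<bar>\<bar>" for \<omega> using growth[of "F (vec \<omega>)"] by linarith
  qed
  have mf': "mom (\<lambda>z. f' (F z))"
  proof (rule all_moments_bound)
    show "mom (\<lambda>z. B)" by (intro mom_intros)
    show "(\<lambda>\<omega>. f' (F (vec \<omega>))) \<in> borel_measurable M" using mF by measurable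
    show "\<bar>f' (F (vec \<omega>))\<bar> \<le> \<bar>B\<bar>" for \<omega> using B[of "F (vec \<omega>)"] by linarith
  qed
  note I = all_moments_integrable
  have "EE (\<lambda>z. F z * f (F z)) = EE (\<lambda>z. 2 * (Y z * f' (F z)) + f' (F z))"
    using stein_identity_F[OF D cont mf mf', of 1 0] by (simp add: algebra_simps)
  also have "\<dots> = 2 * EE (\<lambda>z. Y z * f' (F z)) + EE (\<lambda>z. f' (F z))"
    by (subst Bochner_Integration.integral_add) (auto intro!: I mom_intros mf mf')
  finally have 1: "EE (\<lambda>z. F z * f (F z)) = 2 * EE (\<lambda>z. Y z * f' (F z)) + EE (\<lambda>z. f' (F z))" .
  have "EE (\<lambda>z. F z * (f (F z) * Y z)) = EE (\<lambda>z. 2 * ((Y z)\<^sup>2 * f' (F z)) + Y z * f' (F z)) + 2 * a ^ 3 * EE (\<lambda>z. S z * f (F z))"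
    using stein_identity_F[OF D cont mf mf', of 0 1] by (simp add: algebra_simps power2_eq_square)
  also have "EE (\<lambda>z. 2 * ((Y z)\<^sup>2 * f' (F z)) + Y z * f' (F z)) = 2 * EE (\<lambda>z. (Y z)\<^sup>2 * f' (F z)) + EE (\<lambda>z. Y z * f' (F z))"
    by (subst Bochner_Integration.integral_add) (auto intro!: I mom_intros mf mf')
  finally have 2: "EE (\<lambda>z. F z * (f (F z) * Y z)) = 2 * EE (\<lambda>z. (Y z)\<^sup>2 * f' (F z)) + EE (\<lambda>z. Y z * f' (F z)) + 2 * a ^ 3 * EE (\<lambda>z. S z * f (F z))" .
  have "EE (\<lambda>z. Y z * (F z * f (F z))) = 2 * a ^ 3 * EE (\<lambda>z. S z * (f (F z) + F z * f' (F z)))"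
  proof -
    have D': "((\<lambda>x. x * f x) has_real_derivative f x + x * f' x) (at x)" for x
      using DERIV_mult[OF DERIV_ident D[of x]] by (simp add: algebra_simps)
    have c': "continuous_on UNIV (\<lambda>x. f x + x * f' x)" by (intro continuous_intros cf cont)
    show ?thesis
      using stein_identity_Y[OF D' c', of 1 0] mom_intros mf mf' by (simp add: mom_intros mf mf')
  qed
  also have "EE (\<lambda>z. S z * (f (F z) + F z * f' (F z))) = EE (\<lambda>z. S z * f (F z)) + EE (\<lambda>z. S z * (F z * f' (F z)))"
    unfolding distrib_left by (subst Bochner_Integration.integral_add) (auto intro!: I mom_intros mf mf')
  finally have 3: "EE (\<lambda>z. Y z * (F z * f (F z))) = 2 * a ^ 3 * (EE (\<lambda>z. S z * f (F z)) + EE (\<lambda>z. S z * (F z * f' (F z))))" .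
  have 4: "EE (\<lambda>z. F z * (f (F z) * Y z)) = EE (\<lambda>z. Y z * (F z * f (F z)))" by (simp add: mult_ac)
  have "EE (\<lambda>z. f' (F z) - F z * f (F z)) = EE (\<lambda>z. f' (F z)) - EE (\<lambda>z. F z * f (F z))"
    by (subst Bochner_Integration.integral_diff) (auto intro!: I mom_intros mf mf')
  also have "\<dots> = 4 * EE (\<lambda>z. (Y z)\<^sup>2 * f' (F z)) - 4 * a ^ 3 * EE (\<lambda>z. S z * (F z * f' (F z)))"
    using 1 2 3 4 by (simp add: algebra_simps)
  finally have key: "EE (\<lambda>z. f' (F z) - F z * f (F z)) = \<dots>" .
  have "\<bar>EE (\<lambda>z. (Y z)\<^sup>2 * f' (F z))\<bar> \<le> EE (\<lambda>z. \<bar>(Y z)\<^sup>2 * f' (F z)\<bar>)" by (rule integral_abs_bound)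
  also have "\<dots> \<le> EE (\<lambda>z. B * (Y z)\<^sup>2)"
  proof (rule integral_mono)
    show "\<bar>(Y (vec \<omega>))\<^sup>2 * f' (F (vec \<omega>))\<bar> \<le> B * (Y (vec \<omega>))\<^sup>2" for \<omega>
      using mult_right_mono[OF B[of "F (vec \<omega>)"], of "(Y (vec \<omega>))\<^sup>2"] by (simp add: abs_mult mult.commute)
  qed (intro I mom_intros mf')+
  also have "\<dots> = B * EE (\<lambda>z. (Y z)\<^sup>2)" by simp
  also have "\<dots> \<le> B * (3 / 2 * \<tau>)" by (intro mult_left_mono EE_Y_square B0)
  finally have b1: "\<bar>EE (\<lambda>z. (Y z)\<^sup>2 * f' (F z))\<bar> \<le> B * (3 / 2 * \<tau>)" .
  have "\<bar>EE (\<lambda>z. S z * (F z * f' (F z)))\<bar> \<le> EE (\<lambda>z. \<bar>S z * (F z * f' (F z))\<bar>)" by (rule integral_abs_bound)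
  also have "\<dots> \<le> EE (\<lambda>z. B * (S z * \<bar>F z\<bar>))"
  proof (rule integral_mono)
    fix \<omega>
    have "S (vec \<omega>) \<ge> 0" by (simp add: S_def sum_nonneg)
    then show "\<bar>S (vec \<omega>) * (F (vec \<omega>) * f' (F (vec \<omega>)))\<bar> \<le> B * (S (vec \<omega>) * \<bar>F (vec \<omega>)\<bar>)"
      using mult_right_mono[OF B[of "F (vec \<omega>)"], of "S (vec \<omega>) * \<bar>F (vec \<omega>)\<bar>"] by (simp add: abs_mult mult_ac)
  qed (intro I mom_intros mf')+
  also have "\<dots> = B * EE (\<lambda>z. S z * \<bar>F z\<bar>)" by simp
  also have "\<dots> \<le> B * (2 * EE S)" by (intro mult_left_mono EE_S_abs_F B0)
  finally have "a ^ 3 * \<bar>EE (\<lambda>z. S z * (F z * f' (F z)))\<bar> \<le> a ^ 3 * (B * (2 * EE S))"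
    using a_pos by (intro mult_left_mono) auto
  then have b2: "\<bar>a ^ 3 * EE (\<lambda>z. S z * (F z * f' (F z)))\<bar> \<le> 2 * B * \<tau>"
    using a_pos by (simp add: abs_mult tau_eq mult_ac)
  have "\<bar>EE (\<lambda>z. f' (F z) - F z * f (F z))\<bar> \<le> 4 * (B * (3 / 2 * \<tau>)) + 4 * (2 * B * \<tau>)"
    unfolding key using b1 b2 by linarith
  then show ?thesis by (simp add: mult.assoc)
qed

end


section \<open>Stein's equation\<close>

text \<open>The antiderivative \<open>x \<mapsto> - \<integral>\<^sub>x k\<close>, described by its derivative and its limits, which is all that the comparison arguments below use.\<close>

lemma vanishing_antiderivative:
  fixes k :: "real \<Rightarrow> real"
  assumes c: "continuous_on UNIV k" and k: "integrable lborel k"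
  obtains I where "\<And>x. (I has_real_derivative k x) (at x)" "(I \<longlongrightarrow> 0) at_top" "(I \<longlongrightarrow> - (\<integral>t. k t \<partial>lborel)) at_bot"
proof -
  define I where "I x = (\<integral>t. indicator {..x} t * k t \<partial>lborel) - (\<integral>t. k t \<partial>lborel)" for x
  have ik: "integrable lborel (\<lambda>t. indicator A t * k t)" if "A \<in> sets borel" for A
    using that k integrable_real_mult_indicator[of A lborel k] by (simp add: mult.commute)
  have diff: "I y = I b + integral {b..y} k" if "b \<le> y" for b y
  proof -
    have "I y - I b = (\<integral>t. indicator {..y} t * k t - indicator {..b} t * k t \<partial>lborel)"
      unfolding I_def by (subst Bochner_Integration.integral_diff) (auto intro: ik)
    also have "\<dots> = (\<integral>t. indicator {b..y} t *\<^sub>R k t \<partial>lborel)"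
    proof (rule integral_cong_AE)
      have "AE t in lborel. t \<noteq> b" by (rule AE_lborel_singleton)
      then show "AE t in lborel. indicator {..y} t * k t - indicator {..b} t * k t = indicator {b..y} t *\<^sub>R k t"
        by eventually_elim (use that in \<open>auto simp: indicator_def\<close>)
    qed (use k in auto)
    also have "\<dots> = integral {b..y} k"
      using set_borel_integral_eq_integral(2)[of "{b..y}" k] ik[of "{b..y}"] by (simp add: set_integrable_def set_lebesgue_integral_def)
    finally show ?thesis by simp
  qed
  have "(I has_real_derivative k x) (at x)" for x
  proof (rule has_field_derivative_transform_within_open[where S="{x-1<..<x+1}" and f="\<lambda>y. I (x - 1) + integral {x-1..y} k"])
    have "((\<lambda>y. integral {x-1..y} k) has_vector_derivative k x) (at x within {x-1..x+1})"
      by (rule integral_has_vector_derivative) (use c in \<open>auto intro: continuous_on_subset\<close>)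
    then have "((\<lambda>y. integral {x-1..y} k) has_real_derivative k x) (at x)"
      by (simp add: has_real_derivative_iff_has_vector_derivative at_within_Icc_at)
    then show "((\<lambda>y. I (x - 1) + integral {x-1..y} k) has_real_derivative k x) (at x)"
      by (auto intro!: derivative_eq_intros)
    show "I (x - 1) + integral {x-1..y} k = I y" if "y \<in> {x-1<..<x+1}" for y
      using diff[of "x - 1" y] that by simp
  qed auto
  moreover have "(I \<longlongrightarrow> 0) at_top"
  proof -
    have "((\<lambda>y. \<integral>t. indicator {..y} t *\<^sub>R k t \<partial>lborel) \<longlongrightarrow> (\<integral>t. k t \<partial>lborel)) at_top"
      by (rule tendsto_integral_at_top) (use k in auto)
    from tendsto_diff[OF this tendsto_const[of "\<integral>t. k t \<partial>lborel"]] show ?thesis by (simp add: I_def[abs_def])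
  qed
  moreover have "(I \<longlongrightarrow> - (\<integral>t. k t \<partial>lborel)) at_bot"
  proof -
    have k': "integrable lborel (\<lambda>t. k (- t))" "(\<integral>t. k (- t) \<partial>lborel) = (\<integral>t. k t \<partial>lborel)"
      using lborel_integrable_real_affine[OF k, of "-1" 0] lborel_integral_real_affine[of "-1" k 0] by auto
    have "((\<lambda>y. \<integral>t. indicator {..y} t *\<^sub>R k (- t) \<partial>lborel) \<longlongrightarrow> (\<integral>t. k (- t) \<partial>lborel)) at_top"
      by (rule tendsto_integral_at_top) (use k' in auto)
    from tendsto_minus[OF this] have "((\<lambda>y. - (\<integral>t. indicator {..y} t * k (- t) \<partial>lborel)) \<longlongrightarrow> - (\<integral>t. k t \<partial>lborel)) at_top"
      by (simp add: k')
    moreover have "- (\<integral>t. indicator {..y} t * k (- t) \<partial>lborel) = I (- y)" for y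
    proof -
      have "(\<integral>t. indicator {..y} t * k (- t) \<partial>lborel) = (\<integral>t. indicator {-y..} t * k t \<partial>lborel)"
        using lborel_integral_real_affine[of "-1" "\<lambda>t. indicator {-y..} t * k t" 0] by (simp add: indicator_def if_distrib cong: if_cong)
      also have "\<dots> = (\<integral>t. k t - indicator {..-y} t * k t \<partial>lborel)"
      proof (rule integral_cong_AE)
        have "AE t in lborel. t \<noteq> - y" by (rule AE_lborel_singleton)
        then show "AE t in lborel. indicator {-y..} t * k t = k t - indicator {..-y} t * k t"
          by eventually_elim (auto simp: indicator_def)
      qed (use k in auto)
      also have "\<dots> = (\<integral>t. k t \<partial>lborel) - (\<integral>t. indicator {..-y} t * k t \<partial>lborel)"
        by (subst Bochner_Integration.integral_diff) (auto intro: ik k)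
      finally show ?thesis by (simp add: I_def)
    qed
    ultimately show ?thesis by (simp add: filterlim_at_bot_mirror)
  qed
  ultimately show thesis by (rule that)
qed

text \<open>The comparison principle behind both half-line bounds: to bound an antiderivative that vanishes at infinity, it suffices
to compare derivatives.\<close>

lemma nonneg_of_decreasing_to_0:
  fixes G G' :: "real \<Rightarrow> real"
  assumes D: "\<And>t. t \<ge> x \<Longrightarrow> (G has_real_derivative G' t) (at t)" and neg: "\<And>t. t \<ge> x \<Longrightarrow> G' t \<le> 0"
    and lim: "(G \<longlongrightarrow> 0) at_top"
  shows "G x \<ge> 0"
proof (rule tendsto_upperbound[OF lim])
  show "\<forall>\<^sub>F t in at_top. G t \<le> G x"
    using eventually_ge_at_top[of x]
  proof eventually_elim
    case (elim t)
    show ?case by (rule DERIV_nonpos_imp_nonincreasing[OF elim]) (use D neg in blast)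
  qed
qed simp

abbreviation gauss :: "real \<Rightarrow> real" where "gauss x \<equiv> exp (- x\<^sup>2 / 2)"

lemma DERIV_gauss: "(gauss has_real_derivative - x * gauss x) (at x)"
  by (auto intro!: derivative_eq_intros simp: power2_eq_square)

lemma gauss_tendsto_0: "(gauss \<longlongrightarrow> 0) at_top" "((\<lambda>x. x * gauss x / (1 + x\<^sup>2)) \<longlongrightarrow> 0) at_top" "((\<lambda>x. gauss x / x) \<longlongrightarrow> 0) at_top"
  by real_asymp+

lemma std_normal_density_gauss: "std_normal_density x = gauss x / sqrt (2 * pi)"
  by (simp add: normal_density_def)

lemma integrable_gauss: "integrable lborel gauss"
  using integrable_mult_right[OF integrable_normal_density[of 1 0], of "sqrt (2 * pi)"]
  by (simp add: std_normal_density_gauss cong: Bochner_Integration.integrable_cong)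

text \<open>If \<open>I' = g \<cdot> gauss\<close> then \<open>f = I / gauss\<close> has derivative \<open>g x + x I / gauss\<close>. Here \<open>\<bar>I\<bar>\<close> is compared with \<open>gauss x / x\<close>, whose derivative
is at most \<open>- gauss\<close>.\<close>

lemma half_line_bound_bounded:
  fixes g I :: "real \<Rightarrow> real"
  assumes g: "\<And>x. \<bar>g x\<bar> \<le> 1"
    and I: "\<And>x. (I has_real_derivative g x * gauss x) (at x)" and lim: "(I \<longlongrightarrow> 0) at_top"
    and x: "x \<ge> 0"
  shows "\<bar>g x + x * I x / gauss x\<bar> \<le> 2"
proof -
  have "x * \<bar>I x\<bar> \<le> gauss x"
  proof (cases "x = 0")
    case False
    with x have x: "x > 0" by simp
    have "gauss x / x + \<sigma> * I x \<ge> 0" if \<sigma>: "\<bar>\<sigma>\<bar> = 1" for \<sigma>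
    proof (rule nonneg_of_decreasing_to_0[of x "\<lambda>t. gauss t / t + \<sigma> * I t"])
      fix t assume "t \<ge> x"
      with x have t: "t > 0" by simp
      show "((\<lambda>t. gauss t / t + \<sigma> * I t) has_real_derivative (- gauss t - gauss t / t\<^sup>2 + \<sigma> * g t * gauss t)) (at t)"
        using t by (auto intro!: derivative_eq_intros DERIV_gauss I simp: power2_eq_square field_simps)
      have "\<bar>\<sigma> * g t\<bar> \<le> 1" using g[of t] unfolding abs_mult \<sigma> by simp
      then have "\<sigma> * g t \<le> 1" by linarith
      then have "\<sigma> * g t * gauss t \<le> 1 * gauss t" by (intro mult_right_mono) auto
      moreover have "gauss t / t\<^sup>2 \<ge> 0" by simp
      ultimately show "- gauss t - gauss t / t\<^sup>2 + \<sigma> * g t * gauss t \<le> 0" by linarith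
    next
      show "((\<lambda>t. gauss t / t + \<sigma> * I t) \<longlongrightarrow> 0) at_top"
        using tendsto_add[OF gauss_tendsto_0(3) tendsto_mult_right_zero[OF lim]] by simp
    qed
    from this[of 1] this[of "-1"] have "\<bar>I x\<bar> \<le> gauss x / x" by simp
    then show ?thesis using x by (simp add: field_simps)
  qed simp
  then have "\<bar>x * I x / gauss x\<bar> \<le> 1" using x by (simp add: abs_mult)
  then show ?thesis using g[of x] by linarith
qed

text \<open>With the Gaussian tail \<open>T\<close>, splitting \<open>I = A - g x \<cdot> T\<close> at the point \<open>x\<close> under consideration leaves a remainder \<open>A\<close> whose derivative is
\<open>(g t - g x) gauss t\<close>, of size at most \<open>(t - x) gauss t\<close>. Everything is then bounded by \<open>(2 x + 1) (gauss x - x T x)\<close>, and the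
lower bound \<open>T x \<ge> x gauss x / (1 + x\<^sup>2)\<close> on the Mills ratio gives the factor \<open>1 / (1 + x\<^sup>2)\<close> that compensates the growth.\<close>

lemma half_line_bound_lipschitz:
  fixes g I :: "real \<Rightarrow> real"
  assumes g: "\<And>x y. \<bar>g x - g y\<bar> \<le> \<bar>x - y\<bar>" "\<And>x. \<bar>g x\<bar> \<le> \<bar>x\<bar> + 1"
    and I: "\<And>x. (I has_real_derivative g x * gauss x) (at x)" and lim: "(I \<longlongrightarrow> 0) at_top"
    and x: "x \<ge> 0"
  shows "\<bar>g x + x * I x / gauss x\<bar> \<le> 2"
proof -
  obtain m where m: "\<And>x. (m has_real_derivative gauss x) (at x)" and m0: "(m \<longlongrightarrow> 0) at_top"
  proof (rule vanishing_antiderivative[OF _ integrable_gauss])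
    show "continuous_on UNIV gauss" by (intro continuous_intros) auto
  qed auto
  define T where "T x = - m x" for x
  have T: "(T has_real_derivative - gauss x) (at x)" for x
    unfolding T_def by (auto intro!: derivative_eq_intros m)
  have T0: "(T \<longlongrightarrow> 0) at_top" using tendsto_minus[OF m0] by (simp add: T_def[abs_def])
  have mills: "T x - x * gauss x / (1 + x\<^sup>2) \<ge> 0"
  proof (rule nonneg_of_decreasing_to_0[of x "\<lambda>t. T t - t * gauss t / (1 + t\<^sup>2)"])
    fix t :: real
    have p: "1 + t\<^sup>2 > 0" by (simp add: add_pos_nonneg)
    have "((\<lambda>t. t * gauss t / (1 + t\<^sup>2)) has_real_derivative
        ((1 * gauss t + - t * gauss t * t) * (1 + t\<^sup>2) - t * gauss t * (2 * t)) / ((1 + t\<^sup>2) * (1 + t\<^sup>2))) (at t)"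
      by (rule DERIV_divide[OF DERIV_mult[OF DERIV_ident DERIV_gauss]])
        (use p in \<open>auto intro!: derivative_eq_intros\<close>)
    moreover have "((1 * gauss t + - t * gauss t * t) * (1 + t\<^sup>2) - t * gauss t * (2 * t)) / ((1 + t\<^sup>2) * (1 + t\<^sup>2))
        = - gauss t + 2 * gauss t / (1 + t\<^sup>2)\<^sup>2"
    proof -
      have "(1 * gauss t + - t * gauss t * t) * (1 + t\<^sup>2) - t * gauss t * (2 * t) = gauss t * (2 - (1 + t\<^sup>2)\<^sup>2)"
        by (simp add: algebra_simps power2_eq_square)
      then show ?thesis using p by (simp add: power2_eq_square[symmetric] field_simps)
    qed
    ultimately show "((\<lambda>t. T t - t * gauss t / (1 + t\<^sup>2)) has_real_derivative - (2 * gauss t / (1 + t\<^sup>2)\<^sup>2)) (at t)"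
      using DERIV_diff[OF T[of t]] by fastforce
    show "- (2 * gauss t / (1 + t\<^sup>2)\<^sup>2) \<le> 0" by simp
  next
    show "((\<lambda>t. T t - t * gauss t / (1 + t\<^sup>2)) \<longlongrightarrow> 0) at_top" using tendsto_diff[OF T0 gauss_tendsto_0(2)] by simp
  qed
  define A where "A t = I t + g x * T t" for t
  have "gauss x - x * T x + \<sigma> * A x \<ge> 0" if \<sigma>: "\<bar>\<sigma>\<bar> = 1" for \<sigma>
  proof (rule nonneg_of_decreasing_to_0[of x "\<lambda>t. gauss t - x * T t + \<sigma> * A t"])
    fix t assume t: "t \<ge> x"
    show "((\<lambda>t. gauss t - x * T t + \<sigma> * A t) has_real_derivative (- (t - x) + \<sigma> * (g t - g x)) * gauss t) (at t)"
      unfolding A_def by (auto intro!: derivative_eq_intros DERIV_gauss I T simp: algebra_simps)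
    have "\<bar>\<sigma> * (g t - g x)\<bar> \<le> t - x" using g(1)[of t x] t unfolding abs_mult \<sigma> by simp
    then have "\<sigma> * (g t - g x) \<le> t - x" by linarith
    then show "(- (t - x) + \<sigma> * (g t - g x)) * gauss t \<le> 0" by (intro mult_nonpos_nonneg) auto
  next
    have "((\<lambda>t. gauss t - x * T t + \<sigma> * (I t + g x * T t)) \<longlongrightarrow> 0 - x * 0 + \<sigma> * (0 + g x * 0)) at_top"
      by (intro tendsto_intros gauss_tendsto_0 T0 lim)
    then show "((\<lambda>t. gauss t - x * T t + \<sigma> * A t) \<longlongrightarrow> 0) at_top" by (simp add: A_def)
  qed
  from this[of 1] this[of "-1"] have A: "\<bar>A x\<bar> \<le> gauss x - x * T x" by simp
  have p: "1 + x\<^sup>2 > 0" by (simp add: add_pos_nonneg)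
  have "x * (x * gauss x / (1 + x\<^sup>2)) \<le> x * T x" using mills x by (intro mult_left_mono) auto
  then have "gauss x - x * T x \<le> gauss x - x\<^sup>2 * gauss x / (1 + x\<^sup>2)" by (simp add: power2_eq_square)
  also have "\<dots> = gauss x / (1 + x\<^sup>2)" using p by (simp add: field_simps)
  finally have w: "gauss x - x * T x \<le> gauss x / (1 + x\<^sup>2)" .
  have w0: "gauss x - x * T x \<ge> 0" using A by linarith
  have "\<bar>g x * gauss x + x * I x\<bar> = \<bar>g x * (gauss x - x * T x) + x * A x\<bar>" by (simp add: A_def algebra_simps)
  also have "\<dots> \<le> \<bar>g x\<bar> * (gauss x - x * T x) + x * \<bar>A x\<bar>"
    using abs_triangle_ineq[of "g x * (gauss x - x * T x)" "x * A x"] w0 x by (simp add: abs_mult)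
  also have "\<dots> \<le> (x + 1) * (gauss x - x * T x) + x * (gauss x - x * T x)"
    using g(2)[of x] x w0 A by (intro add_mono mult_right_mono mult_left_mono) auto
  also have "\<dots> = (2 * x + 1) * (gauss x - x * T x)" by (simp add: algebra_simps)
  also have "\<dots> \<le> (2 * x + 1) * (gauss x / (1 + x\<^sup>2))" using w x by (intro mult_left_mono) auto
  also have "\<dots> = (2 * x + 1) / (1 + x\<^sup>2) * gauss x" by simp
  also have "\<dots> \<le> 2 * gauss x"
  proof (rule mult_right_mono)
    have "0 \<le> x\<^sup>2 + (x - 1)\<^sup>2" by simp
    then have "2 * x + 1 \<le> 2 * (1 + x\<^sup>2)" by (simp add: power2_eq_square algebra_simps)
    then show "(2 * x + 1) / (1 + x\<^sup>2) \<le> 2" using p by (simp add: field_simps)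
  qed simp
  finally have "\<bar>g x * gauss x + x * I x\<bar> / gauss x \<le> 2" by (simp add: field_simps)
  moreover have "g x + x * I x / gauss x = (g x * gauss x + x * I x) / gauss x" by (simp add: field_simps)
  ultimately show ?thesis by (simp add: abs_divide)
qed

text \<open>Because \<open>g\<close> has mean \<open>0\<close>, the antiderivative of \<open>g \<cdot> gauss\<close> vanishes at both infinities, so half-line bounds apply on both sides: the
negative half-line is reduced to the positive one by reflection, which is what the sign \<open>\<sigma>\<close> provides for.\<close>

lemma stein_equation_solution:
  fixes g :: "real \<Rightarrow> real"
  assumes c: "continuous_on UNIV g" and g: "integrable std_normal_distribution g" and mean: "(\<integral>x. g x \<partial>std_normal_distribution) = 0"
    and half: "\<And>\<sigma> I x. \<bar>\<sigma>\<bar> = 1 \<Longrightarrow> (\<And>x. (I has_real_derivative g (\<sigma> * x) * gauss x) (at x)) \<Longrightarrow> (I \<longlongrightarrow> 0) at_top \<Longrightarrow> x \<ge> 0 \<Longrightarrow>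
       \<bar>g (\<sigma> * x) + x * I x / gauss x\<bar> \<le> B"
  obtains f f' where "\<And>x. (f has_real_derivative f' x) (at x)" "continuous_on UNIV f'" "\<And>x. \<bar>f' x\<bar> \<le> B"
    "\<And>x. f' x - x * f x = g x"
proof -
  have [measurable]: "g \<in> borel_measurable borel" using c by (rule borel_measurable_continuous_onI)
  have ig: "integrable lborel (\<lambda>x. std_normal_density x * g x)" using g by (simp add: integrable_density)
  have k: "integrable lborel (\<lambda>x. g x * gauss x)"
    using integrable_mult_right[OF ig, of "sqrt (2 * pi)"] by (simp add: std_normal_density_gauss mult_ac cong: Bochner_Integration.integrable_cong)
  have "(\<integral>x. std_normal_density x * g x \<partial>lborel) = 0" using mean by (simp add: integral_density)
  then have k0: "(\<integral>x. g x * gauss x \<partial>lborel) = 0" by (simp add: std_normal_density_gauss mult_ac)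
  obtain I where I: "\<And>x. (I has_real_derivative g x * gauss x) (at x)" and t: "(I \<longlongrightarrow> 0) at_top" and b: "(I \<longlongrightarrow> 0) at_bot"
  proof (rule vanishing_antiderivative[OF _ k])
    show "continuous_on UNIV (\<lambda>x. g x * gauss x)" by (intro continuous_intros c) auto
  qed (use k0 in auto)
  define f where "f x = I x / gauss x" for x
  define f' where "f' x = g x + x * I x / gauss x" for x
  have "(f has_real_derivative f' x) (at x)" for x
  proof -
    have "((\<lambda>x. I x / gauss x) has_real_derivative (g x * gauss x * gauss x - I x * (- x * gauss x)) / (gauss x * gauss x)) (at x)"
      by (rule DERIV_divide[OF I DERIV_gauss]) simp
    moreover have "(g x * gauss x * gauss x - I x * (- x * gauss x)) / (gauss x * gauss x) = f' x"
      by (simp add: f'_def field_simps)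
    ultimately show ?thesis by (simp add: f_def[abs_def])
  qed
  moreover have "continuous_on UNIV f'"
  proof -
    have "continuous_on UNIV I" using I by (meson DERIV_isCont continuous_at_imp_continuous_on)
    then show ?thesis unfolding f'_def by (intro continuous_intros c) auto
  qed
  moreover have "\<bar>f' x\<bar> \<le> B" for x
  proof (cases "x \<ge> 0")
    case True
    then show ?thesis using half[of 1 I x] I t by (simp add: f'_def)
  next
    case False
    have "\<bar>g (-1 * - x) + - x * - I (- (- x)) / gauss (- x)\<bar> \<le> B"
    proof (rule half)
      show "((\<lambda>x. - I (- x)) has_real_derivative g (-1 * y) * gauss y) (at y)" for y
        using DERIV_minus[OF DERIV_chain2[OF I DERIV_minus[OF DERIV_ident]], of y] by simp
      show "((\<lambda>x. - I (- x)) \<longlongrightarrow> 0) at_top"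
        using tendsto_minus[OF b[unfolded filterlim_at_bot_mirror]] by simp
    qed (use False in auto)
    then show ?thesis by (simp add: f'_def)
  qed
  moreover have "f' x - x * f x = g x" for x by (simp add: f_def f'_def)
  ultimately show thesis by (rule that)
qed


section \<open>Total variation and Wasserstein bounds for the quadratic form\<close>

text \<open>By inner regularity \<open>\<mu> A\<close> is almost attained on a compact \<open>C \<subseteq> A\<close>, and the indicator function of \<open>C\<close> is a decreasing limit of
continuous functions.\<close>

lemma measure_diff_le_of_continuous:
  fixes \<mu> \<nu> :: "real measure"
  assumes "prob_space \<mu>" "prob_space \<nu>" and [measurable_cong]: "sets \<mu> = sets borel" "sets \<nu> = sets borel"
    and h: "\<And>h. continuous_on UNIV h \<Longrightarrow> (\<And>x. 0 \<le> h x) \<Longrightarrow> (\<And>x. h x \<le> 1) \<Longrightarrow> (\<integral>x. h x \<partial>\<mu>) - (\<integral>x. h x \<partial>\<nu>) \<le> b"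
    and A: "A \<in> sets borel"
  shows "measure \<mu> A - measure \<nu> A \<le> b"
proof -
  interpret \<mu>: prob_space \<mu> by fact
  interpret \<nu>: prob_space \<nu> by fact
  have b: "0 \<le> b" using h[of "\<lambda>_. 0"] by simp
  have compact: "measure \<mu> C - measure \<nu> C \<le> b" if C: "compact C" for C
  proof (cases "C = {}")
    case False
    have cl: "closed C" using C by (rule compact_imp_closed)
    then have [measurable]: "C \<in> sets borel" by auto
    define g where "g n x = max 0 (1 - real n * infdist x C)" for n x
    have cg: "continuous_on UNIV (g n)" for n unfolding g_def by (intro continuous_intros)
    then have [measurable]: "g n \<in> borel_measurable borel" for n by (rule borel_measurable_continuous_onI)
    have g: "0 \<le> g n x" "g n x \<le> 1" for n x by (auto simp: g_def infdist_nonneg)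
    have "(\<lambda>n. \<integral>x. g n x \<partial>\<nu>) \<longlonglongrightarrow> (\<integral>x. indicator C x \<partial>\<nu>)"
    proof (rule integral_dominated_convergence[where w="\<lambda>_. 1"])
      show "AE x in \<nu>. (\<lambda>n. g n x) \<longlonglongrightarrow> indicator C x"
      proof (rule AE_I2)
        fix x
        show "(\<lambda>n. g n x) \<longlonglongrightarrow> indicator C x"
        proof (cases "x \<in> C")
          case True then show ?thesis by (simp add: g_def)
        next
          case x: False
          then have d: "infdist x C > 0" using cl False infdist_nonneg[of x C] in_closed_iff_infdist_zero[of C x] by fastforce
          have "\<forall>\<^sub>F n in sequentially. real n \<ge> 1 / infdist x C"
            using filterlim_real_sequentially by (simp add: filterlim_at_top)
          then have "\<forall>\<^sub>F n in sequentially. g n x = 0"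
            by eventually_elim (use d in \<open>auto simp: g_def field_simps max_def\<close>)
          then show ?thesis using x by (simp add: tendsto_eventually)
        qed
      qed
    qed (use g in auto)
    then have lim: "(\<lambda>n. \<integral>x. g n x \<partial>\<nu>) \<longlonglongrightarrow> measure \<nu> C" by simp
    have "measure \<mu> C - b \<le> (\<integral>x. g n x \<partial>\<nu>)" for n
    proof -
      have "measure \<mu> C = (\<integral>x. indicator C x \<partial>\<mu>)" by simp
      also have "\<dots> \<le> (\<integral>x. g n x \<partial>\<mu>)"
      proof (rule integral_mono)
        show "integrable \<mu> (g n)" by (rule \<mu>.integrable_const_bound[where B=1]) (use g in auto)
        show "indicator C x \<le> g n x" for x using g by (auto simp: indicator_def g_def)
      qed (auto intro: \<mu>.integrable_const_bound[where B=1])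
      finally show ?thesis using h[OF cg g, of n] by linarith
    qed
    then have "measure \<mu> C - b \<le> measure \<nu> C" by (intro LIMSEQ_le_const[OF lim]) auto
    then show ?thesis by simp
  qed (use b in simp)
  show ?thesis
  proof (rule field_le_epsilon)
    fix e :: real assume e: "e > 0"
    have reg: "emeasure \<mu> A = (SUP C \<in> {C. C \<subseteq> A \<and> compact C}. emeasure \<mu> C)"
      by (rule inner_regular) (use A assms in auto)
    have "\<exists>C. C \<subseteq> A \<and> compact C \<and> measure \<mu> A < measure \<mu> C + e"
    proof (cases "measure \<mu> A < e")
      case True then show ?thesis by (intro exI[of _ "{}"]) auto
    next
      case False
      have "ennreal (measure \<mu> A - e) < emeasure \<mu> A"
        using False e by (simp add: \<mu>.emeasure_eq_measure ennreal_less_iff)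
      then obtain C where "C \<subseteq> A" "compact C" "ennreal (measure \<mu> A - e) < emeasure \<mu> C"
        unfolding reg less_SUP_iff by auto
      then show ?thesis using False by (intro exI[of _ C]) (auto simp: \<mu>.emeasure_eq_measure ennreal_less_iff)
    qed
    then obtain C where C: "C \<subseteq> A" "compact C" "measure \<mu> A < measure \<mu> C + e" by blast
    have "measure \<nu> C \<le> measure \<nu> A" by (rule \<nu>.finite_measure_mono) (use C A assms in auto)
    then show "measure \<mu> A - measure \<nu> A \<le> b + e" using compact[OF C(2)] C(3) by linarith
  qed
qed

lemma abs_measure_diff_le_of_continuous:
  fixes \<mu> \<nu> :: "real measure"
  assumes p: "prob_space \<mu>" "prob_space \<nu>" and s: "sets \<mu> = sets borel" "sets \<nu> = sets borel"
    and h: "\<And>h. continuous_on UNIV h \<Longrightarrow> (\<And>x. 0 \<le> h x) \<Longrightarrow> (\<And>x. h x \<le> 1) \<Longrightarrow> \<bar>(\<integral>x. h x \<partial>\<mu>) - (\<integral>x. h x \<partial>\<nu>)\<bar> \<le> b"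
    and A: "A \<in> sets borel"
  shows "\<bar>measure \<mu> A - measure \<nu> A\<bar> \<le> b"
proof -
  have "measure \<mu> A - measure \<nu> A \<le> b" "measure \<nu> A - measure \<mu> A \<le> b"
    by (rule measure_diff_le_of_continuous; use p s A h in \<open>force\<close>)+
  then show ?thesis by linarith
qed

lemma distributed_std_normal_distr:
  "distributed N lborel G std_normal_density \<Longrightarrow> distr N borel G = std_normal_distribution"
  using distributed_distr_eq_density[of N lborel G] by (simp cong: distr_cong)

lemma std_normal_prob_UNIV: "measure std_normal_distribution UNIV = 1"
  using prob_space.prob_space[OF prob_space_normal_density[of 1 0]] by simp

lemma std_normal_abs_le_1:
  "integrable std_normal_distribution (\<lambda>x. \<bar>x\<bar>)" "(\<integral>x. \<bar>x\<bar> \<partial>std_normal_distribution) \<le> 1"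
proof -
  show i: "integrable std_normal_distribution (\<lambda>x. \<bar>x\<bar>)"
    using integrable_norm[OF integrable_std_normal_distribution_moment[of 1]] by simp
  have "(\<integral>x. \<bar>x\<bar> \<partial>std_normal_distribution) = sqrt (2 / pi)"
    using std_normal_distribution_odd_moments_abs[of 0] by simp
  also have "\<dots> \<le> 1" using pi_gt3 by (simp add: real_sqrt_le_1_iff)
  finally show "(\<integral>x. \<bar>x\<bar> \<partial>std_normal_distribution) \<le> 1" .
qed

lemma integral_std_normal_eq:
  assumes G: "distributed N lborel G std_normal_density" and h: "h \<in> borel_measurable borel"
  shows "(\<integral>\<omega>. h (G \<omega>) \<partial>N) = (\<integral>x. h x \<partial>std_normal_distribution :: real)"
proof -
  have [measurable]: "G \<in> borel_measurable N" using distributed_measurable[OF G] by simp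
  show ?thesis unfolding distributed_std_normal_distr[OF G, symmetric] using h by (simp add: integral_distr)
qed

context gaussian_quadratic
begin

lemma test_function_bound:
  assumes c: "continuous_on UNIV h" and int: "integrable std_normal_distribution h" and intF: "integrable M (\<lambda>\<omega>. h (F (vec \<omega>)))"
    and half: "\<And>\<sigma> I x. \<bar>\<sigma>\<bar> = 1 \<Longrightarrow>
       (\<And>x. (I has_real_derivative (h (\<sigma> * x) - (\<integral>x. h x \<partial>std_normal_distribution)) * gauss x) (at x)) \<Longrightarrow>
       (I \<longlongrightarrow> 0) at_top \<Longrightarrow> x \<ge> 0 \<Longrightarrow> \<bar>(h (\<sigma> * x) - (\<integral>x. h x \<partial>std_normal_distribution)) + x * I x / gauss x\<bar> \<le> 2"
  shows "\<bar>EE (\<lambda>z. h (F z)) - (\<integral>x. h x \<partial>std_normal_distribution)\<bar> \<le> 28 * \<tau>"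
proof -
  interpret \<gamma>: prob_space std_normal_distribution by (rule prob_space_normal_density) simp
  define m where "m = (\<integral>x. h x \<partial>std_normal_distribution)"
  obtain f f' where f: "\<And>x. (f has_real_derivative f' x) (at x)" "continuous_on UNIV f'" "\<And>x. \<bar>f' x\<bar> \<le> 2"
    and eq: "\<And>x. f' x - x * f x = h x - m"
  proof (rule stein_equation_solution[of "\<lambda>x. h x - m" 2])
    show "continuous_on UNIV (\<lambda>x. h x - m)" by (intro continuous_intros c)
    show "integrable std_normal_distribution (\<lambda>x. h x - m)" using int by auto
    show "(\<integral>x. h x - m \<partial>std_normal_distribution) = 0"
      using int by (subst Bochner_Integration.integral_diff) (auto simp: m_def std_normal_prob_UNIV)
  qed (use half in \<open>auto simp: m_def\<close>)
  have "EE (\<lambda>z. h (F z)) - m = EE (\<lambda>z. h (F z) - m)"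
    using intF by (subst Bochner_Integration.integral_diff) (auto simp: prob_space)
  also have "\<dots> = EE (\<lambda>z. f' (F z) - F z * f (F z))" by (simp add: eq)
  finally show ?thesis using stein_discrepancy_bound[OF f] by (simp add: m_def)
qed

lemma bounded_test_function:
  assumes c: "continuous_on UNIV h" and h: "\<And>x. 0 \<le> h x" "\<And>x. h x \<le> 1"
  shows "\<bar>EE (\<lambda>z. h (F z)) - (\<integral>x. h x \<partial>std_normal_distribution)\<bar> \<le> 28 * \<tau>"
proof (rule test_function_bound[OF c])
  interpret \<gamma>: prob_space std_normal_distribution by (rule prob_space_normal_density) simp
  have [measurable]: "h \<in> borel_measurable borel" using c by (rule borel_measurable_continuous_onI)
  have [measurable]: "(\<lambda>\<omega>. F (vec \<omega>)) \<in> borel_measurable M" by (rule all_moments_measurable[OF mom_F])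
  have ab: "\<bar>h x\<bar> \<le> 1" for x using h[of x] by simp
  show int: "integrable std_normal_distribution h" by (rule \<gamma>.integrable_const_bound[where B=1]) (use ab in auto)
  show "integrable M (\<lambda>\<omega>. h (F (vec \<omega>)))" by (rule integrable_const_bound[where B=1]) (use ab in auto)
  have m: "0 \<le> (\<integral>x. h x \<partial>std_normal_distribution)" "(\<integral>x. h x \<partial>std_normal_distribution) \<le> 1"
  proof -
    show "0 \<le> (\<integral>x. h x \<partial>std_normal_distribution)" by (rule Bochner_Integration.integral_nonneg) (rule h)
    show "(\<integral>x. h x \<partial>std_normal_distribution) \<le> 1"
      using integral_mono[OF int, of "\<lambda>_. 1"] h by (simp add: std_normal_prob_UNIV)
  qed
  fix \<sigma> :: real and I :: "real \<Rightarrow> real" and x :: real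
  assume I: "\<And>x. (I has_real_derivative (h (\<sigma> * x) - (\<integral>x. h x \<partial>std_normal_distribution)) * gauss x) (at x)" "(I \<longlongrightarrow> 0) at_top" "0 \<le> x"
  have "\<bar>h (\<sigma> * x) - (\<integral>x. h x \<partial>std_normal_distribution)\<bar> \<le> 1" for x using h[of "\<sigma> * x"] m by linarith
  from half_line_bound_bounded[OF this I]
  show "\<bar>(h (\<sigma> * x) - (\<integral>x. h x \<partial>std_normal_distribution)) + x * I x / gauss x\<bar> \<le> 2" .
qed

text \<open>The Lipschitz property and \<open>E\<bar>N\<bar> \<le> 1\<close> for standard normal \<open>N\<close> give the linear growth that the half-line bound requires.\<close>

lemma lipschitz_test_function:
  assumes h: "1-lipschitz_on UNIV (h :: real \<Rightarrow> real)"
  shows "\<bar>EE (\<lambda>z. h (F z)) - (\<integral>x. h x \<partial>std_normal_distribution)\<bar> \<le> 28 * \<tau>"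
proof (rule test_function_bound)
  interpret \<gamma>: prob_space std_normal_distribution by (rule prob_space_normal_density) simp
  show c: "continuous_on UNIV h" using h by (rule lipschitz_on_continuous_on)
  have [measurable]: "h \<in> borel_measurable borel" using c by (rule borel_measurable_continuous_onI)
  have [measurable]: "(\<lambda>\<omega>. F (vec \<omega>)) \<in> borel_measurable M" by (rule all_moments_measurable[OF mom_F])
  have L: "\<bar>h x - h y\<bar> \<le> \<bar>x - y\<bar>" for x y using lipschitz_onD[OF h, of x y] by (simp add: dist_real_def)
  have gr: "\<bar>h x\<bar> \<le> \<bar>h 0\<bar> + \<bar>x\<bar>" for x using L[of x 0] by simp
  show int: "integrable std_normal_distribution h"
    by (rule Bochner_Integration.integrable_bound[where f="\<lambda>x. \<bar>h 0\<bar> + \<bar>x\<bar>"])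
      (use gr std_normal_abs_le_1(1) in \<open>auto intro!: Bochner_Integration.integrable_add AE_I2\<close>)
  show "integrable M (\<lambda>\<omega>. h (F (vec \<omega>)))"
  proof (rule Bochner_Integration.integrable_bound)
    show "integrable M (\<lambda>\<omega>. \<bar>h 0\<bar> + \<bar>F (vec \<omega>)\<bar>)" by (intro all_moments_integrable mom_intros)
    show "AE \<omega> in M. norm (h (F (vec \<omega>))) \<le> norm (\<bar>h 0\<bar> + \<bar>F (vec \<omega>)\<bar>)" using gr by (intro AE_I2) auto
  qed measurable
  define m where "m = (\<integral>x. h x \<partial>std_normal_distribution)"
  have mx: "\<bar>h x - m\<bar> \<le> \<bar>x\<bar> + 1" for x
  proof -
    have "h x - m = (\<integral>y. h x - h y \<partial>std_normal_distribution)"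
      using int by (subst Bochner_Integration.integral_diff) (auto simp: m_def std_normal_prob_UNIV)
    also have "\<bar>\<dots>\<bar> \<le> (\<integral>y. \<bar>h x - h y\<bar> \<partial>std_normal_distribution)" by (rule integral_abs_bound)
    also have "\<dots> \<le> (\<integral>y. \<bar>x\<bar> + \<bar>y\<bar> \<partial>std_normal_distribution)"
    proof (rule integral_mono)
      show "\<bar>h x - h y\<bar> \<le> \<bar>x\<bar> + \<bar>y\<bar>" for y using L[of x y] by linarith
    qed (use int std_normal_abs_le_1(1) in auto)
    also have "\<dots> = \<bar>x\<bar> + (\<integral>y. \<bar>y\<bar> \<partial>std_normal_distribution)"
      using std_normal_abs_le_1(1) by (subst Bochner_Integration.integral_add) (auto simp: std_normal_prob_UNIV)
    finally show ?thesis using std_normal_abs_le_1(2) by linarith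
  qed
  fix \<sigma> :: real and I :: "real \<Rightarrow> real" and x :: real
  assume \<sigma>: "\<bar>\<sigma>\<bar> = (1::real)" and I: "\<And>x. (I has_real_derivative (h (\<sigma> * x) - (\<integral>x. h x \<partial>std_normal_distribution)) * gauss x) (at x)" "(I \<longlongrightarrow> 0) at_top" "0 \<le> x"
  have 1: "\<bar>(h (\<sigma> * x) - m) - (h (\<sigma> * y) - m)\<bar> \<le> \<bar>x - y\<bar>" for x y
    using L[of "\<sigma> * x" "\<sigma> * y"] unfolding right_diff_distrib[symmetric] abs_mult \<sigma> by simp
  have 2: "\<bar>h (\<sigma> * x) - m\<bar> \<le> \<bar>x\<bar> + 1" for x using mx[of "\<sigma> * x"] unfolding abs_mult \<sigma> by simp
  show "\<bar>(h (\<sigma> * x) - (\<integral>x. h x \<partial>std_normal_distribution)) + x * I x / gauss x\<bar> \<le> 2"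
    using half_line_bound_lipschitz[OF 1 2 I[folded m_def]] unfolding m_def .
qed

theorem d_TV_bound:
  assumes N: "prob_space N" and G: "distributed N lborel G std_normal_density"
  shows "d_TV M (\<lambda>\<omega>. F (vec \<omega>)) N G \<le> 28 * \<tau>"
proof -
  have mG[measurable]: "G \<in> borel_measurable N" using distributed_measurable[OF G] by simp
  have mF[measurable]: "(\<lambda>\<omega>. F (vec \<omega>)) \<in> borel_measurable M" by (rule all_moments_measurable[OF mom_F])
  have "\<bar>measure (distr M borel (\<lambda>\<omega>. F (vec \<omega>))) A - measure (distr N borel G) A\<bar> \<le> 28 * \<tau>" if "A \<in> sets borel" for A
  proof (rule abs_measure_diff_le_of_continuous)
    fix h :: "real \<Rightarrow> real" assume h: "continuous_on UNIV h" "\<And>x. 0 \<le> h x" "\<And>x. h x \<le> 1"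
    have [measurable]: "h \<in> borel_measurable borel" using h(1) by (rule borel_measurable_continuous_onI)
    show "\<bar>(\<integral>x. h x \<partial>distr M borel (\<lambda>\<omega>. F (vec \<omega>))) - (\<integral>x. h x \<partial>distr N borel G)\<bar> \<le> 28 * \<tau>"
      using bounded_test_function[OF h] by (simp add: integral_distr integral_std_normal_eq[OF G])
  qed (use that N in \<open>auto intro: prob_space_distr prob_space.prob_space_distr\<close>)
  then show ?thesis unfolding d_TV_def
    by (intro cSUP_least) (auto simp: measure_distr vimage_def Int_def conj_commute)
qed

theorem d_W_bound:
  assumes G: "distributed N lborel G std_normal_density"
  shows "d_W M (\<lambda>\<omega>. F (vec \<omega>)) N G \<le> ereal (28 * \<tau>)"
  unfolding d_W_def
proof (rule SUP_least)
  fix h :: "real \<Rightarrow> real" assume "h \<in> {h. 1-lipschitz_on UNIV h}"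
  then have h: "1-lipschitz_on UNIV h" by simp
  then have "h \<in> borel_measurable borel"
    by (intro borel_measurable_continuous_onI lipschitz_on_continuous_on)
  then show "ereal \<bar>EE (\<lambda>z. h (F z)) - (\<integral>\<omega>. h (G \<omega>) \<partial>N)\<bar> \<le> ereal (28 * \<tau>)"
    using lipschitz_test_function[OF h] by (simp add: integral_std_normal_eq[OF G])
qed

end


section \<open>Estimates for sampled covariance functions\<close>

lemma powr_three_halves:
  assumes "x \<ge> 0" shows "x powr (3/2) = sqrt x ^ 3"
proof (cases "x = 0")
  case False
  with assms have x: "x > 0" by simp
  have "x powr (3/2) = (x powr (1/2)) powr 3" by (simp add: powr_powr)
  then show ?thesis using x by (simp add: powr_half_sqrt)
qed simp

text \<open>The inequality of arithmetic and geometric means for \<open>(p q)\<^sup>3\<^sup>/\<^sup>2\<close>, \<open>(p r)\<^sup>3\<^sup>/\<^sup>2\<close>, \<open>(q r)\<^sup>3\<^sup>/\<^sup>2\<close>. It decouples a cyclic product, as Young's convolution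
inequality does in the continuous setting.\<close>

lemma triple_product_le:
  fixes p q r :: real
  assumes "p \<ge> 0" "q \<ge> 0" "r \<ge> 0"
  shows "3 * (p * q * r) \<le> sqrt p ^ 3 * sqrt q ^ 3 + sqrt p ^ 3 * sqrt r ^ 3 + sqrt q ^ 3 * sqrt r ^ 3"
proof -
  define x y z where "x = sqrt p * sqrt q" and "y = sqrt p * sqrt r" and "z = sqrt q * sqrt r"
  have nn: "x \<ge> 0" "y \<ge> 0" "z \<ge> 0" using assms by (auto simp: x_def y_def z_def)
  have "x ^ 3 + y ^ 3 + z ^ 3 - 3 * (x * y * z) = (x + y + z) * ((x - y)\<^sup>2 + (y - z)\<^sup>2 + (z - x)\<^sup>2) / 2"
    by (simp add: power2_eq_square power3_eq_cube algebra_simps)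
  also have "\<dots> \<ge> 0" using nn by simp
  finally have "3 * (x * y * z) \<le> x ^ 3 + y ^ 3 + z ^ 3" by simp
  moreover have "x * y * z = (sqrt p)\<^sup>2 * (sqrt q)\<^sup>2 * (sqrt r)\<^sup>2"
    unfolding x_def y_def z_def power2_eq_square by (simp add: mult_ac)
  then have "x * y * z = p * q * r" using assms by simp
  moreover have "x ^ 3 = sqrt p ^ 3 * sqrt q ^ 3" "y ^ 3 = sqrt p ^ 3 * sqrt r ^ 3" "z ^ 3 = sqrt q ^ 3 * sqrt r ^ 3"
    unfolding x_def y_def z_def by (simp_all only: power_mult_distrib)
  ultimately show ?thesis by simp
qed

lemma sum_triple_le:
  fixes x :: "'k \<Rightarrow> 'k \<Rightarrow> real" and B :: real
  assumes K: "finite K" and x: "\<And>i j. x i j \<ge> 0" "\<And>i j. x i j = x j i" and B: "\<And>i. i \<in> K \<Longrightarrow> (\<Sum>j\<in>K. x i j) \<le> B" "B \<ge> 0"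
  shows "(\<Sum>i\<in>K. \<Sum>j\<in>K. \<Sum>k\<in>K. x i j * x i k) \<le> card K * B\<^sup>2"
proof -
  have "(\<Sum>i\<in>K. \<Sum>j\<in>K. \<Sum>k\<in>K. x i j * x i k) = (\<Sum>i\<in>K. (\<Sum>j\<in>K. x i j)\<^sup>2)"
    by (simp add: power2_eq_square sum_product)
  also have "\<dots> \<le> (\<Sum>i\<in>K. B\<^sup>2)" by (intro sum_mono power_mono B sum_nonneg x)
  finally show ?thesis by simp
qed

text \<open>After \<open>triple_product_le\<close> each product involves only two of the three pairs of indices, so two sums are row sums.\<close>

lemma trace_cube_le:
  fixes R :: "'k \<Rightarrow> 'k \<Rightarrow> real" and B :: real
  assumes K: "finite K" and sym: "\<And>i j. R i j = R j i"
    and B: "\<And>i. i \<in> K \<Longrightarrow> (\<Sum>j\<in>K. sqrt \<bar>R i j\<bar> ^ 3) \<le> B" "B \<ge> 0"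
  shows "(\<Sum>i\<in>K. \<Sum>j\<in>K. \<Sum>k\<in>K. R i j * R i k * R j k) \<le> card K * B\<^sup>2"
proof -
  define x where "x i j = sqrt \<bar>R i j\<bar> ^ 3" for i j
  have x: "x i j \<ge> 0" "x i j = x j i" for i j using sym[of i j] by (auto simp: x_def)
  note t = sum_triple_le[of K x B, OF K x B[folded x_def]]
  have "(\<Sum>i\<in>K. \<Sum>j\<in>K. \<Sum>k\<in>K. R i j * R i k * R j k) \<le> (\<Sum>i\<in>K. \<Sum>j\<in>K. \<Sum>k\<in>K. (x i j * x i k + x i j * x j k + x i k * x j k) / 3)"
  proof (intro sum_mono)
    fix i j k
    have "R i j * R i k * R j k \<le> \<bar>R i j\<bar> * \<bar>R i k\<bar> * \<bar>R j k\<bar>" by (metis abs_ge_self abs_mult)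
    then show "R i j * R i k * R j k \<le> (x i j * x i k + x i j * x j k + x i k * x j k) / 3"
      using triple_product_le[of "\<bar>R i j\<bar>" "\<bar>R i k\<bar>" "\<bar>R j k\<bar>"] by (simp add: x_def)
  qed
  also have "\<dots> = ((\<Sum>i\<in>K. \<Sum>j\<in>K. \<Sum>k\<in>K. x i j * x i k) + (\<Sum>i\<in>K. \<Sum>j\<in>K. \<Sum>k\<in>K. x i j * x j k) + (\<Sum>i\<in>K. \<Sum>j\<in>K. \<Sum>k\<in>K. x i k * x j k)) / 3"
    by (simp add: sum.distrib sum_divide_distrib[symmetric])
  also have "(\<Sum>i\<in>K. \<Sum>j\<in>K. \<Sum>k\<in>K. x i j * x j k) = (\<Sum>i\<in>K. \<Sum>j\<in>K. \<Sum>k\<in>K. x i j * x i k)"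
    by (subst sum.swap) (simp add: x(2))
  also have "(\<Sum>i\<in>K. \<Sum>j\<in>K. \<Sum>k\<in>K. x i k * x j k) = (\<Sum>i\<in>K. \<Sum>k\<in>K. \<Sum>j\<in>K. x i k * x j k)"
    by (intro sum.cong refl sum.swap)
  also have "\<dots> = (\<Sum>i\<in>K. \<Sum>j\<in>K. \<Sum>k\<in>K. x i j * x i k)"
    by (subst sum.swap) (simp add: x(2))
  finally show ?thesis using t by simp
qed

lemma row_sum_le:
  fixes y :: "real \<Rightarrow> real"
  assumes y: "\<And>t. y t \<ge> 0" and i: "i \<in> {1..n}"
  shows "(\<Sum>j=1..n. y (real_of_int \<bar>int j - int i\<bar> * d)) \<le> 2 * (\<Sum>m<n. y (real m * d))"
proof -
  have "(\<Sum>j=1..n. y (real_of_int \<bar>int j - int i\<bar> * d)) =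
      (\<Sum>j\<in>{i..n}. y (real_of_int \<bar>int j - int i\<bar> * d)) + (\<Sum>j\<in>{1..<i}. y (real_of_int \<bar>int j - int i\<bar> * d))"
    by (subst sum.union_disjoint[symmetric]) (use i in \<open>auto intro!: sum.cong\<close>)
  also have "(\<Sum>j\<in>{i..n}. y (real_of_int \<bar>int j - int i\<bar> * d)) = (\<Sum>m\<in>(\<lambda>j. j - i) ` {i..n}. y (real m * d))"
    by (subst sum.reindex) (auto simp: inj_on_def of_nat_diff intro!: sum.cong)
  also have "\<dots> \<le> (\<Sum>m<n. y (real m * d))" using i y by (intro sum_mono2) auto
  also have "(\<Sum>j\<in>{1..<i}. y (real_of_int \<bar>int j - int i\<bar> * d)) = (\<Sum>m\<in>(\<lambda>j. i - j) ` {1..<i}. y (real m * d))"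
    by (subst sum.reindex) (auto simp: inj_on_def of_nat_diff intro!: sum.cong)
  also have "\<dots> \<le> (\<Sum>m<n. y (real m * d))" using i y by (intro sum_mono2) auto
  finally show ?thesis by simp
qed

lemma sqrt_cube_add_le:
  assumes "a \<ge> 0" "b \<ge> 0"
  shows "sqrt (a + b) ^ 3 \<le> 3 * (sqrt a ^ 3 + sqrt b ^ 3)"
proof -
  define m where "m = max a b"
  have "sqrt (a + b) ^ 3 \<le> sqrt (2 * m) ^ 3" by (intro power_mono) (use assms in \<open>auto simp: m_def\<close>)
  also have "\<dots> = 2 * sqrt 2 * sqrt m ^ 3" by (simp add: real_sqrt_mult power_mult_distrib) (simp add: power3_eq_cube)
  also have "\<dots> \<le> 3 * sqrt m ^ 3"
  proof (rule mult_right_mono)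
    have "sqrt 2 \<le> 3 / 2" by (rule real_le_lsqrt) (auto simp: power2_eq_square)
    then show "2 * sqrt 2 \<le> 3" by simp
  qed (use assms in \<open>auto simp: m_def max_def\<close>)
  also have "sqrt m ^ 3 \<le> sqrt a ^ 3 + sqrt b ^ 3" using assms by (auto simp: m_def max_def)
  finally show ?thesis by simp
qed

text \<open>\<open>e\<close> is the oscillation of \<open>\<rho>\<close> on intervals of length \<open>d\<close>; \<open>sqrt_cube_add_le\<close> separates it from the integrand.\<close>

lemma riemann_sum_le:
  fixes \<rho> :: "real \<Rightarrow> real"
  assumes c: "continuous_on UNIV \<rho>" and d: "d > 0" and e: "e \<ge> 0"
    and osc: "\<And>s t. \<bar>s - t\<bar> \<le> d \<Longrightarrow> \<bar>\<rho> s - \<rho> t\<bar> \<le> e"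
  shows "d * (\<Sum>m<n. sqrt \<bar>\<rho> (real m * d)\<bar> ^ 3) \<le> integral {0..real n * d} (\<lambda>t. 3 * (sqrt \<bar>\<rho> t\<bar> ^ 3 + sqrt e ^ 3))"
proof (induction n)
  case (Suc n)
  let ?g = "\<lambda>t. 3 * (sqrt \<bar>\<rho> t\<bar> ^ 3 + sqrt e ^ 3)"
  have cg: "continuous_on S ?g" for S
    by (intro continuous_intros continuous_on_subset[OF c]) auto
  have "d * sqrt \<bar>\<rho> (real n * d)\<bar> ^ 3 = integral {real n * d..real (Suc n) * d} (\<lambda>_. sqrt \<bar>\<rho> (real n * d)\<bar> ^ 3)"
    using d by (simp add: algebra_simps)
  also have "\<dots> \<le> integral {real n * d..real (Suc n) * d} ?g"
  proof (rule integral_le)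
    fix t assume t: "t \<in> {real n * d..real (Suc n) * d}"
    then have "\<bar>real n * d - t\<bar> \<le> d" by (auto simp: algebra_simps)
    from osc[OF this] have "\<bar>\<rho> (real n * d)\<bar> \<le> \<bar>\<rho> t\<bar> + e" by linarith
    then have "sqrt \<bar>\<rho> (real n * d)\<bar> ^ 3 \<le> sqrt (\<bar>\<rho> t\<bar> + e) ^ 3" by (intro power_mono) auto
    also have "\<dots> \<le> ?g t" by (rule sqrt_cube_add_le) (use e in auto)
    finally show "sqrt \<bar>\<rho> (real n * d)\<bar> ^ 3 \<le> ?g t" .
  next
    show "?g integrable_on {real n * d..real (Suc n) * d}" by (rule integrable_continuous_real[OF cg])
  qed auto
  finally have "d * sqrt \<bar>\<rho> (real n * d)\<bar> ^ 3 \<le> integral {real n * d..real (Suc n) * d} ?g" .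
  moreover have "integral {0..real n * d} ?g + integral {real n * d..real (Suc n) * d} ?g = integral {0..real (Suc n) * d} ?g"
  proof (rule Henstock_Kurzweil_Integration.integral_combine)
    show "?g integrable_on {0..real (Suc n) * d}" by (rule integrable_continuous_real[OF cg])
  qed (use d in auto)
  ultimately show ?case using Suc by (simp add: distrib_left)
qed simp

text \<open>Every row of the matrix has at least \<open>\<eta> / (2 d)\<close> entries at distance at most \<open>\<eta>\<close> from the diagonal, to the left or to the right of it.\<close>

lemma sum_square_lower_bound:
  fixes \<rho> :: "real \<Rightarrow> real"
  assumes d: "0 < d" "2 * d \<le> \<eta>" and n: "2 * \<eta> \<le> real n * d" and v: "v > 0"
    and near: "\<And>t. \<bar>t\<bar> \<le> \<eta> \<Longrightarrow> v \<le> \<rho> t"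
  shows "\<eta> * v\<^sup>2 / 2 * (real n)\<^sup>2 / (real n * d) \<le> (\<Sum>i=1..n. \<Sum>j=1..n. (\<rho> ((real j - real i) * d))\<^sup>2)"
proof -
  define m where "m = nat \<lfloor>\<eta> / d\<rfloor>"
  have \<eta>: "\<eta> / d \<ge> 2" using d by (simp add: field_simps)
  have m: "real m \<le> \<eta> / d" "real m \<ge> \<eta> / d - 1" using \<eta> by (auto simp: m_def)
  have "real m * d \<le> \<eta>" using m(1) d by (simp add: field_simps)
  then have "(2 * real m) * d \<le> real n * d" using n by linarith
  then have "2 * real m \<le> real n" using d by simp
  then have mn: "2 * m \<le> n" by linarith
  have md: "real k * d \<le> \<eta>" if "k \<le> m" for k
  proof -
    have "real k * d \<le> real m * d" using that d by simp
    also have "\<dots> \<le> \<eta>" using m(1) d by (simp add: field_simps)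
    finally show ?thesis .
  qed
  have row: "real m * v\<^sup>2 \<le> (\<Sum>j=1..n. (\<rho> ((real j - real i) * d))\<^sup>2)" if i: "i \<in> {1..n}" for i
  proof -
    \<comment> \<open>The m neighbours of i below it if there are so many, and otherwise the m neighbours above it.\<close>
    define J where "J = (if i > m then {i - m..<i} else {i<..i + m})"
    have J: "J \<subseteq> {1..n}" "card J = m" "finite J" using i mn by (auto simp: J_def)
    have "real m * v\<^sup>2 = (\<Sum>j\<in>J. v\<^sup>2)" using J by simp
    also have "\<dots> \<le> (\<Sum>j\<in>J. (\<rho> ((real j - real i) * d))\<^sup>2)"
    proof (rule sum_mono)
      fix j assume j: "j \<in> J"
      define k where "k = nat \<bar>int j - int i\<bar>"
      have "k \<le> m" using j by (auto simp: J_def k_def split: if_splits)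
      moreover have "\<bar>(real j - real i) * d\<bar> = real k * d" using d by (simp add: k_def abs_mult)
      ultimately have "\<bar>(real j - real i) * d\<bar> \<le> \<eta>" using md by simp
      then show "v\<^sup>2 \<le> (\<rho> ((real j - real i) * d))\<^sup>2" using near v by (intro power_mono) auto
    qed
    also have "\<dots> \<le> (\<Sum>j=1..n. (\<rho> ((real j - real i) * d))\<^sup>2)" using J by (intro sum_mono2) auto
    finally show ?thesis .
  qed
  have n0: "real n > 0" using n d \<eta> by (cases "n = 0") (auto simp: field_simps)
  have "\<eta> * v\<^sup>2 / 2 * (real n)\<^sup>2 / (real n * d) = real n * (\<eta> / d / 2 * v\<^sup>2)"
    using n0 d by (simp add: field_simps power2_eq_square)
  also have "\<dots> \<le> real n * (real m * v\<^sup>2)"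
    using m \<eta> by (intro mult_left_mono mult_right_mono) auto
  also have "\<dots> = (\<Sum>i=1..n. real m * v\<^sup>2)" by simp
  also have "\<dots> \<le> (\<Sum>i=1..n. \<Sum>j=1..n. (\<rho> ((real j - real i) * d))\<^sup>2)" by (intro sum_mono row)
  finally show ?thesis .
qed


text \<open>The quantity \<open>\<tau>\<close> for the covariance matrix \<open>\<rho> ((j - i) d)\<close>, \<open>1 \<le> i, j \<le> n\<close>.\<close>

definition sampled_tau :: "(real \<Rightarrow> real) \<Rightarrow> nat \<Rightarrow> real \<Rightarrow> real" where
  "sampled_tau \<rho> n d = (1 / (sqrt 2 * sqrt (\<Sum>i=1..n. \<Sum>j=1..n. (\<rho> ((real j - real i) * d))\<^sup>2))) ^ 3 *
     (\<Sum>i=1..n. \<Sum>j=1..n. \<Sum>k=1..n. \<rho> ((real j - real i) * d) * \<rho> ((real k - real i) * d) * \<rho> ((real k - real j) * d))"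

text \<open>\<open>tr R\<^sup>2 \<ge> \<eta> v\<^sup>2 n\<^sup>2 / (2 T)\<close> and \<open>tr R\<^sup>3 \<le> n B\<^sup>2\<close> with row sums \<open>B\<close> of order \<open>(Q + T e\<^sup>3\<^sup>/\<^sup>2) / d\<close>. The powers of \<open>n\<close> and \<open>d\<close> combine to \<open>T\<^sup>-\<^sup>1\<^sup>/\<^sup>2\<close>.\<close>

lemma sampled_tau_le:
  fixes \<rho> :: "real \<Rightarrow> real"
  assumes c: "continuous_on UNIV \<rho>" and even: "\<And>t. \<rho> (- t) = \<rho> t"
    and d: "0 < d" "2 * d \<le> \<eta>" and n: "2 * \<eta> \<le> real n * d" and v: "v > 0"
    and near: "\<And>t. \<bar>t\<bar> \<le> \<eta> \<Longrightarrow> v \<le> \<rho> t"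
    and e: "e \<ge> 0" and osc: "\<And>s t. \<bar>s - t\<bar> \<le> d \<Longrightarrow> \<bar>\<rho> s - \<rho> t\<bar> \<le> e"
  defines "T \<equiv> real n * d"
  defines "Q \<equiv> integral {0..T} (\<lambda>t. sqrt \<bar>\<rho> t\<bar> ^ 3)"
  shows "sampled_tau \<rho> n d \<le> 72 / sqrt (\<eta> * v\<^sup>2) ^ 3 * (Q\<^sup>2 / sqrt T + T * sqrt T * e ^ 3)"
proof -
  have \<eta>: "\<eta> > 0" using d by linarith
  have T: "T > 0" using n \<eta> by (simp add: T_def)
  then have n0: "real n > 0" using d by (simp add: T_def zero_less_mult_iff)
  define \<kappa> where "\<kappa> = sqrt (\<eta> * v\<^sup>2)"
  have \<kappa>: "\<kappa> > 0" using \<eta> v by (simp add: \<kappa>_def)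
  define X where "X = sqrt 2 * sqrt (\<Sum>i=1..n. \<Sum>j=1..n. (\<rho> ((real j - real i) * d))\<^sup>2)"
  define Tr where "Tr = (\<Sum>i=1..n. \<Sum>j=1..n. \<Sum>k=1..n. \<rho> ((real j - real i) * d) * \<rho> ((real k - real i) * d) * \<rho> ((real k - real j) * d))"
  have X: "X \<ge> \<kappa> * real n / sqrt T"
  proof -
    have "(\<kappa> * real n / sqrt T)\<^sup>2 = 2 * (\<eta> * v\<^sup>2 / 2 * (real n)\<^sup>2 / (real n * d))"
      using T \<eta> by (simp add: \<kappa>_def power_divide power_mult_distrib T_def)
    also have "\<dots> \<le> 2 * (\<Sum>i=1..n. \<Sum>j=1..n. (\<rho> ((real j - real i) * d))\<^sup>2)"
      by (intro mult_left_mono sum_square_lower_bound d n v near) auto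
    finally show ?thesis unfolding X_def real_sqrt_mult[symmetric] by (rule real_le_rsqrt)
  qed
  have X0: "\<kappa> * real n / sqrt T > 0" using \<kappa> n0 T by simp
  have "1 / X \<le> 1 / (\<kappa> * real n / sqrt T)" by (rule frac_le[OF _ _ X0 X]) auto
  moreover have "X > 0" using X X0 by linarith
  ultimately have a: "1 / X \<le> sqrt T / (\<kappa> * real n)" "0 \<le> 1 / X" by auto
  define B where "B = 6 / d * (Q + T * sqrt e ^ 3)"
  have Q: "Q \<ge> 0" unfolding Q_def by (intro Henstock_Kurzweil_Integration.integral_nonneg integrable_continuous_real)
      (auto intro!: continuous_intros continuous_on_subset[OF c])
  have B0: "B \<ge> 0" using Q T e d by (simp add: B_def)
  have "d * (\<Sum>m<n. sqrt \<bar>\<rho> (real m * d)\<bar> ^ 3) \<le> integral {0..T} (\<lambda>t. 3 * (sqrt \<bar>\<rho> t\<bar> ^ 3 + sqrt e ^ 3))"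
    unfolding T_def by (rule riemann_sum_le[OF c d(1) e osc])
  also have "\<dots> = 3 * (Q + T * sqrt e ^ 3)"
  proof -
    have "(\<lambda>t. 3 * sqrt \<bar>\<rho> t\<bar> ^ 3) integrable_on {0..T}"
      by (intro integrable_continuous_real continuous_intros continuous_on_subset[OF c]) auto
    then have "integral {0..T} (\<lambda>t. 3 * sqrt \<bar>\<rho> t\<bar> ^ 3 + 3 * sqrt e ^ 3)
        = integral {0..T} (\<lambda>t. 3 * sqrt \<bar>\<rho> t\<bar> ^ 3) + integral {0..T} (\<lambda>t. 3 * sqrt e ^ 3)"
      by (rule Henstock_Kurzweil_Integration.integral_add) (rule integrable_const_ivl)
    then show ?thesis using T unfolding Q_def by (simp add: distrib_left)
  qed
  finally have sB: "2 * (\<Sum>m<n. sqrt \<bar>\<rho> (real m * d)\<bar> ^ 3) \<le> B"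
    unfolding B_def using d by (simp add: field_simps)
  have "Tr \<le> card {1..n} * B\<^sup>2"
    unfolding Tr_def
  proof (rule trace_cube_le[where R="\<lambda>i j. \<rho> ((real j - real i) * d)"])
    show "\<rho> ((real j - real i) * d) = \<rho> ((real i - real j) * d)" for i j
      using even[of "(real i - real j) * d"] by (simp add: algebra_simps)
    fix i assume i: "i \<in> {1..n}"
    have ab: "\<rho> ((real j - real i) * d) = \<rho> (real_of_int \<bar>int j - int i\<bar> * d)" for j
      using even[of "(real i - real j) * d"] by (auto simp: abs_if algebra_simps)
    show "(\<Sum>j=1..n. sqrt \<bar>\<rho> ((real j - real i) * d)\<bar> ^ 3) \<le> B"
      unfolding ab using row_sum_le[of "\<lambda>t. sqrt \<bar>\<rho> t\<bar> ^ 3" i n d] i sB by simp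
  qed (use B0 in auto)
  then have Tr: "Tr \<le> real n * B\<^sup>2" by simp
  have "sampled_tau \<rho> n d = (1 / X) ^ 3 * Tr" unfolding sampled_tau_def X_def Tr_def ..
  also have "\<dots> \<le> (1 / X) ^ 3 * (real n * B\<^sup>2)" using a by (intro mult_left_mono Tr) auto
  also have "\<dots> \<le> (sqrt T / (\<kappa> * real n)) ^ 3 * (real n * B\<^sup>2)"
    using a n0 by (intro mult_right_mono power_mono) auto
  also have "\<dots> = 36 / \<kappa> ^ 3 * (sqrt T ^ 3 / T\<^sup>2) * (Q + T * sqrt e ^ 3)\<^sup>2"
  proof -
    have "(x / (\<kappa> * real n)) ^ 3 * (real n * (6 / d * w)\<^sup>2) = 36 / \<kappa> ^ 3 * (x ^ 3 / T\<^sup>2) * w\<^sup>2" for x w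
      unfolding T_def using n0 d \<kappa> by (simp add: field_simps power2_eq_square power3_eq_cube)
    then show ?thesis unfolding B_def .
  qed
  also have "sqrt T ^ 3 / T\<^sup>2 = 1 / sqrt T"
  proof -
    have "T\<^sup>2 = sqrt T ^ 4" using T by (simp add: power4_eq_xxxx power2_eq_square)
    then show ?thesis using T by (simp add: power4_eq_xxxx power3_eq_cube)
  qed
  also have "36 / \<kappa> ^ 3 * (1 / sqrt T) * (Q + T * sqrt e ^ 3)\<^sup>2 \<le> 36 / \<kappa> ^ 3 * (1 / sqrt T) * (2 * Q\<^sup>2 + 2 * (T * sqrt e ^ 3)\<^sup>2)"
  proof (intro mult_left_mono)
    show "(Q + T * sqrt e ^ 3)\<^sup>2 \<le> 2 * Q\<^sup>2 + 2 * (T * sqrt e ^ 3)\<^sup>2"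
      using sum_squares_bound[of Q "T * sqrt e ^ 3"] by (simp add: power2_sum)
  qed (use \<kappa> T in auto)
  also have "(T * sqrt e ^ 3)\<^sup>2 = T\<^sup>2 * e ^ 3"
  proof -
    have "(sqrt e ^ 3)\<^sup>2 = (sqrt e ^ 2) ^ 3" by (simp only: power_mult[symmetric] mult.commute)
    then show ?thesis using e by (simp add: power_mult_distrib)
  qed
  also have "36 / \<kappa> ^ 3 * (1 / sqrt T) * (2 * Q\<^sup>2 + 2 * (T\<^sup>2 * e ^ 3)) = 72 / \<kappa> ^ 3 * (Q\<^sup>2 / sqrt T + T * (T / sqrt T) * e ^ 3)"
    using \<kappa> T by (simp add: field_simps power2_eq_square)
  also have "T / sqrt T = sqrt T" using T by (simp add: real_div_sqrt)
  finally show ?thesis by (simp add: \<kappa>_def)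
qed

section \<open>Sampling a stationary Gaussian process\<close>

locale stationary_gaussian = prob_space M for M :: "'a measure" +
  fixes Z :: "real \<Rightarrow> 'a \<Rightarrow> real"
  assumes centered_Z: "centered_process M Z"
    and stationary_Z: "stationary_process M Z"
    and gaussian_Z: "gaussian_process M Z"
    and f_Z_pos: "f_Z M Z > 0"
begin

abbreviation "\<rho> \<equiv> autocov M Z"

lemma gaussian_rv_Z: "t \<ge> 0 \<Longrightarrow> gaussian_rv M (Z t)"
  using gaussian_Z[unfolded gaussian_process_def, rule_format, of "{t}" "\<lambda>_. 1"] by simp

lemma all_moments_Z: "t \<ge> 0 \<Longrightarrow> all_moments M (Z t)"
  using centered_gaussian_rv(1)[OF gaussian_rv_Z] centered_Z by (simp add: centered_process_def)

lemma measurable_Z: "t \<ge> 0 \<Longrightarrow> Z t \<in> borel_measurable M"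
  using all_moments_Z all_moments_measurable by blast

lemma autocov_0: "\<rho> 0 = f_Z M Z"
  by (simp add: autocov_def f_Z_def power2_eq_square)

lemma autocov_minus: "\<rho> (- t) = \<rho> t"
  by (simp add: autocov_def)

lemma covariance_eq_autocov:
  assumes "s \<ge> 0" "t \<ge> 0"
  shows "expectation (\<lambda>\<omega>. Z s \<omega> * Z t \<omega>) = \<rho> (t - s)"
proof -
  have le: "expectation (\<lambda>\<omega>. Z s \<omega> * Z t \<omega>) = \<rho> (t - s)" if st: "0 \<le> s" "s \<le> t" for s t
  proof -
    let ?I = "{0, t - s}"
    have m: "(\<lambda>\<omega>. \<lambda>u\<in>?I. Z (u + h) \<omega>) \<in> measurable M (PiM ?I (\<lambda>_. borel))" if "h \<ge> 0" for h
      using st that by (intro measurable_restrict) (auto intro: measurable_Z)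
    have f: "(\<lambda>x. x 0 * x (t - s)) \<in> borel_measurable (PiM ?I (\<lambda>_. borel :: real measure))"
      by (intro borel_measurable_times measurable_component_singleton) auto
    have "distr M (PiM ?I (\<lambda>_. borel)) (\<lambda>\<omega>. \<lambda>u\<in>?I. Z (u + s) \<omega>) = distr M (PiM ?I (\<lambda>_. borel)) (\<lambda>\<omega>. \<lambda>u\<in>?I. Z u \<omega>)"
      using stationary_Z[unfolded stationary_process_def, rule_format, of ?I s] st by simp
    then have "(\<integral>x. x 0 * x (t - s) \<partial>distr M (PiM ?I (\<lambda>_. borel)) (\<lambda>\<omega>. \<lambda>u\<in>?I. Z (u + s) \<omega>))
      = (\<integral>x. x 0 * x (t - s) \<partial>distr M (PiM ?I (\<lambda>_. borel)) (\<lambda>\<omega>. \<lambda>u\<in>?I. Z u \<omega>))" by simp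
    then show ?thesis using st by (simp add: integral_distr[OF m f] integral_distr[OF m[of 0, simplified] f] autocov_def)
  qed
  show ?thesis
  proof (cases "s \<le> t")
    case True then show ?thesis using le assms by simp
  next
    case False
    then have "expectation (\<lambda>\<omega>. Z t \<omega> * Z s \<omega>) = \<rho> (s - t)" using le[of t s] assms by simp
    then show ?thesis using autocov_minus[of "s - t"] by (simp add: mult.commute)
  qed
qed

lemma sample_gaussian_quadratic:
  assumes d: "d > 0" and n: "n \<ge> 1"
  shows "gaussian_quadratic M {1..n} (\<lambda>k. Z (real k * d))"
proof -
  interpret gaussian_vector M "{1..n}" "\<lambda>k. Z (real k * d)"
  proof
    fix u :: "nat \<Rightarrow> real"
    let ?f = "\<lambda>k :: nat. real k * d"
    have inj: "inj_on ?f {1..n}" using d by (auto simp: inj_on_def)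
    have "(\<Sum>t\<in>?f ` {1..n}. u (inv_into {1..n} ?f t) * Z t \<omega>) = (\<Sum>k=1..n. u k * Z (real k * d) \<omega>)" for \<omega>
      unfolding sum.reindex[OF inj] o_def by (intro sum.cong refl) (simp only: inv_into_f_f[OF inj])
    note eq = this
    have "gaussian_rv M (\<lambda>\<omega>. \<Sum>t\<in>?f ` {1..n}. u (inv_into {1..n} ?f t) * Z t \<omega>)"
      by (rule gaussian_Z[unfolded gaussian_process_def, rule_format]) (use d in auto)
    then show "gaussian_rv M (\<lambda>\<omega>. \<Sum>k=1..n. u k * Z (real k * d) \<omega>)" by (simp only: eq)
    show "expectation (Z (real k * d)) = 0" for k
      using centered_Z d by (simp add: centered_process_def)
  qed auto
  show ?thesis
  proof
    fix i assume "i \<in> {1..n}"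
    have "R i i = f_Z M Z" unfolding R_def using covariance_eq_autocov[of "real i * d" "real i * d"] d autocov_0 by simp
    then show "R i i > 0" using f_Z_pos by simp
  qed (use n in auto)
qed

text \<open>The estimation error is \<open>F / (a n)\<close>. As \<open>F\<close> has mean \<open>0\<close> and variance \<open>1\<close>, its standard deviation is \<open>1 / (a n)\<close>, and the normalized
error is \<open>F\<close> itself.\<close>

theorem normalized_error_bound:
  assumes d: "\<Delta> n > 0" and n: "n \<ge> 1" and N: "prob_space N" and G: "distributed N lborel G std_normal_density"
  shows "d_TV M (normalized_error M Z \<Delta> n) N G \<le> 28 * sampled_tau \<rho> n (\<Delta> n)"
    and "d_W M (normalized_error M Z \<Delta> n) N G \<le> ereal (28 * sampled_tau \<rho> n (\<Delta> n))"
    and "sampled_tau \<rho> n (\<Delta> n) \<le> 1" "0 \<le> sampled_tau \<rho> n (\<Delta> n)"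
proof -
  interpret gq: gaussian_quadratic M "{1..n}" "\<lambda>k. Z (real k * \<Delta> n)"
    by (rule sample_gaussian_quadratic[OF d n])
  have R: "gq.R i j = \<rho> ((real j - real i) * \<Delta> n)" for i j
    unfolding gq.R_def using covariance_eq_autocov[of "real i * \<Delta> n" "real j * \<Delta> n"] d by (simp add: algebra_simps)
  have Rii: "gq.R i i = f_Z M Z" for i by (simp add: R autocov_0)
  have t: "gq.\<tau> = sampled_tau \<rho> n (\<Delta> n)"
    unfolding gq.\<tau>_def gq.a_def gq.frob_def sampled_tau_def R ..
  have an: "gq.a * real n > 0" using gq.a_pos n by simp
  have X: "f_tilde Z \<Delta> n \<omega> - f_Z M Z = gq.F (gq.vec \<omega>) / (gq.a * real n)" for \<omega>
  proof -
    have "gq.F (gq.vec \<omega>) = gq.a * ((\<Sum>k=1..n. (Z (real k * \<Delta> n) \<omega>)\<^sup>2) - real n * f_Z M Z)"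
      by (simp add: gq.F_def gq.vec_def Rii sum_subtractf del: One_nat_def)
    moreover have "1 / m * x - z = (A * (x - m * z)) / (A * m)" if "A > 0" "m > 0" for A m x z :: real
      using that by (simp add: field_simps)
    ultimately show ?thesis using n gq.a_pos by (simp add: f_tilde_def del: One_nat_def)
  qed
  have EF: "gq.EE gq.F = 0" using gq.stein_identity_F[of "\<lambda>_. 1" "\<lambda>_. 0" 1 0] by simp
  have "variance (\<lambda>\<omega>. f_tilde Z \<Delta> n \<omega> - f_Z M Z) = gq.EE (\<lambda>z. (gq.F z)\<^sup>2) / (gq.a * real n)\<^sup>2"
    by (simp add: X EF power_divide del: One_nat_def)
  also have "\<dots> = 1 / (gq.a * real n)\<^sup>2" by (simp only: gq.EE_F_square)
  finally have sd: "sqrt (variance (\<lambda>\<omega>. f_tilde Z \<Delta> n \<omega> - f_Z M Z)) = 1 / (gq.a * real n)"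
    using an by (simp add: real_sqrt_divide)
  have e: "normalized_error M Z \<Delta> n = (\<lambda>\<omega>. gq.F (gq.vec \<omega>))"
  proof
    fix \<omega>
    have "x / p / (1 / p) = x" if "p > 0" for x p :: real using that by simp
    from this[OF an] show "normalized_error M Z \<Delta> n \<omega> = gq.F (gq.vec \<omega>)"
      unfolding normalized_error_def unfolding sd unfolding X .
  qed
  show "d_TV M (normalized_error M Z \<Delta> n) N G \<le> 28 * sampled_tau \<rho> n (\<Delta> n)"
    unfolding e t[symmetric] by (rule gq.d_TV_bound[OF N G])
  show "d_W M (normalized_error M Z \<Delta> n) N G \<le> ereal (28 * sampled_tau \<rho> n (\<Delta> n))"
    unfolding e t[symmetric] by (rule gq.d_W_bound[OF G])
  show "sampled_tau \<rho> n (\<Delta> n) \<le> 1" "0 \<le> sampled_tau \<rho> n (\<Delta> n)"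
    unfolding t[symmetric] by (rule gq.tau_le_1 gq.tau_nonneg)+
qed

text \<open>\<open>\<rho> s - \<rho> t = E[Z\<^sub>0 (Z\<^sub>s - Z\<^sub>t)]\<close>. Young's inequality with the weight \<open>\<bar>s - t\<bar>\<^sup>\<alpha>\<close> stands in for the Cauchy-Schwarz inequality.\<close>

lemma autocov_hoelder:
  assumes c: "c > 0" and \<alpha>: "\<alpha> > 0"
    and inc: "\<And>s t. s \<ge> 0 \<Longrightarrow> t \<ge> 0 \<Longrightarrow> \<bar>t - s\<bar> < \<delta> \<Longrightarrow> expectation (\<lambda>\<omega>. \<bar>Z t \<omega> - Z s \<omega>\<bar>\<^sup>2) \<le> c * \<bar>t - s\<bar> powr (2 * \<alpha>)"
    and st: "\<bar>s - t\<bar> < \<delta>"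
  shows "\<bar>\<rho> s - \<rho> t\<bar> \<le> (f_Z M Z + c) * \<bar>s - t\<bar> powr \<alpha>"
proof -
  define u v where "u = \<bar>s\<bar>" and "v = \<bar>t\<bar>"
  have uv: "u \<ge> 0" "v \<ge> 0" "\<bar>u - v\<bar> \<le> \<bar>s - t\<bar>" by (auto simp: u_def v_def)
  have "\<bar>\<rho> s - \<rho> t\<bar> \<le> (f_Z M Z + c) * \<bar>u - v\<bar> powr \<alpha>"
  proof (cases "u = v")
    case True
    then show ?thesis by (simp add: autocov_def u_def v_def)
  next
    case False
    define l where "l = \<bar>u - v\<bar> powr \<alpha>"
    have l: "l > 0" using False by (simp add: l_def)
    have mz: "all_moments M (Z 0)" "all_moments M (Z u)" "all_moments M (Z v)" using uv by (auto intro: all_moments_Z)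
    note mi = all_moments_mult all_moments_diff all_moments_power all_moments_add all_moments_const all_moments_abs mz
    have young: "p * q \<le> l * p\<^sup>2 + 1 / l * q\<^sup>2" if "p \<ge> 0" "q \<ge> 0" for p q
    proof -
      have "2 * (l * p) * q \<le> (l * p)\<^sup>2 + q\<^sup>2" by (rule sum_squares_bound)
      moreover have "0 \<le> l * p * q" using l that by simp
      ultimately have "l * p * q \<le> (l * p)\<^sup>2 + q\<^sup>2" by linarith
      then show ?thesis using l by (simp add: field_simps power2_eq_square)
    qed
    have "\<rho> s = expectation (\<lambda>\<omega>. Z 0 \<omega> * Z u \<omega>)" "\<rho> t = expectation (\<lambda>\<omega>. Z 0 \<omega> * Z v \<omega>)"
      by (simp_all add: autocov_def u_def v_def)
    then have "\<rho> s - \<rho> t = expectation (\<lambda>\<omega>. Z 0 \<omega> * (Z u \<omega> - Z v \<omega>))"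
      unfolding right_diff_distrib
      by (subst Bochner_Integration.integral_diff) (auto intro!: all_moments_integrable mi)
    also have "\<bar>\<dots>\<bar> \<le> expectation (\<lambda>\<omega>. \<bar>Z 0 \<omega> * (Z u \<omega> - Z v \<omega>)\<bar>)" by (rule integral_abs_bound)
    also have "\<dots> \<le> expectation (\<lambda>\<omega>. l * (Z 0 \<omega>)\<^sup>2 + 1 / l * (Z u \<omega> - Z v \<omega>)\<^sup>2)"
    proof (rule integral_mono)
      fix \<omega> let ?a = "\<bar>Z 0 \<omega>\<bar>" and ?b = "\<bar>Z u \<omega> - Z v \<omega>\<bar>"
      have "?a * ?b \<le> l * ?a\<^sup>2 + 1 / l * ?b\<^sup>2" by (rule young) auto
      then show "\<bar>Z 0 \<omega> * (Z u \<omega> - Z v \<omega>)\<bar> \<le> l * (Z 0 \<omega>)\<^sup>2 + 1 / l * (Z u \<omega> - Z v \<omega>)\<^sup>2"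
        by (simp add: abs_mult)
    qed (intro all_moments_integrable mi)+
    also have "\<dots> = l * f_Z M Z + 1 / l * expectation (\<lambda>\<omega>. (Z u \<omega> - Z v \<omega>)\<^sup>2)"
    proof -
      have "integrable M (\<lambda>\<omega>. (Z 0 \<omega>)\<^sup>2)" "integrable M (\<lambda>\<omega>. (Z u \<omega> - Z v \<omega>)\<^sup>2)"
        by (intro all_moments_integrable mi)+
      then show ?thesis by (subst Bochner_Integration.integral_add) (auto simp: f_Z_def)
    qed
    also have "\<dots> \<le> l * f_Z M Z + 1 / l * (c * l\<^sup>2)"
    proof -
      have "expectation (\<lambda>\<omega>. (Z u \<omega> - Z v \<omega>)\<^sup>2) \<le> c * \<bar>u - v\<bar> powr (2 * \<alpha>)"
        using inc[of v u] uv st by simp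
      also have "\<bar>u - v\<bar> powr (2 * \<alpha>) = l\<^sup>2" using False
        by (simp add: l_def powr_powr[symmetric] powr_numeral mult.commute[of 2])
      finally show ?thesis using l by (intro add_left_mono mult_left_mono) auto
    qed
    also have "\<dots> = (f_Z M Z + c) * l" using l by (simp add: field_simps power2_eq_square)
    finally show ?thesis by (simp add: l_def)
  qed
  also have "\<dots> \<le> (f_Z M Z + c) * \<bar>s - t\<bar> powr \<alpha>"
    using uv c \<alpha> f_Z_pos by (intro mult_left_mono powr_mono2) auto
  finally show ?thesis .
qed

end

theorem theorem1p2:
  fixes M :: "'a measure" and Z :: "real \<Rightarrow> 'a \<Rightarrow> real"
    and N :: "'b measure" and G :: "'b \<Rightarrow> real"
    and \<Delta> :: "nat \<Rightarrow> real" and c \<alpha> :: real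
  assumes "prob_space M"
    and "continuous_process M Z"
    and "centered_process M Z"
    and "stationary_process M Z"
    and "gaussian_process M Z"
    and "f_Z M Z > 0"
    and "integrable lborel (\<lambda>r. (autocov M Z r)\<^sup>2)"
    and "c > 0" and "0 < \<alpha>" and "\<alpha> < 1"
    and "\<exists>\<delta>>0. \<forall>s\<ge>0. \<forall>t\<ge>0. \<bar>t - s\<bar> < \<delta> \<longrightarrow>
           (\<integral>\<omega>. \<bar>Z t \<omega> - Z s \<omega>\<bar>\<^sup>2 \<partial>M) \<le> c * \<bar>t - s\<bar> powr (2 * \<alpha>)"
    and "prob_space N"
    and "distributed N lborel G std_normal_density"
    and "\<And>n. n \<ge> 1 \<Longrightarrow> \<Delta> n > 0"
    and "\<Delta> \<longlonglongrightarrow> 0"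
    and "filterlim (\<lambda>n. real n * \<Delta> n) at_top sequentially"
  shows "(\<exists>C>0. \<forall>n\<ge>1.
            d_TV M (normalized_error M Z \<Delta> n) N G
            \<le> \<phi> C M Z (real n * \<Delta> n)
              + 2 * \<bar>1 - prob_space.variance M (\<lambda>\<omega>. f_hat Z (real n * \<Delta> n) \<omega> - f_Z M Z)
                        / prob_space.variance M (\<lambda>\<omega>. f_tilde Z \<Delta> n \<omega> - f_Z M Z)\<bar>
              + C * (real n * \<Delta> n powr (2 * \<alpha> + 1)) powr (1/4)) \<and>
         (\<exists>C>0. \<forall>n\<ge>1.
            d_W M (normalized_error M Z \<Delta> n) N G
            \<le> ereal (\<phi> C M Z (real n * \<Delta> n)
              + 2 * \<bar>1 - prob_space.variance M (\<lambda>\<omega>. f_hat Z (real n * \<Delta> n) \<omega> - f_Z M Z)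
                        / prob_space.variance M (\<lambda>\<omega>. f_tilde Z \<Delta> n \<omega> - f_Z M Z)\<bar>
              + C * (real n * \<Delta> n powr (2 * \<alpha> + 1)) powr (1/4)))"
proof -
  interpret stationary_gaussian M Z
    using assms by (intro stationary_gaussian.intro stationary_gaussian_axioms.intro)
  obtain \<delta> where \<delta>: "\<delta> > 0" and inc: "\<And>s t. s \<ge> 0 \<Longrightarrow> t \<ge> 0 \<Longrightarrow> \<bar>t - s\<bar> < \<delta> \<Longrightarrow>
      expectation (\<lambda>\<omega>. \<bar>Z t \<omega> - Z s \<omega>\<bar>\<^sup>2) \<le> c * \<bar>t - s\<bar> powr (2 * \<alpha>)"
    using assms(11) by blast
  define C1 where "C1 = f_Z M Z + c"
  have C1: "C1 > 0" using f_Z_pos \<open>c > 0\<close> by (simp add: C1_def)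
  have hoelder: "\<bar>\<rho> s - \<rho> t\<bar> \<le> C1 * \<bar>s - t\<bar> powr \<alpha>" if "\<bar>s - t\<bar> < \<delta>" for s t
    unfolding C1_def by (rule autocov_hoelder[OF \<open>c > 0\<close> \<open>0 < \<alpha>\<close> inc that])
  have unif: "\<exists>h>0. \<forall>s t. \<bar>s - t\<bar> < h \<longrightarrow> \<bar>\<rho> s - \<rho> t\<bar> < \<epsilon>" if \<epsilon>: "\<epsilon> > 0" for \<epsilon>
  proof (intro exI conjI allI impI)
    let ?h = "min \<delta> ((\<epsilon> / (2 * C1)) powr (1 / \<alpha>))"
    show "?h > 0" using \<epsilon> \<delta> C1 by simp
    fix s t assume st: "\<bar>s - t\<bar> < ?h"
    have "\<bar>\<rho> s - \<rho> t\<bar> \<le> C1 * \<bar>s - t\<bar> powr \<alpha>" using st by (intro hoelder) simp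
    also have "\<dots> \<le> C1 * ((\<epsilon> / (2 * C1)) powr (1 / \<alpha>)) powr \<alpha>"
      using st C1 \<open>0 < \<alpha>\<close> by (intro mult_left_mono powr_mono2) auto
    also have "\<dots> = \<epsilon> / 2" using \<open>0 < \<alpha>\<close> C1 \<epsilon> by (simp add: powr_powr)
    finally show "\<bar>\<rho> s - \<rho> t\<bar> < \<epsilon>" using \<epsilon> by simp
  qed
  have cont: "continuous_on UNIV \<rho>"
    unfolding continuous_on_iff dist_real_def using unif by (metis abs_minus_commute)
  define v where "v = f_Z M Z / 2"
  have v: "v > 0" using f_Z_pos by (simp add: v_def)
  obtain h where h: "h > 0" "\<And>s t. \<bar>s - t\<bar> < h \<Longrightarrow> \<bar>\<rho> s - \<rho> t\<bar> < v" using unif[OF v] by blast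
  define \<eta> where "\<eta> = h / 2"
  have \<eta>: "\<eta> > 0" using h by (simp add: \<eta>_def)
  have near: "v \<le> \<rho> t" if "\<bar>t\<bar> \<le> \<eta>" for t
  proof -
    have "\<bar>t - 0\<bar> < h" using that h(1) unfolding \<eta>_def by linarith
    from h(2)[OF this] show ?thesis unfolding v_def autocov_0 by linarith
  qed
  define K where "K = 72 / sqrt (\<eta> * v\<^sup>2) ^ 3"
  have K: "K > 0" using \<eta> v by (simp add: K_def)
  define D where "D n = real n * \<Delta> n powr (2 * \<alpha> + 1)" for n
  have D: "D n > 0" if "n \<ge> 1" for n using assms(14)[OF that] that by (simp add: D_def)
  define I where "I T = (LBINT t:{-T..T}. \<bar>\<rho> t\<bar> powr (3/2))" for T
  have "\<forall>\<^sub>F n in sequentially. \<Delta> n < min \<delta> (\<eta> / 2)"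
    using order_tendstoD(2)[OF assms(15), of "min \<delta> (\<eta> / 2)"] \<delta> \<eta> by simp
  moreover have "\<forall>\<^sub>F n in sequentially. 2 * \<eta> \<le> real n * \<Delta> n"
    using assms(16) by (simp add: filterlim_at_top)
  ultimately have "\<forall>\<^sub>F n in sequentially. \<Delta> n < \<delta> \<and> 2 * \<Delta> n \<le> \<eta> \<and> 2 * \<eta> \<le> real n * \<Delta> n"
    by eventually_elim auto
  then obtain N0 where N0: "\<And>n. n \<ge> N0 \<Longrightarrow> \<Delta> n < \<delta> \<and> 2 * \<Delta> n \<le> \<eta> \<and> 2 * \<eta> \<le> real n * \<Delta> n"
    by (auto simp: eventually_sequentially)
  have large: "sampled_tau \<rho> n (\<Delta> n) \<le> K * ((I (real n * \<Delta> n))\<^sup>2 / sqrt (real n * \<Delta> n)) + (K * C1 ^ 3 + 1) * D n powr (1/4)"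
    if n: "n \<ge> 1" "n \<ge> N0" for n
  proof -
    define d T e where "d = \<Delta> n" and "T = real n * d" and "e = C1 * d powr \<alpha>"
    have d: "d > 0" "d < \<delta>" "2 * d \<le> \<eta>" "2 * \<eta> \<le> real n * d"
      using N0[OF n(2)] assms(14)[OF n(1)] by (auto simp: d_def)
    have T: "T > 0" using d n by (simp add: T_def)
    have e: "e \<ge> 0" using C1 by (simp add: e_def)
    have osc: "\<bar>\<rho> s - \<rho> t\<bar> \<le> e" if "\<bar>s - t\<bar> \<le> d" for s t
    proof -
      have "\<bar>\<rho> s - \<rho> t\<bar> \<le> C1 * \<bar>s - t\<bar> powr \<alpha>" using that d by (intro hoelder) simp
      also have "\<dots> \<le> e" unfolding e_def using that C1 \<open>0 < \<alpha>\<close> by (intro mult_left_mono powr_mono2) auto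
      finally show ?thesis .
    qed
    define Q where "Q = integral {0..T} (\<lambda>t. sqrt \<bar>\<rho> t\<bar> ^ 3)"
    have b: "sampled_tau \<rho> n d \<le> K * (Q\<^sup>2 / sqrt T + T * sqrt T * e ^ 3)"
      unfolding K_def Q_def T_def using sampled_tau_le[OF cont autocov_minus d(1,3,4) v near e osc] .
    have cq: "continuous_on S (\<lambda>t. sqrt \<bar>\<rho> t\<bar> ^ 3)" for S
      by (intro continuous_intros continuous_on_subset[OF cont]) auto
    have IT: "I T = integral {-T..T} (\<lambda>t. sqrt \<bar>\<rho> t\<bar> ^ 3)"
    proof -
      have "I T = (LBINT t:{-T..T}. sqrt \<bar>\<rho> t\<bar> ^ 3)"
        unfolding I_def by (simp add: powr_three_halves)
      also have "\<dots> = integral {-T..T} (\<lambda>t. sqrt \<bar>\<rho> t\<bar> ^ 3)"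
        by (rule set_borel_integral_eq_integral(2)) (rule borel_integrable_atLeastAtMost'[OF cq])
      finally show ?thesis .
    qed
    have "Q \<ge> 0" unfolding Q_def
      by (rule Henstock_Kurzweil_Integration.integral_nonneg) (auto intro!: integrable_continuous_real cq)
    moreover have "Q \<le> I T" unfolding Q_def IT
      by (rule integral_subset_le) (use T in \<open>auto intro!: integrable_continuous_real cq\<close>)
    ultimately have QI: "Q\<^sup>2 / sqrt T \<le> (I T)\<^sup>2 / sqrt T" using T by (intro divide_right_mono power_mono) auto
    show ?thesis
    \<comment> \<open>The error term is of order D powr (3/2): it is below D powr (1/4) if D \<le> 1, and otherwise sampled_tau \<le> 1 is enough.\<close>
    proof (cases "D n \<le> 1")
      case True
      have Dn: "D n = T * (d powr \<alpha>)\<^sup>2"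
      proof -
        have "d powr (2 * \<alpha> + 1) = d powr (\<alpha> + \<alpha> + 1)" by (simp only: mult_2)
        also have "\<dots> = d * (d powr \<alpha>)\<^sup>2" using d by (simp only: powr_add power2_eq_square) simp
        finally show ?thesis by (simp add: D_def T_def d_def)
      qed
      have "T * sqrt T * e ^ 3 = C1 ^ 3 * (sqrt T * sqrt T * sqrt T) * (d powr \<alpha>) ^ 3"
        using T by (simp add: e_def power_mult_distrib)
      also have "\<dots> = C1 ^ 3 * (sqrt T * d powr \<alpha>) ^ 3" by (simp add: power3_eq_cube)
      also have "sqrt T * d powr \<alpha> = sqrt (D n)" unfolding Dn using d by (simp add: real_sqrt_mult)
      also have "sqrt (D n) ^ 3 = D n powr (3/2)" using D[OF n(1)] by (simp add: powr_three_halves)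
      also have "C1 ^ 3 * D n powr (3/2) \<le> C1 ^ 3 * D n powr (1/4)"
        using D[OF n(1)] True C1 by (intro mult_left_mono powr_mono') auto
      finally have "K * (Q\<^sup>2 / sqrt T + T * sqrt T * e ^ 3) \<le> K * ((I T)\<^sup>2 / sqrt T + C1 ^ 3 * D n powr (1/4))"
        using QI K by (intro mult_left_mono add_mono) auto
      moreover have "D n powr (1/4) \<ge> 0" by simp
      ultimately have "sampled_tau \<rho> n d \<le> K * ((I T)\<^sup>2 / sqrt T + C1 ^ 3 * D n powr (1/4)) + D n powr (1/4)"
        using b by linarith
      also have "\<dots> = K * ((I T)\<^sup>2 / sqrt T) + (K * C1 ^ 3 + 1) * D n powr (1/4)"
        by (simp add: distrib_left distrib_right mult.assoc)
      finally show ?thesis unfolding T_def d_def .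
    next
      case False
      have "sampled_tau \<rho> n (\<Delta> n) \<le> 1" by (rule normalized_error_bound(3)[of \<Delta> n N G, OF assms(14)[OF n(1)] n(1) assms(12,13)])
      also have "1 \<le> D n powr (1/4)" using False by (intro ge_one_powr_ge_zero) auto
      finally have "sampled_tau \<rho> n (\<Delta> n) \<le> D n powr (1/4)" .
      moreover have "0 \<le> K * ((I (real n * \<Delta> n))\<^sup>2 / sqrt (real n * \<Delta> n))" "0 \<le> K * C1 ^ 3 * D n powr (1/4)"
        using K C1 T by (auto simp: T_def d_def)
      ultimately show ?thesis by (simp add: distrib_right)
    qed
  qed
  \<comment> \<open>The last sum takes care of the finitely many n below N0, for which only sampled_tau \<le> 1 is used.\<close>
  define C where "C = 28 * K + 28 * (K * C1 ^ 3 + 1) + (\<Sum>n=1..N0. 28 / D n powr (1/4))"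
  have Csum: "0 \<le> (\<Sum>n=1..N0. 28 / D n powr (1/4))" by (intro sum_nonneg) auto
  have CK: "28 * K \<le> C" "28 * (K * C1 ^ 3 + 1) \<le> C" "C > 0"
    using K C1 Csum unfolding C_def by (auto intro!: add_nonneg_nonneg mult_nonneg_nonneg add_pos_nonneg)
  have main: "28 * sampled_tau \<rho> n (\<Delta> n) \<le> \<phi> C M Z (real n * \<Delta> n) + C * (D n) powr (1/4)" if n: "n \<ge> 1" for n
  proof -
    let ?T = "real n * \<Delta> n"
    have T: "?T > 0" using assms(14)[OF n] n by simp
    have "C * ((I ?T)\<^sup>2 / sqrt ?T) \<le> C * (8 / sqrt ?T * (I ?T)\<^sup>2)"
      using CK T by (intro mult_left_mono) (auto simp: field_simps)
    also have "\<dots> \<le> \<phi> C M Z ?T" unfolding \<phi>_def I_def using CK by (intro mult_left_mono) auto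
    finally have p: "C * ((I ?T)\<^sup>2 / sqrt ?T) \<le> \<phi> C M Z ?T" .
    have I0: "0 \<le> (I ?T)\<^sup>2 / sqrt ?T" using T by simp
    show ?thesis
    proof (cases "n \<ge> N0")
      case True
      have "28 * sampled_tau \<rho> n (\<Delta> n) \<le> (28 * K) * ((I ?T)\<^sup>2 / sqrt ?T) + (28 * (K * C1 ^ 3 + 1)) * D n powr (1/4)"
        using large[OF n True] by linarith
      also have "\<dots> \<le> C * ((I ?T)\<^sup>2 / sqrt ?T) + C * D n powr (1/4)"
        using CK I0 by (intro add_mono mult_right_mono) auto
      finally show ?thesis using p by linarith
    next
      case False
      have "28 * sampled_tau \<rho> n (\<Delta> n) \<le> 28"
        using normalized_error_bound(3)[of \<Delta> n N G, OF assms(14)[OF n] n assms(12,13)] by simp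
      also have "28 = 28 / D n powr (1/4) * D n powr (1/4)" using D[OF n] by simp
      also have "\<dots> \<le> C * D n powr (1/4)"
      proof (rule mult_right_mono)
        have "28 / D n powr (1/4) \<le> (\<Sum>n=1..N0. 28 / D n powr (1/4))"
          using False n by (intro member_le_sum[of n _ "\<lambda>n. 28 / D n powr (1/4)"]) auto
        also have "\<dots> \<le> C" unfolding C_def using K C1 by simp
        finally show "28 / D n powr (1/4) \<le> C" .
      qed simp
      moreover have "0 \<le> C * ((I ?T)\<^sup>2 / sqrt ?T)" using CK(3) by (intro mult_nonneg_nonneg I0) simp
      ultimately show ?thesis using p by linarith
    qed
  qed
  let ?r = "\<lambda>n. 2 * \<bar>1 - variance (\<lambda>\<omega>. f_hat Z (real n * \<Delta> n) \<omega> - f_Z M Z) / variance (\<lambda>\<omega>. f_tilde Z \<Delta> n \<omega> - f_Z M Z)\<bar>"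
  have bound: "28 * sampled_tau \<rho> n (\<Delta> n) \<le> \<phi> C M Z (real n * \<Delta> n) + ?r n + C * (real n * \<Delta> n powr (2 * \<alpha> + 1)) powr (1/4)"
    if "n \<ge> 1" for n
  proof -
    have "x \<le> p + 2 * \<bar>r\<bar> + q" if "x \<le> p + q" for x p q r :: real using that by simp
    from this[OF main[OF that]] show ?thesis unfolding D_def .
  qed
  show ?thesis
  proof (intro conjI exI[of _ C] allI impI CK(3))
    fix n :: nat assume n: "1 \<le> n"
    note b = normalized_error_bound[of \<Delta> n N G, OF assms(14)[OF n] n assms(12,13)]
    show "d_TV M (normalized_error M Z \<Delta> n) N G
        \<le> \<phi> C M Z (real n * \<Delta> n) + ?r n + C * (real n * \<Delta> n powr (2 * \<alpha> + 1)) powr (1/4)"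
      by (rule order_trans[OF b(1) bound[OF n]])
    show "d_W M (normalized_error M Z \<Delta> n) N G
        \<le> ereal (\<phi> C M Z (real n * \<Delta> n) + ?r n + C * (real n * \<Delta> n powr (2 * \<alpha> + 1)) powr (1/4))"
      by (rule order_trans[OF b(2)]) (simp only: ereal_less_eq bound[OF n])
  qed
qed

end
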